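(* There exists a positive absolute constant $c$ such that if $K$ is a planar convex body with $\delta_{\rm BM}(K,T^2)=1+\delta$ for some $\delta>0$, and $p\geq 1$, then $$\mathbb{E}^p_*(K)\leq(1-c^p\delta^2)\,\mathbb{E}^p_*(T^2),$$ $$\mathbb{E}^p_3(K)\leq(1-c^p\delta^2)\,\mathbb{E}^p_3(T^2).$$ This estimate is asymptotically sharp as $\delta$ tends to zero, in the sense that the exponent $2$ of $\delta$ is optimal: for any $p\geq 1$, in neither of the two inequalities can the error term $c^p\delta^2$ be replaced by $c'\delta^q$ with some $q<2$ and some constant $c'>0$ (possibly depending on $p$ and $q$) so that the inequality still holds for all planar convex bodies $K$ with $\delta$ sufficiently small.
   Context: A planar convex body is a compact convex set in $\mathbb{R}^2$ with nonempty interior. $T^2$ denotes a triangle (the quantities below are invariant under non-singular affine maps, so the choice is irrelevant). $V$ is area, $[x_1,\ldots,x_n]$ denotes the convex hull of the points, and $\gamma(K)$ is the centroid of $K$. For a planar convex body $K$ and $p>0$, set $$\mathbb{E}^p_3(K)=V(K)^{-3-p}\int_K\int_K\int_K V([x_1,x_2,x_3])^p\,dx_1dx_2dx_3,$$ $$\mathbb{E}^p_*(K)=V(K)^{-2-p}\int_K\int_K V([\gamma(K),x_1,x_2])^p\,dx_1dx_2.$$ The Banach-Mazur distance of planar convex bodies $K,M$ is $$\delta_{\rm BM}(K,M)=\min\{\lambda\geq 1:\ K-x\subset\Phi(M-y)\subset\lambda(K-x)\ \text{for some}\ \Phi\in{\rm GL}_2,\ x,y\in\mathbb{R}^2\}.$$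 *)

theory Defs
  imports "HOL-Analysis.Analysis"
begin

definition planar_convex_body :: "(real^2) set \<Rightarrow> bool" where
  "planar_convex_body K \<longleftrightarrow> compact K \<and> convex K \<and> interior K \<noteq> {}"

definition area :: "(real^2) set \<Rightarrow> real" where
  "area K = measure lborel K"

definition centroid :: "(real^2) set \<Rightarrow> real^2" where
  "centroid K = (1 / area K) *\<^sub>R (LINT x:K|lborel. x)"

(* Degenerate hulls have area 0 and contribute 0 powr p = 0. *)
definition E3 :: "real \<Rightarrow> (real^2) set \<Rightarrow> real" where
  "E3 p K = area K powr (- 3 - p) *
    (LINT x1:K|lborel. LINT x2:K|lborel. LINT x3:K|lborel.
       area (convex hull {x1, x2, x3}) powr p)"

definition Estar :: "real \<Rightarrow> (real^2) set \<Rightarrow> real" where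
  "Estar p K = area K powr (- 2 - p) *
    (LINT x1:K|lborel. LINT x2:K|lborel.
       area (convex hull {centroid K, x1, x2}) powr p)"

(* For planar convex bodies K and M the infimum below is attained, so it is the minimum. *)
definition banach_mazur :: "(real^2) set \<Rightarrow> (real^2) set \<Rightarrow> real" where
  "banach_mazur K M = Inf {l. l \<ge> 1 \<and>
     (\<exists>(A::real^2^2) x y. invertible A \<and>
        (\<lambda>z. z - x) ` K \<subseteq> (\<lambda>z. A *v (z - y)) ` M \<and>
        (\<lambda>z. A *v (z - y)) ` M \<subseteq> (\<lambda>z. l *\<^sub>R (z - x)) ` K)}"

end

theory Submission imports Defs begin

text \<open>
  Both functionals are expectations of \<open>|u|^p\<close>, where \<open>u\<close> is a normalised determinant of points of the
  body. Slide a vertex \<open>A\<close> of a convex polygon parallel to the diagonal joining its neighbours. The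
  polygon is then transformed by an area-preserving map that shears the ear at \<open>A\<close> and fixes the rest,
  each determinant is affine in the sliding parameter, and so the functional is convex in that
  parameter. At the ends of the admissible interval one vertex disappears, whence triangles maximise.

  For stability, measure the distance from triangles by \<open>e\<close>, where \<open>1 + e\<close> is the ratio of the area of
  the body to the maximal area of an inscribed triangle; \<open>e\<close> is comparable to the Banach-Mazur deficit. For polygons
  with at most \<open>N\<close> vertices, induct on \<open>N\<close>. If the ear is thin or the slide is short, one of the ends still
  has a ratio of at least \<open>1 + e / 2\<close>, and the induction hypothesis applies. Otherwise the convexity is
  strict: on a set of points of sufficient measure the affine function \<open>u\<close> changes sign, and this gains
  a term \<open>c^p e^2\<close>. When the ratio is close to \<open>1\<close>, polygons with many vertices reduce to at most nine by sliding
  vertices that are not adjacent to those of a maximal triangle, so \<open>c\<close> does not depend on \<open>N\<close>.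
  Approximation by inscribed polygons gives all convex bodies.

  The exponent is optimal because cutting off a corner of size \<open>r\<close> from a triangle changes the
  functional by \<open>O(r^2)\<close>, but the Banach-Mazur distance by a multiple of \<open>r\<close>.
\<close>

section \<open>Signed areas, affine maps and folds\<close>

text \<open>For p = 1 the integrand is an absolute value, affine along a slide as long as the
  determinant keeps its sign, so there is no pointwise strict convexity. The gain comes from triples
  whose determinant changes sign: integrated along a line across the zero, |u|^p turns into a
  primitive of degree p + 1 >= 2, whose convexity gap is quadratic, uniformly in p >= 1. The gain is
  proportional to the area of the ear times both slide lengths. One length is at least of order e,
  and so is the ear area times the other length; this is the origin of e^2. The estimates need a
  polygon close to its maximal triangle, so the ratio is first made exactly 1 + e: then nothing
  sticks out of the normalised triangle by more than e. The induction halves e and shrinks c with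
  each new vertex, so its constant depends on the number of vertices. The reduction to nine vertices
  removes this dependence. It keeps one triangle fixed, which may cease to be maximal; but the other
  inscribed triangles exceed it only by O(e^2), which is small compared with e.\<close>

definition cr :: "real^2 \<Rightarrow> real^2 \<Rightarrow> real^2 \<Rightarrow> real" where
  "cr X Y Z = (Y$1 - X$1) * (Z$2 - X$2) - (Y$2 - X$2) * (Z$1 - X$1)"

lemma area_triangle: "area (convex hull {X, Y, Z}) = \<bar>cr X Y Z\<bar> / 2"
  unfolding area_def content_triangle cr_def by (simp add: algebra_simps)

lemma continuous_on_cr [continuous_intros]:
  assumes "continuous_on S f" "continuous_on S g" "continuous_on S h"
  shows "continuous_on S (\<lambda>x. cr (f x) (g x) (h x))"
  unfolding cr_def by (intro continuous_intros assms)

lemma vec_nth_measurable [measurable]: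
  assumes "f \<in> borel_measurable M"
  shows "(\<lambda>x. (f x :: real^2) $ i) \<in> borel_measurable M"
proof -
  have "(\<lambda>y::real^2. y $ i) \<in> borel_measurable borel"
    by (intro borel_measurable_continuous_onI continuous_intros)
  from measurable_compose[OF assms this] show ?thesis .
qed

lemma cr_measurable [measurable]:
  assumes [measurable]: "f \<in> borel_measurable M" "g \<in> borel_measurable M" "h \<in> borel_measurable M"
  shows "(\<lambda>x. cr (f x) (g x) (h x)) \<in> borel_measurable M"
  unfolding cr_def by measurable

definition affmap :: "real^2^2 \<Rightarrow> real^2 \<Rightarrow> real^2 \<Rightarrow> real^2" where
  "affmap A u x = A *v x + u"

lemma affmap_nth: "affmap A u x $ 1 = A$1$1 * x$1 + A$1$2 * x$2 + u$1"
  "affmap A u x $ 2 = A$2$1 * x$1 + A$2$2 * x$2 + u$2"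
  by (simp_all add: affmap_def matrix_vector_mult_def sum_2)

lemma cr_affmap: "cr (affmap A u X) (affmap A u Y) (affmap A u Z) = det A * cr X Y Z"
  by (simp add: cr_def affmap_nth det_2 algebra_simps)

lemma affmap_inverse:
  assumes "invertible A"
  obtains B w where "invertible B" "det B = 1 / det A"
    "\<And>x. affmap B w (affmap A u x) = x" "\<And>x. affmap A u (affmap B w x) = x"
proof -
  obtain B where B: "A ** B = mat 1" "B ** A = mat 1" using assms unfolding invertible_def by blast
  have "det A * det B = 1" using B(1) by (metis det_I det_mul)
  then have "det B = 1 / det A" by (metis mult_zero_left nonzero_mult_div_cancel_left zero_neq_one)
  moreover have "affmap B (- (B *v u)) (affmap A u x) = x" for x
    by (simp add: affmap_def matrix_vector_right_distrib matrix_vector_mul_assoc B)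
  moreover have "affmap A u (affmap B (- (B *v u)) x) = x" for x
    by (simp add: affmap_def matrix_vector_right_distrib matrix_vector_mult_diff_distrib matrix_vector_mul_assoc B)
  ultimately show ?thesis using that[of B "- (B *v u)"] B unfolding invertible_def by blast
qed

lemma continuous_on_affmap: "continuous_on S (affmap A u)"
  unfolding affmap_def by (intro continuous_intros)

text \<open>It is enough that the push-forward of Lebesgue measure, given the density |det A|, is
  Lebesgue measure again. \<open>lborel_eqI\<close> reduces this to boxes, and the preimage of a box
  is a translate of a linear image.\<close>

lemma emeasure_vimage_affmap:
  assumes A: "invertible A" and S: "S \<in> sets borel"
  shows "emeasure lborel (affmap A u -` S) = ennreal (1 / \<bar>det A\<bar>) * emeasure lborel S"
proof -
  obtain B w where B: "invertible B" "det B = 1 / det A"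
    and inv: "\<And>x. affmap B w (affmap A u x) = x" "\<And>x. affmap A u (affmap B w x) = x"
    using affmap_inverse[OF A] by blast
  have dA: "det A \<noteq> 0" using A invertible_det_nz by blast
  have meas [measurable]: "affmap A u \<in> borel_measurable borel"
    by (intro borel_measurable_continuous_onI continuous_on_affmap)
  let ?M = "density (distr lborel borel (affmap A u)) (\<lambda>_. ennreal \<bar>det A\<bar>)"
  have "lborel = ?M"
  proof (rule lborel_eqI)
    fix l m :: "real^2" assume lm: "\<And>b. b \<in> Basis \<Longrightarrow> l \<bullet> b \<le> m \<bullet> b"
    have "affmap A u -` box l m = affmap B w ` box l m"
      using inv by (auto simp: image_iff) metis
    also have "\<dots> = (+) w ` ((*v) B ` box l m)"
      by (auto simp: affmap_def image_image add.commute)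
    finally have eq: "affmap A u -` box l m = (+) w ` ((*v) B ` box l m)" .
    have fin: "emeasure lborel (affmap A u -` box l m) < \<infinity>"
      unfolding eq by (intro emeasure_bounded_finite bounded_translation bounded_linear_image)
        (auto simp: matrix_vector_mul_bounded_linear)
    have "measure lborel (affmap A u -` box l m) = measure lebesgue (affmap A u -` box l m)"
      using measurable_sets[OF meas, of "box l m"] by (intro measure_completion[symmetric]) simp
    also have "\<dots> = measure lebesgue ((*v) B ` box l m)"
      unfolding eq by (rule measure_translation)
    also have "\<dots> = \<bar>det B\<bar> * measure lebesgue (box l m)"
      by (subst measure_linear_image) auto
    finally have m: "measure lborel (affmap A u -` box l m) = (\<Prod>b\<in>Basis. (m - l) \<bullet> b) / \<bar>det A\<bar>"
      using lm by (simp add: B abs_divide)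
    have "emeasure lborel (affmap A u -` box l m) = ennreal ((\<Prod>b\<in>Basis. (m - l) \<bullet> b) / \<bar>det A\<bar>)"
      unfolding m[symmetric] using fin by (simp add: emeasure_eq_ennreal_measure less_top)
    then show "emeasure ?M (box l m) = ennreal (\<Prod>b\<in>Basis. (m - l) \<bullet> b)"
      using dA by (simp add: emeasure_density nn_integral_cmult_indicator emeasure_distr ennreal_mult'[symmetric])
  qed simp
  then have "emeasure lborel S = emeasure ?M S" by simp
  also have "\<dots> = ennreal \<bar>det A\<bar> * emeasure lborel (affmap A u -` S)"
    using S by (simp add: emeasure_density nn_integral_cmult_indicator emeasure_distr)
  finally show ?thesis
    using dA by (simp add: mult.assoc[symmetric] ennreal_mult'[symmetric])
qed

text \<open>Every motion below displaces the part \<open>h > 0\<close> of the body only, along the lines parallel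
  to \<open>v\<close> and by an amount proportional to \<open>h\<close>; it is a shear on that part, hence preserves area.\<close>
definition fold_map :: "real^2 \<Rightarrow> (real^2 \<Rightarrow> real) \<Rightarrow> real \<Rightarrow> real^2 \<Rightarrow> real^2" where
  "fold_map v h t x = x + (t * max 0 (h x)) *\<^sub>R v"

text \<open>\<open>wv\<close> says that \<open>h\<close> is constant in the direction of
  \<open>v\<close>. Hence points keep their height under the motion, displacements for different
  times add up, and time -t undoes time t.\<close>

locale fold =
  fixes v :: "real^2" and h :: "real^2 \<Rightarrow> real" and w1 w2 w0
  assumes h: "\<And>x. h x = w1 * x$1 + w2 * x$2 + w0"
    and wv: "w1 * v$1 + w2 * v$2 = 0"
begin

lemma h_shift: "h (x + s *\<^sub>R v) = h x"
proof -
  have "h (x + s *\<^sub>R v) = h x + s * (w1 * v$1 + w2 * v$2)" by (simp add: h algebra_simps)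
  then show ?thesis by (simp add: wv)
qed

lemma h_fold: "h (fold_map v h t x) = h x"
  by (simp add: fold_map_def h_shift)

lemma fold_fold: "fold_map v h s (fold_map v h t x) = fold_map v h (s + t) x"
  by (simp add: fold_map_def h_shift algebra_simps)

lemma fold_0 [simp]: "fold_map v h 0 x = x" by (simp add: fold_map_def)

lemma fold_inverse: "fold_map v h (- t) (fold_map v h t x) = x" "fold_map v h t (fold_map v h (- t) x) = x"
  by (simp_all add: fold_fold)

lemma continuous_on_h: "continuous_on S h"
  unfolding h by (intro continuous_intros)

lemma continuous_on_fold: "continuous_on S (fold_map v h t)"
  unfolding fold_map_def by (intro continuous_intros continuous_on_h)

lemma inj_fold: "inj (fold_map v h t)"
  by (rule inj_on_inverseI[where g = "fold_map v h (- t)"]) (simp add: fold_inverse)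

text \<open>Split the plane by the sign of \<open>h\<close>, which the motion preserves. Where
  \<open>h\<close> is not positive it is the identity, elsewhere an affine shear, whose determinant
  is 1 by \<open>wv\<close>.\<close>

lemma emeasure_vimage_fold:
  assumes S: "S \<in> sets borel"
  shows "emeasure lborel (fold_map v h t -` S) = emeasure lborel S"
proof -
  define A :: "real^2^2" where "A = vector [vector [1 + t * w1 * v$1, t * w2 * v$1], vector [t * w1 * v$2, 1 + t * w2 * v$2]]"
  have A: "A$1$1 = 1 + t * w1 * v$1" "A$1$2 = t * w2 * v$1" "A$2$1 = t * w1 * v$2" "A$2$2 = 1 + t * w2 * v$2"
    by (simp_all add: A_def vector_2)
  have "det A = 1 + t * (w1 * v$1 + w2 * v$2)" by (simp add: det_2 A algebra_simps)
  then have dA: "det A = 1" by (simp add: wv)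
  then have inv: "invertible A" by (simp add: invertible_det_nz)
  have [measurable]: "h \<in> borel_measurable borel"
    by (intro borel_measurable_continuous_onI continuous_on_h)
  have P: "{x. h x > 0} \<in> sets borel" "{x. h x \<le> 0} \<in> sets borel" by measurable
  have g: "affmap A ((t * w0) *\<^sub>R v) x = x + (t * h x) *\<^sub>R v" for x
    by (simp add: vec_eq_iff forall_2 affmap_nth A h algebra_simps)
  have "fold_map v h t -` S = (S \<inter> {x. h x \<le> 0}) \<union> affmap A ((t * w0) *\<^sub>R v) -` (S \<inter> {x. h x > 0})"
  proof (intro set_eqI)
    show "x \<in> fold_map v h t -` S \<longleftrightarrow> x \<in> (S \<inter> {x. h x \<le> 0}) \<union> affmap A ((t * w0) *\<^sub>R v) -` (S \<inter> {x. h x > 0})" for x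
      by (cases "h x > 0") (auto simp: g fold_map_def h_shift max_def)
  qed
  also have "emeasure lborel \<dots> = emeasure lborel (S \<inter> {x. h x \<le> 0}) + emeasure lborel (affmap A ((t * w0) *\<^sub>R v) -` (S \<inter> {x. h x > 0}))"
  proof (rule plus_emeasure[symmetric])
    have "affmap A ((t * w0) *\<^sub>R v) \<in> borel_measurable borel"
      by (intro borel_measurable_continuous_onI continuous_on_affmap)
    then show "affmap A ((t * w0) *\<^sub>R v) -` (S \<inter> {x. h x > 0}) \<in> sets lborel"
      using S P by (simp add: measurable_sets_borel)
    show "S \<inter> {x. h x \<le> 0} \<inter> affmap A ((t * w0) *\<^sub>R v) -` (S \<inter> {x. 0 < h x}) = {}"
      by (auto simp: g h_shift)
  qed (use S P in auto)
  also have "emeasure lborel (affmap A ((t * w0) *\<^sub>R v) -` (S \<inter> {x. h x > 0})) = emeasure lborel (S \<inter> {x. h x > 0})"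
    using S P by (subst emeasure_vimage_affmap[OF inv]) (auto simp: dA)
  also have "emeasure lborel (S \<inter> {x. h x \<le> 0}) + emeasure lborel (S \<inter> {x. h x > 0}) = emeasure lborel S"
    using S P by (subst plus_emeasure) (auto intro!: arg_cong[where f = "emeasure lborel"])
  finally show ?thesis .
qed

end

section \<open>The functionals as integrals over the uniform distribution\<close>

lemma abs_powr_convex:
  fixes x y :: real
  assumes "p \<ge> 1" "0 \<le> l" "l \<le> 1"
  shows "\<bar>l * x + (1 - l) * y\<bar> powr p \<le> l * \<bar>x\<bar> powr p + (1 - l) * \<bar>y\<bar> powr p"
proof -
  have aux: "(l * a + (1 - l) * b) powr p \<le> l * a powr p + (1 - l) * b powr p"
    if ab: "a \<ge> 0" "b \<ge> 0" and l: "0 \<le> l" "l \<le> 1" for a b l :: real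
  proof -
    have le: "u powr p \<le> u" if "0 \<le> u" "u \<le> 1" for u :: real
      using powr_mono'[OF \<open>p \<ge> 1\<close> that] that by simp
    \<comment> \<open>Convexity of the power is used on the open half-line only; if one argument is
      zero, the claim comes down to \<open>l powr p \<le> l\<close>.\<close>
    consider "a = 0" | "b = 0" | "a \<in> {0<..}" "b \<in> {0<..}"
      using ab by (metis greaterThan_iff less_eq_real_def)
    then show ?thesis
    proof cases
      case 1
      have "(1 - l) powr p * b powr p \<le> (1 - l) * b powr p"
        by (intro mult_right_mono le) (use ab l in auto)
      then show ?thesis using 1 by (simp add: powr_mult)
    next
      case 2
      have "l powr p * a powr p \<le> l * a powr p"
        by (intro mult_right_mono le) (use ab l in auto)
      then show ?thesis using 2 by (simp add: powr_mult)
    next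
      case 3
      have "(\<lambda>x. x powr p) ((1 - (1 - l)) *\<^sub>R a + (1 - l) *\<^sub>R b) \<le> (1 - (1 - l)) * a powr p + (1 - l) * b powr p"
        by (rule convex_onD[OF powr_convex[OF \<open>p \<ge> 1\<close>]]) (use l 3 in auto)
      then show ?thesis by simp
    qed
  qed
  have "\<bar>l * x + (1 - l) * y\<bar> \<le> l * \<bar>x\<bar> + (1 - l) * \<bar>y\<bar>"
    using assms abs_triangle_ineq[of "l * x" "(1 - l) * y"] by (simp add: abs_mult)
  then have "\<bar>l * x + (1 - l) * y\<bar> powr p \<le> (l * \<bar>x\<bar> + (1 - l) * \<bar>y\<bar>) powr p"
    using assms by (intro powr_mono2) auto
  also have "\<dots> \<le> l * \<bar>x\<bar> powr p + (1 - l) * \<bar>y\<bar> powr p"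
    using assms by (intro aux) auto
  finally show ?thesis .
qed

abbreviation unif :: "(real^2) set \<Rightarrow> (real^2) measure" where
  "unif K \<equiv> uniform_measure lborel K"

lemma body_borel: "planar_convex_body K \<Longrightarrow> K \<in> sets borel"
  by (simp add: planar_convex_body_def compact_imp_closed)

lemma body_emeasure:
  assumes "planar_convex_body K"
  shows "emeasure lborel K = ennreal (area K)" "0 < area K"
proof -
  have b: "bounded K" using assms by (simp add: planar_convex_body_def compact_imp_bounded)
  have "emeasure lborel K \<noteq> \<infinity>" using emeasure_bounded_finite[OF b] by simp
  then show "emeasure lborel K = ennreal (area K)"
    by (simp add: area_def emeasure_eq_ennreal_measure)
  obtain x e where e: "e > 0" "ball x e \<subseteq> K"
    using assms unfolding planar_convex_body_def by (meson equals0I mem_interior)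
  have "0 < measure lborel (ball x e)" using e by (rule_tac content_ball_pos)
  also have "\<dots> \<le> area K" unfolding area_def
    using e body_borel[OF assms] \<open>emeasure lborel K \<noteq> \<infinity>\<close>
    by (intro measure_mono_fmeasurable) (auto simp: fmeasurable_def less_top)
  finally show "0 < area K" .
qed

lemma area_mono:
  assumes "planar_convex_body K" "L \<subseteq> K" "L \<in> sets borel"
  shows "area L \<le> area K"
  unfolding area_def using body_emeasure[OF assms(1)] assms body_borel
  by (intro measure_mono_fmeasurable) (auto simp: fmeasurable_def)

lemma cr_le_area:
  assumes "planar_convex_body K" "X \<in> K" "Y \<in> K" "Z \<in> K"
  shows "\<bar>cr X Y Z\<bar> \<le> 2 * area K"
proof -
  have "convex hull {X, Y, Z} \<subseteq> K"
    using assms by (intro hull_minimal) (auto simp: planar_convex_body_def)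
  moreover have "compact (convex hull {X, Y, Z})" by (intro finite_imp_compact_convex_hull) auto
  ultimately have "area (convex hull {X, Y, Z}) \<le> area K"
    by (intro area_mono assms) (auto intro: borel_closed compact_imp_closed)
  then show ?thesis by (simp add: area_triangle)
qed

lemma unif_measurable [simp]: "measurable (unif K) N = measurable borel N"
  by (rule measurable_cong_sets) auto

lemma unif_space: "planar_convex_body K \<Longrightarrow> emeasure (unif K) UNIV = 1"
  using body_emeasure[of K] by (simp add: body_borel ennreal_divide_self)

lemma unif_finite: "planar_convex_body K \<Longrightarrow> finite_measure (unif K)"
  by (rule finite_measureI) (simp add: unif_space)

lemma unif_sigma_finite: "planar_convex_body K \<Longrightarrow> sigma_finite_measure (unif K)"
  using unif_finite by (rule finite_measure.axioms)

lemma AE_unif: "planar_convex_body K \<Longrightarrow> AE x in unif K. x \<in> K"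
  by (rule AE_uniform_measureI) (simp_all add: body_borel)

lemma unif_density:
  assumes "planar_convex_body K"
  shows "unif K = density lborel (\<lambda>x. ennreal (indicator K x / area K))"
  unfolding uniform_measure_def using body_emeasure[OF assms]
    divide_ennreal[of 1 "area K"]
  by (intro arg_cong[where f = "density lborel"] ext) (simp add: indicator_def)

lemma set_lebesgue_integral_unif:
  fixes f :: "real^2 \<Rightarrow> 'a::{second_countable_topology, banach}"
  assumes K: "planar_convex_body K" and f [measurable]: "f \<in> borel_measurable borel"
  shows "(LINT x:K|lborel. f x) = area K *\<^sub>R (\<integral>x. f x \<partial>unif K)"
proof -
  have [measurable]: "K \<in> sets borel" by (rule body_borel[OF K])
  have "(\<integral>x. f x \<partial>unif K) = (\<integral>x. (indicator K x / area K) *\<^sub>R f x \<partial>lborel)"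
    unfolding unif_density[OF K] using body_emeasure[OF K]
    by (intro integral_density) (auto intro!: AE_I2)
  also have "\<dots> = (\<integral>x. (1 / area K) *\<^sub>R (indicator K x *\<^sub>R f x) \<partial>lborel)"
    by (simp add: divide_inverse mult.commute)
  also have "\<dots> = (1 / area K) *\<^sub>R (LINT x:K|lborel. f x)"
    unfolding set_lebesgue_integral_def by (rule integral_scaleR_right)
  finally show ?thesis using body_emeasure[OF K] by simp
qed

lemma integrable_unif:
  fixes f :: "real^2 \<Rightarrow> 'a::{second_countable_topology, banach}"
  assumes K: "planar_convex_body K" and f: "continuous_on UNIV f"
  shows "integrable (unif K) f"
proof -
  have "compact (f ` K)"
    using K f by (intro compact_continuous_image) (auto simp: planar_convex_body_def intro: continuous_on_subset)
  then obtain M where M: "\<And>x. x \<in> K \<Longrightarrow> norm (f x) \<le> M"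
    using compact_imp_bounded bounded_iff by (metis imageI)
  show ?thesis
  proof (rule finite_measure.integrable_const_bound[OF unif_finite[OF K]])
    show "AE x in unif K. norm (f x) \<le> M" using AE_unif[OF K] by (auto elim: eventually_mono simp: M)
    show "f \<in> borel_measurable (unif K)" using f by (simp add: borel_measurable_continuous_onI)
  qed
qed

lemma centroid_eq: "planar_convex_body K \<Longrightarrow> centroid K = (\<integral>x. x \<partial>unif K)"
  unfolding centroid_def by (subst set_lebesgue_integral_unif) (auto dest: body_emeasure(2))

lemma measure_unif_UNIV [simp]: "planar_convex_body K \<Longrightarrow> measure (unif K) UNIV = 1"
  by (simp add: measure_def unif_space)

lemma centroid_nth: "planar_convex_body K \<Longrightarrow> centroid K $ i = (\<integral>x. x $ i \<partial>unif K)"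
  unfolding centroid_eq
  by (rule integral_bounded_linear[symmetric, OF bounded_linear_vec_nth integrable_unif[OF _ continuous_on_id]])

lemma centroid_affine:
  assumes K: "planar_convex_body K"
  shows "c1 * centroid K $ 1 + c2 * centroid K $ 2 + c0 = (\<integral>x. c1 * x $ 1 + c2 * x $ 2 + c0 \<partial>unif K)"
proof -
  have [simp]: "integrable (unif K) (\<lambda>x. x $ i)" for i
    by (rule integrable_unif[OF K]) (intro continuous_intros)
  have [simp]: "integrable (unif K) (\<lambda>x. c)" for c :: real
    by (rule integrable_unif[OF K]) (intro continuous_intros)
  show ?thesis by (simp add: centroid_nth[OF K] K)
qed

lemma cr_affine: "cr z X Y = (X$2 - Y$2) * z$1 + (Y$1 - X$1) * z$2 + (X$1 * Y$2 - X$2 * Y$1)"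
  by (simp add: cr_def algebra_simps)

lemma centroid_mem:
  assumes K: "planar_convex_body K"
  shows "centroid K \<in> K"
proof (rule ccontr)
  assume "centroid K \<notin> K"
  then obtain a b where ab: "a \<bullet> centroid K < b" "\<And>x. x \<in> K \<Longrightarrow> a \<bullet> x > b"
    using separating_hyperplane_closed_point[of K "centroid K"] K
    by (auto simp: planar_convex_body_def compact_imp_closed)
  have "a \<bullet> centroid K = (\<integral>x. a$1 * x$1 + a$2 * x$2 + 0 \<partial>unif K)"
    unfolding centroid_affine[OF K, symmetric] by (simp add: inner_vec_def sum_2)
  also have "\<dots> \<ge> (\<integral>x. b \<partial>unif K)"
  proof (rule integral_mono_AE)
    show "AE x in unif K. b \<le> a$1 * x$1 + a$2 * x$2 + 0"
      using AE_unif[OF K] by eventually_elim (use ab(2) in \<open>force simp: inner_vec_def sum_2\<close>)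
  qed (auto intro!: integrable_unif[OF K] continuous_intros)
  finally show False using ab(1) K by simp
qed

text \<open>The centroid of \<open>K\<close> is the average, with weights 1 - \<theta> and \<theta>,
  of the centroid of \<open>L\<close> and of the centre of mass of \<open>K - L\<close>; at the
  latter the affine function is at most M in absolute value. Applied to determinants this controls
  the centroid functional, applied to coordinates it locates the centroid.\<close>

lemma centroid_subset:
  assumes K: "planar_convex_body K" and L: "planar_convex_body L" "L \<subseteq> K"
    and M: "\<And>x. x \<in> K \<Longrightarrow> \<bar>c1 * x$1 + c2 * x$2 + c0\<bar> \<le> M"
    and \<theta>: "\<theta> = (area K - area L) / area K"
  shows "\<bar>c1 * centroid K$1 + c2 * centroid K$2 + c0\<bar> \<le> (1 - \<theta>) * \<bar>c1 * centroid L$1 + c2 * centroid L$2 + c0\<bar> + \<theta> * M"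
proof -
  let ?f = "\<lambda>x::real^2. c1 * x$1 + c2 * x$2 + c0"
  have [measurable]: "K \<in> sets borel" "L \<in> sets borel" using K L by (auto intro: body_borel)
  have f: "continuous_on UNIV ?f" by (intro continuous_intros)
  have fm [measurable]: "?f \<in> borel_measurable borel" using f by (rule borel_measurable_continuous_onI)
  have int: "set_integrable lborel K ?f"
    unfolding set_integrable_def using K f
    by (intro borel_integrable_compact) (auto simp: planar_convex_body_def intro: continuous_on_subset)
  have intc: "set_integrable lborel K (\<lambda>x. M)"
    unfolding set_integrable_def using K
    by (intro borel_integrable_compact) (auto simp: planar_convex_body_def)
  have "area K * ?f (centroid K) = (LINT x:K|lborel. ?f x)"
    by (simp add: set_lebesgue_integral_unif[OF K fm] centroid_affine[OF K])
  also have "\<dots> = (LINT x:L \<union> (K - L)|lborel. ?f x)" using L by (simp add: Un_absorb1)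
  also have "\<dots> = (LINT x:L|lborel. ?f x) + (LINT x:K - L|lborel. ?f x)"
    by (rule set_integral_Un) (auto intro: set_integrable_subset[OF int] set_integrable_subset[OF int _ L(2)])
  also have "(LINT x:L|lborel. ?f x) = area L * ?f (centroid L)"
    by (simp add: set_lebesgue_integral_unif[OF L(1) fm] centroid_affine[OF L(1)])
  finally have eq: "area K * ?f (centroid K) = area L * ?f (centroid L) + (LINT x:K - L|lborel. ?f x)" .
  have "\<bar>LINT x:K - L|lborel. ?f x\<bar> \<le> (LINT x:K - L|lborel. M)"
  proof -
    have "norm (LINT x:K - L|lborel. ?f x) \<le> (LINT x:K - L|lborel. norm (?f x))"
      unfolding set_lebesgue_integral_def
      using integral_norm_bound[of lborel "\<lambda>x. indicator (K - L) x *\<^sub>R ?f x"] by (simp add: abs_mult)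
    also have "\<dots> \<le> (LINT x:K - L|lborel. M)"
      by (rule set_integral_mono)
        (auto intro!: M set_integrable_abs set_integrable_subset[OF int] set_integrable_subset[OF intc])
    finally show ?thesis by simp
  qed
  also have "(LINT x:K - L|lborel. M) = M * measure lborel (K - L)"
  proof -
    have "(LINT x:K - L|lborel. M) = (\<integral>x. M * indicator (K - L) x \<partial>lborel)"
      unfolding set_lebesgue_integral_def by (intro Bochner_Integration.integral_cong) simp_all
    also have "\<dots> = M * measure lborel (K - L)"
      by (subst integral_mult_right_zero) simp
    finally show ?thesis .
  qed
  also have "measure lborel (K - L) = area K - area L"
    unfolding area_def using L body_emeasure[OF K] body_emeasure[OF L(1)] by (intro measure_Diff) auto
  finally have rest: "\<bar>LINT x:K - L|lborel. ?f x\<bar> \<le> M * (area K - area L)" .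
  have "area K * \<bar>?f (centroid K)\<bar> = \<bar>area L * ?f (centroid L) + (LINT x:K - L|lborel. ?f x)\<bar>"
    unfolding eq[symmetric] using body_emeasure(2)[OF K] by (simp add: abs_mult)
  also have "\<dots> \<le> area L * \<bar>?f (centroid L)\<bar> + M * (area K - area L)"
    using rest abs_triangle_ineq[of "area L * ?f (centroid L)" "LINT x:K - L|lborel. ?f x"]
      body_emeasure(2)[OF L(1)] by (simp add: abs_mult)
  finally have "area K * \<bar>?f (centroid K)\<bar> \<le> area L * \<bar>?f (centroid L)\<bar> + M * (area K - area L)" .
  then have "\<bar>?f (centroid K)\<bar> \<le> (area L * \<bar>?f (centroid L)\<bar> + M * (area K - area L)) / area K"
    using body_emeasure(2)[OF K] by (simp add: pos_le_divide_eq mult.commute)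
  also have "\<dots> = (1 - \<theta>) * \<bar>?f (centroid L)\<bar> + \<theta> * M"
  proof -
    have "1 - \<theta> = area L / area K" using body_emeasure(2)[OF K] by (simp add: \<theta> field_simps)
    then show ?thesis by (simp add: \<theta> add_divide_distrib)
  qed
  finally show ?thesis .
qed

text \<open>Extended nonnegative values make splittings and comparisons free of integrability
  conditions. With \<open>w = wt K\<close> the kernel is the p-th power of an area normalised by
  that of \<open>K\<close>, hence at most 1 on \<open>K\<close>, so real values are recovered by
  \<open>enn2real\<close>.\<close>

definition kern :: "real \<Rightarrow> real \<Rightarrow> real^2 \<Rightarrow> real^2 \<Rightarrow> real^2 \<Rightarrow> ennreal" where
  "kern p w X Y Z = ennreal ((\<bar>cr X Y Z\<bar> * w) powr p)"

definition N2 :: "real \<Rightarrow> real \<Rightarrow> real^2 \<Rightarrow> (real^2) set \<Rightarrow> ennreal" where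
  "N2 p w g K = (\<integral>\<^sup>+x. \<integral>\<^sup>+z. kern p w g x z \<partial>unif K \<partial>unif K)"

definition N3 :: "real \<Rightarrow> real \<Rightarrow> (real^2) set \<Rightarrow> ennreal" where
  "N3 p w K = (\<integral>\<^sup>+g. N2 p w g K \<partial>unif K)"

lemma kern_measurable [measurable]:
  assumes [measurable]: "f \<in> borel_measurable M" "g \<in> borel_measurable M" "h \<in> borel_measurable M"
  shows "(\<lambda>x. kern p w (f x) (g x) (h x)) \<in> borel_measurable M"
  unfolding kern_def by measurable

lemma kern_integral_measurable:
  assumes K: "planar_convex_body K"
    and [measurable]: "f \<in> borel_measurable M" "g \<in> borel_measurable M" "h \<in> borel_measurable borel"
  shows "(\<lambda>x. \<integral>\<^sup>+z. kern p w (f x) (g x) (h z) \<partial>unif K) \<in> borel_measurable M"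
proof -
  interpret sigma_finite_measure "unif K" by (rule unif_sigma_finite[OF K])
  have [measurable]: "h \<in> borel_measurable (unif K)" by simp
  show ?thesis by measurable
qed

lemma kern_integral2_measurable:
  assumes K: "planar_convex_body K"
    and [measurable]: "f \<in> borel_measurable M" "g \<in> borel_measurable borel" "h \<in> borel_measurable borel"
  shows "(\<lambda>x. \<integral>\<^sup>+y. \<integral>\<^sup>+z. kern p w (f x) (g y) (h z) \<partial>unif K \<partial>unif K) \<in> borel_measurable M"
proof -
  interpret sigma_finite_measure "unif K" by (rule unif_sigma_finite[OF K])
  have [measurable]: "g \<in> borel_measurable (unif K)" "h \<in> borel_measurable (unif K)" by simp_all
  show ?thesis by measurable
qed

lemma nn_integral_unif_le:
  assumes K: "planar_convex_body K" and G: "\<And>x. x \<in> K \<Longrightarrow> G x \<le> c"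
  shows "(\<integral>\<^sup>+x. G x \<partial>unif K) \<le> c"
proof -
  have "(\<integral>\<^sup>+x. G x \<partial>unif K) \<le> (\<integral>\<^sup>+x. c \<partial>unif K)"
    using AE_unif[OF K] by (intro nn_integral_mono_AE) (auto elim: eventually_mono simp: G)
  then show ?thesis by (simp add: unif_space[OF K])
qed

text \<open>The bound 1 keeps \<open>G\<close> finite on \<open>K\<close>, so that nothing is lost
  in passing to real values.\<close>

lemma set_integral_enn2real:
  assumes K: "planar_convex_body K" and [measurable]: "G \<in> borel_measurable borel"
    and G: "\<And>x. x \<in> K \<Longrightarrow> G x \<le> 1"
  shows "(LINT x:K|lborel. c * enn2real (G x)) = c * area K * enn2real (\<integral>\<^sup>+x. G x \<partial>unif K)"
proof -
  have "(LINT x:K|lborel. c * enn2real (G x)) = area K * (c * (\<integral>x. enn2real (G x) \<partial>unif K))"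
    by (subst set_lebesgue_integral_unif[OF K]) simp_all
  also have "(\<integral>x. enn2real (G x) \<partial>unif K) = enn2real (\<integral>\<^sup>+x. ennreal (enn2real (G x)) \<partial>unif K)"
    by (intro integral_eq_nn_integral) simp_all
  also have "(\<integral>\<^sup>+x. ennreal (enn2real (G x)) \<partial>unif K) = (\<integral>\<^sup>+x. G x \<partial>unif K)"
  proof (rule nn_integral_cong_AE)
    show "AE x in unif K. ennreal (enn2real (G x)) = G x"
      using AE_unif[OF K]
    proof eventually_elim
      case (elim x)
      then have "G x < top" using G[of x] by (metis ennreal_one_less_top order_le_less_trans)
      then show ?case by simp
    qed
  qed
  finally show ?thesis by simp
qed

abbreviation wt :: "(real^2) set \<Rightarrow> real" where "wt K \<equiv> 1 / (2 * area K)"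

lemma kern_le_1:
  assumes "planar_convex_body K" "p \<ge> 1" "X \<in> K" "Y \<in> K" "Z \<in> K"
  shows "kern p (wt K) X Y Z \<le> 1"
proof -
  have "\<bar>cr X Y Z\<bar> * wt K \<le> 1"
    using cr_le_area[OF assms(1,3-5)] body_emeasure[OF assms(1)] by simp
  then have "(\<bar>cr X Y Z\<bar> * wt K) powr p \<le> 1 powr p"
    using body_emeasure[OF assms(1)] assms(2) by (intro powr_mono2) auto
  then show ?thesis by (simp add: kern_def)
qed

lemma N2_le_1: "planar_convex_body K \<Longrightarrow> p \<ge> 1 \<Longrightarrow> g \<in> K \<Longrightarrow> N2 p (wt K) g K \<le> 1"
  unfolding N2_def by (intro nn_integral_unif_le kern_le_1)

lemma N3_le_1: "planar_convex_body K \<Longrightarrow> p \<ge> 1 \<Longrightarrow> N3 p (wt K) K \<le> 1"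
  unfolding N3_def by (intro nn_integral_unif_le N2_le_1)

lemma hull_area_powr:
  assumes "planar_convex_body K"
  shows "area (convex hull {X, Y, Z}) powr p = area K powr p * enn2real (kern p (wt K) X Y Z)"
  using body_emeasure[OF assms]
  by (simp add: area_triangle kern_def powr_mult[symmetric])

lemma set_integral2:
  assumes K: "planar_convex_body K" and p: "p \<ge> 1" and g: "g \<in> K"
  shows "(LINT x:K|lborel. LINT z:K|lborel. area (convex hull {g, x, z}) powr p)
    = area K powr p * area K * area K * enn2real (N2 p (wt K) g K)"
proof -
  have [measurable]: "K \<in> sets borel" by (rule body_borel[OF K])
  have "(LINT x:K|lborel. LINT z:K|lborel. area (convex hull {g, x, z}) powr p)
    = (LINT x:K|lborel. area K powr p * area K * enn2real (\<integral>\<^sup>+z. kern p (wt K) g x z \<partial>unif K))"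
    unfolding hull_area_powr[OF K]
  proof (rule set_lebesgue_integral_cong; (intro allI impI)?)
    fix x assume "x \<in> K"
    then have "kern p (wt K) g x z \<le> 1" if "z \<in> K" for z
      using that by (intro kern_le_1[OF K p] g)
    then show "(LINT z:K|lborel. area K powr p * enn2real (kern p (wt K) g x z))
      = area K powr p * area K * enn2real (\<integral>\<^sup>+z. kern p (wt K) g x z \<partial>unif K)"
      by (rule set_integral_enn2real[OF K, rotated]) measurable
  qed simp
  also have "\<dots> = area K powr p * area K * area K * enn2real (N2 p (wt K) g K)"
    unfolding N2_def
    by (rule set_integral_enn2real[OF K])
      (auto intro!: kern_integral_measurable[OF K] nn_integral_unif_le[OF K] kern_le_1[OF K p] g)
  finally show ?thesis .
qed

lemma powr_cancel:
  fixes a :: real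
  assumes "a > 0"
  shows "a powr (- 2 - p) * (a powr p * a * a) = 1" "a powr (- 3 - p) * (a powr p * a * a * a) = 1"
proof -
  have "a powr (- 2 - p) * (a powr p * a powr 1 * a powr 1) = a powr 0"
    unfolding powr_add[symmetric] by (rule arg_cong[where f = "(powr) a"]) simp
  then show "a powr (- 2 - p) * (a powr p * a * a) = 1" using assms by simp
  have "a powr (- 3 - p) * (a powr p * a powr 1 * a powr 1 * a powr 1) = a powr 0"
    unfolding powr_add[symmetric] by (rule arg_cong[where f = "(powr) a"]) simp
  then show "a powr (- 3 - p) * (a powr p * a * a * a) = 1" using assms by simp
qed

lemma Estar_eq:
  assumes K: "planar_convex_body K" and p: "p \<ge> 1"
  shows "Estar p K = enn2real (N2 p (wt K) (centroid K) K)"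
  unfolding Estar_def set_integral2[OF K p centroid_mem[OF K]]
  using powr_cancel(1)[OF body_emeasure(2)[OF K], of p] by (simp only: mult.assoc[symmetric] mult_1)

lemma E3_eq:
  assumes K: "planar_convex_body K" and p: "p \<ge> 1"
  shows "E3 p K = enn2real (N3 p (wt K) K)"
proof -
  have [measurable]: "K \<in> sets borel" by (rule body_borel[OF K])
  have "(LINT g:K|lborel. LINT x:K|lborel. LINT z:K|lborel. area (convex hull {g, x, z}) powr p)
    = (LINT g:K|lborel. area K powr p * area K * area K * enn2real (N2 p (wt K) g K))"
    by (rule set_lebesgue_integral_cong) (auto simp: set_integral2[OF K p])
  also have "\<dots> = area K powr p * area K * area K * area K * enn2real (N3 p (wt K) K)"
    unfolding N3_def
  proof (rule set_integral_enn2real[OF K _ N2_le_1[OF K p]])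
    show "(\<lambda>g. N2 p (wt K) g K) \<in> borel_measurable borel"
      unfolding N2_def by (rule kern_integral2_measurable[OF K]) auto
  qed
  finally show ?thesis
    unfolding E3_def using powr_cancel(2)[OF body_emeasure(2)[OF K], of p] by (simp only: mult.assoc[symmetric] mult_1)
qed

section \<open>Affine invariance and dependence on the body\<close>

text \<open>An injective map whose preimages scale all areas by the same factor carries the uniform
  law of \<open>K\<close> to the uniform law of its image. The factor is 1 / |det A| for affine maps
  and 1 for folds.\<close>

lemma
  assumes K: "planar_convex_body K" and fK: "planar_convex_body (f ` K)"
    and f [measurable]: "f \<in> borel_measurable borel" and inj: "inj f" and c: "c > 0"
    and scale: "\<And>S. S \<in> sets borel \<Longrightarrow> emeasure lborel (f -` S) = ennreal c * emeasure lborel S"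
  shows area_push: "area K = c * area (f ` K)"
    and unif_push: "distr (unif K) borel f = unif (f ` K)"
proof -
  have pre: "f -` (f ` K) = K" using inj by (simp add: inj_vimage_image_eq)
  have "ennreal (area K) = ennreal (c * area (f ` K))"
    using scale[OF body_borel[OF fK]] c body_emeasure(1)[OF K] body_emeasure[OF fK]
    by (simp add: pre ennreal_mult)
  then show eq: "area K = c * area (f ` K)"
    using c body_emeasure(2)[OF K] body_emeasure(2)[OF fK] by simp
  show "distr (unif K) borel f = unif (f ` K)"
  proof (rule measure_eqI)
    fix S assume "S \<in> sets (distr (unif K) borel f)"
    then have S: "S \<in> sets borel" by simp
    have fS: "f -` S \<in> sets borel" using measurable_sets[OF f S] by simp
    have "emeasure lborel (f ` K \<inter> S) \<le> ennreal (area (f ` K))"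
      unfolding body_emeasure(1)[OF fK, symmetric]
      using body_borel[OF fK] by (intro emeasure_mono) auto
    then obtain r where r: "r \<ge> 0" "emeasure lborel (f ` K \<inter> S) = ennreal r"
      by (cases "emeasure lborel (f ` K \<inter> S)" rule: ennreal_cases) (auto simp: top_unique)
    have "K \<inter> f -` S = f -` (f ` K \<inter> S)" using pre by auto
    then have "emeasure (distr (unif K) borel f) S = ennreal c * ennreal r / ennreal (area K)"
      using S fS body_borel[OF K] scale[of "f ` K \<inter> S"] body_borel[OF fK]
      by (simp add: emeasure_distr body_emeasure(1)[OF K] r)
    also have "\<dots> = ennreal r / ennreal (area (f ` K))"
      using c r body_emeasure(2)[OF fK] body_emeasure(2)[OF K]
      by (simp add: ennreal_mult[symmetric] divide_ennreal eq)
    also have "\<dots> = emeasure (unif (f ` K)) S"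
      using S body_borel[OF fK] by (simp add: body_emeasure(1)[OF fK] r)
    finally show "emeasure (distr (unif K) borel f) S = emeasure (unif (f ` K)) S" .
  qed simp
qed

lemma N2_push:
  assumes K: "planar_convex_body K" and fK: "planar_convex_body (f ` K)"
    and f [measurable]: "f \<in> borel_measurable borel"
    and d: "distr (unif K) borel f = unif (f ` K)"
  shows "N2 p w g (f ` K) = (\<integral>\<^sup>+x. \<integral>\<^sup>+z. kern p w g (f x) (f z) \<partial>unif K \<partial>unif K)"
proof -
  have "N2 p w g (f ` K) = (\<integral>\<^sup>+x. (\<integral>\<^sup>+z. kern p w g x (f z) \<partial>unif K) \<partial>distr (unif K) borel f)"
    unfolding N2_def d[symmetric] by (subst (2) nn_integral_distr) simp_all
  also have "\<dots> = (\<integral>\<^sup>+x. \<integral>\<^sup>+z. kern p w g (f x) (f z) \<partial>unif K \<partial>unif K)"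
    by (rule nn_integral_distr) (auto intro!: kern_integral_measurable[OF K])
  finally show ?thesis .
qed

lemma N3_push:
  assumes K: "planar_convex_body K" and fK: "planar_convex_body (f ` K)"
    and f [measurable]: "f \<in> borel_measurable borel"
    and d: "distr (unif K) borel f = unif (f ` K)"
  shows "N3 p w (f ` K) = (\<integral>\<^sup>+g. N2 p w (f g) (f ` K) \<partial>unif K)"
  unfolding N3_def d[symmetric]
  by (rule nn_integral_distr) (auto simp: N2_push[OF K fK f d] intro!: kern_integral2_measurable[OF K])

lemma centroid_push:
  assumes K: "planar_convex_body K" and fK: "planar_convex_body (f ` K)"
    and f [measurable]: "f \<in> borel_measurable borel"
    and d: "distr (unif K) borel f = unif (f ` K)"
  shows "centroid (f ` K) $ i = (\<integral>x. f x $ i \<partial>unif K)"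
  unfolding centroid_nth[OF fK] d[symmetric] by (rule integral_distr) simp_all

text \<open>\<open>Phi True\<close> is the functional with three random points, \<open>Phi False\<close> the one with the
  centroid; the two are treated in parallel.\<close>
definition Phi :: "bool \<Rightarrow> real \<Rightarrow> (real^2) set \<Rightarrow> real" where
  "Phi m p K = (if m then E3 p K else Estar p K)"

lemma Phi_eq:
  assumes "planar_convex_body K" "p \<ge> 1"
  shows "Phi m p K = enn2real (if m then N3 p (wt K) K else N2 p (wt K) (centroid K) K)"
  using assms by (simp add: Phi_def E3_eq Estar_eq)

lemma ennreal_Phi:
  assumes K: "planar_convex_body K" and p: "p \<ge> 1"
  shows "ennreal (Phi m p K) = (if m then N3 p (wt K) K else N2 p (wt K) (centroid K) K)"
proof -
  have "(if m then N3 p (wt K) K else N2 p (wt K) (centroid K) K) \<le> 1"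
    using N3_le_1[OF K p] N2_le_1[OF K p centroid_mem[OF K]] by simp
  then have "(if m then N3 p (wt K) K else N2 p (wt K) (centroid K) K) < top"
    by (rule order_le_less_trans) simp
  then show ?thesis unfolding Phi_eq[OF K p] by (rule ennreal_enn2real)
qed

lemma Phi_bounds:
  assumes "planar_convex_body K" "p \<ge> 1"
  shows "0 \<le> Phi m p K" "Phi m p K \<le> 1"
proof -
  show "0 \<le> Phi m p K" by (simp add: Phi_eq[OF assms])
  have "ennreal (Phi m p K) \<le> 1"
    using N3_le_1[OF assms] N2_le_1[OF assms centroid_mem[OF assms(1)]] by (simp add: ennreal_Phi[OF assms])
  then show "Phi m p K \<le> 1" by simp
qed

lemma body_affmap:
  assumes A: "invertible A" and K: "planar_convex_body K"
  shows "planar_convex_body (affmap A u ` K)"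
proof -
  have eq: "affmap A u ` K = (+) u ` ((*v) A ` K)"
    by (auto simp: affmap_def image_image add.commute)
  have "inj ((*v) A)" using A by (simp add: inj_matrix_vector_mult)
  then have "interior ((*v) A ` K) = (*v) A ` interior K"
    by (intro interior_injective_linear_image) simp_all
  then have "interior (affmap A u ` K) \<noteq> {}"
    using K by (simp add: eq interior_translation planar_convex_body_def)
  moreover have "convex (affmap A u ` K)"
    unfolding eq using K by (intro convex_translation convex_linear_image) (auto simp: planar_convex_body_def)
  moreover have "compact (affmap A u ` K)"
    using K by (intro compact_continuous_image continuous_on_affmap) (simp add: planar_convex_body_def)
  ultimately show ?thesis by (simp add: planar_convex_body_def)
qed

lemma
  assumes A: "invertible A" and K: "planar_convex_body K"
  shows area_affmap: "area (affmap A u ` K) = \<bar>det A\<bar> * area K"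
    and unif_affmap: "distr (unif K) borel (affmap A u) = unif (affmap A u ` K)"
proof -
  have m: "affmap A u \<in> borel_measurable borel"
    by (intro borel_measurable_continuous_onI continuous_on_affmap)
  have i: "inj (affmap A u)" using affmap_inverse[OF A] by (metis injI)
  have d: "det A \<noteq> 0" using A by (simp add: invertible_det_nz)
  note * = K body_affmap[OF A K] m i _ emeasure_vimage_affmap[OF A]
  show "area (affmap A u ` K) = \<bar>det A\<bar> * area K"
    using area_push[OF *] d by simp
  show "distr (unif K) borel (affmap A u) = unif (affmap A u ` K)"
    using unif_push[OF *] d by simp
qed

text \<open>The determinant is multiplied by \<open>det A\<close>, \<open>wt\<close> is divided by
  its absolute value, and the centroid moves along with the body.\<close>

lemma Phi_affmap:
  assumes A: "invertible A" and K: "planar_convex_body K" and p: "p \<ge> 1"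
  shows "Phi m p (affmap A u ` K) = Phi m p K"
proof -
  have m: "affmap A u \<in> borel_measurable borel"
    by (intro borel_measurable_continuous_onI continuous_on_affmap)
  have d: "det A \<noteq> 0" using A by (simp add: invertible_det_nz)
  note push = K body_affmap[OF A K] m unif_affmap[OF A K]
  have N2: "N2 p (wt (affmap A u ` K)) (affmap A u g) (affmap A u ` K) = N2 p (wt K) g K" for g
    unfolding N2_push[OF push] unfolding N2_def kern_def cr_affmap
    using d by (simp add: area_affmap[OF A K] abs_mult)
  have "centroid (affmap A u ` K) $ i = affmap A u (centroid K) $ i" for i
  proof (cases "i = 1")
    case True
    then show ?thesis unfolding centroid_push[OF push] True affmap_nth centroid_affine[OF K] by simp
  next
    case False
    then have "i = 2" using exhaust_2 by blast
    then show ?thesis by (simp add: centroid_push[OF push] affmap_nth centroid_affine[OF K])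
  qed
  then have "centroid (affmap A u ` K) = affmap A u (centroid K)" by (simp add: vec_eq_iff)
  then show ?thesis
    unfolding Phi_eq[OF K p] Phi_eq[OF body_affmap[OF A K] p] N3_push[OF push]
    by (simp add: N2 N3_def)
qed

text \<open>A uniform point of \<open>K\<close> misses \<open>L\<close> with probability \<theta>,
  and there \<open>G\<close> is at most 1; given that it hits \<open>L\<close>, it is uniform in
  \<open>L\<close>.\<close>

lemma nn_integral_unif_subset:
  assumes K: "planar_convex_body K" and L: "planar_convex_body L" "L \<subseteq> K"
    and [measurable]: "G \<in> borel_measurable borel" and G: "\<And>x. x \<in> K \<Longrightarrow> G x \<le> 1"
    and \<theta>: "\<theta> = (area K - area L) / area K"
  shows "(\<integral>\<^sup>+x. G x \<partial>unif K) \<le> (\<integral>\<^sup>+x. G x \<partial>unif L) + ennreal \<theta>"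
proof -
  have [measurable]: "K \<in> sets borel" "L \<in> sets borel" using K L by (auto intro: body_borel)
  note aK = body_emeasure[OF K] and aL = body_emeasure[OF L(1)]
  have LK: "area L \<le> area K" using L by (intro area_mono[OF K]) auto
  have "(\<integral>\<^sup>+x. G x \<partial>unif L) \<le> 1" using G L by (intro nn_integral_unif_le) auto
  then obtain r where r: "r \<ge> 0" "(\<integral>\<^sup>+x. G x \<partial>unif L) = ennreal r"
    by (cases "\<integral>\<^sup>+x. G x \<partial>unif L" rule: ennreal_cases) (auto simp: top_unique)
  have GLr: "ennreal r = (\<integral>\<^sup>+x. G x * indicator L x \<partial>lborel) / ennreal (area L)"
    unfolding r(2)[symmetric] aL(1)[symmetric] by (rule nn_integral_uniform_measure) simp_all
  have "(\<integral>\<^sup>+x. G x * indicator L x \<partial>lborel)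
      = (\<integral>\<^sup>+x. G x * indicator L x \<partial>lborel) / ennreal (area L) * ennreal (area L)"
    using aL(2) by (simp add: ennreal_divide_times ennreal_divide_self)
  also have "\<dots> = ennreal (area L * r)"
    unfolding GLr[symmetric] using aL(2) r(1) by (simp add: ennreal_mult mult.commute)
  finally have GL: "(\<integral>\<^sup>+x. G x * indicator L x \<partial>lborel) = ennreal (area L * r)" .
  have "(\<integral>\<^sup>+x. G x * indicator K x \<partial>lborel) \<le> (\<integral>\<^sup>+x. G x * indicator L x + indicator (K - L) x \<partial>lborel)"
    using G L by (intro nn_integral_mono) (auto split: split_indicator)
  also have "\<dots> = ennreal (area L * r) + emeasure lborel (K - L)"
    by (subst nn_integral_add) (simp_all add: GL)
  also have "emeasure lborel (K - L) = ennreal (area K - area L)"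
    using L aK aL by (subst emeasure_Diff) (auto simp: ennreal_minus)
  finally have "(\<integral>\<^sup>+x. G x * indicator K x \<partial>lborel) \<le> ennreal (area L * r + (area K - area L))"
    using r LK aL by (simp add: ennreal_plus)
  then have "(\<integral>\<^sup>+x. G x \<partial>unif K) \<le> ennreal (area L * r + (area K - area L)) / ennreal (area K)"
    using aK by (subst nn_integral_uniform_measure) (auto intro!: divide_right_mono_ennreal)
  also have "\<dots> = ennreal ((area L * r + (area K - area L)) / area K)"
    using aK r LK aL by (intro divide_ennreal) auto
  also have "\<dots> \<le> ennreal (r + \<theta>)"
  proof (rule ennreal_leI)
    have "area L * r / area K \<le> r" using LK aK r mult_right_mono[OF LK r(1)] by (simp add: field_simps)
    then show "(area L * r + (area K - area L)) / area K \<le> r + \<theta>"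
      by (simp add: \<theta> add_divide_distrib)
  qed
  also have "\<dots> = ennreal r + ennreal \<theta>" using r LK aK by (simp add: \<theta> ennreal_plus)
  finally show ?thesis by (simp add: r)
qed

lemma nn_integral_unif_add_const:
  assumes K: "planar_convex_body K" and [measurable]: "H \<in> borel_measurable borel"
    and le: "\<And>x. x \<in> K \<Longrightarrow> G x \<le> H x + c"
  shows "(\<integral>\<^sup>+x. G x \<partial>unif K) \<le> (\<integral>\<^sup>+x. H x \<partial>unif K) + c"
proof -
  have "(\<integral>\<^sup>+x. G x \<partial>unif K) \<le> (\<integral>\<^sup>+x. H x + c \<partial>unif K)"
    using AE_unif[OF K] by (intro nn_integral_mono_AE) (auto elim: eventually_mono simp: le)
  also have "\<dots> = (\<integral>\<^sup>+x. H x \<partial>unif K) + c"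
    by (subst nn_integral_add) (simp_all add: unif_space[OF K])
  finally show ?thesis .
qed

text \<open>Three replacements, each at the price \<theta>: the three random points of one
  functional, or the two random points and the centroid of the other. Normalising by the smaller
  area of \<open>L\<close> only increases the kernel. The estimate serves the approximation by
  polygons as well as the example for optimality.\<close>

lemma Phi_subset:
  assumes K: "planar_convex_body K" and L: "planar_convex_body L" "L \<subseteq> K" and p: "p \<ge> 1"
  shows "Phi m p K \<le> Phi m p L + 3 * ((area K - area L) / area K)"
proof -
  define \<theta> where "\<theta> = (area K - area L) / area K"
  note aK = body_emeasure(2)[OF K] and aL = body_emeasure(2)[OF L(1)]
  have LK: "area L \<le> area K" using L by (intro area_mono[OF K]) (auto intro: body_borel)
  then have \<theta>: "0 \<le> \<theta>" "\<theta> \<le> 1" using aK aL by (auto simp: \<theta>_def)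
  have two: "N2 p (wt K) g K \<le> N2 p (wt K) g L + ennreal \<theta> + ennreal \<theta>" if g: "g \<in> K" for g
  proof -
    have "N2 p (wt K) g K \<le> (\<integral>\<^sup>+x. \<integral>\<^sup>+z. kern p (wt K) g x z \<partial>unif K \<partial>unif L) + ennreal \<theta>"
      unfolding N2_def using g
      by (intro nn_integral_unif_subset[OF K L _ _ \<theta>_def] kern_integral_measurable[OF K] nn_integral_unif_le[OF K] kern_le_1[OF K p]) auto
    also have "(\<integral>\<^sup>+x. \<integral>\<^sup>+z. kern p (wt K) g x z \<partial>unif K \<partial>unif L) \<le> N2 p (wt K) g L + ennreal \<theta>"
      unfolding N2_def using g L(2)
      by (intro nn_integral_unif_add_const[OF L(1)] kern_integral_measurable[OF L(1)]
          nn_integral_unif_subset[OF K L _ _ \<theta>_def] kern_le_1[OF K p]) auto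
    finally show ?thesis by (simp add: add_right_mono)
  qed
  have w: "wt K \<le> wt L" using LK aL by (simp add: frac_le)
  have "ennreal (Phi m p K) \<le> ennreal (Phi m p L) + ennreal \<theta> + ennreal \<theta> + ennreal \<theta>"
  proof (cases m)
    case True
    have mono: "N2 p (wt K) g L \<le> N2 p (wt L) g L" for g
      unfolding N2_def kern_def using w p aK
      by (intro nn_integral_mono ennreal_leI powr_mono2 mult_left_mono) auto
    have "N3 p (wt K) K \<le> (\<integral>\<^sup>+g. N2 p (wt K) g K \<partial>unif L) + ennreal \<theta>"
      unfolding N3_def
    proof (rule nn_integral_unif_subset[OF K L _ N2_le_1[OF K p] \<theta>_def])
      show "(\<lambda>g. N2 p (wt K) g K) \<in> borel_measurable borel"
        unfolding N2_def by (rule kern_integral2_measurable[OF K]) auto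
    qed
    also have "(\<integral>\<^sup>+g. N2 p (wt K) g K \<partial>unif L) \<le> N3 p (wt L) L + (ennreal \<theta> + ennreal \<theta>)"
      unfolding N3_def
    proof (rule nn_integral_unif_add_const[OF L(1)])
      show "(\<lambda>g. N2 p (wt L) g L) \<in> borel_measurable borel"
        unfolding N2_def by (rule kern_integral2_measurable[OF L(1)]) auto
      show "N2 p (wt K) g K \<le> N2 p (wt L) g L + (ennreal \<theta> + ennreal \<theta>)" if "g \<in> L" for g
        using order_trans[OF two[of g] add_right_mono[OF add_right_mono[OF mono]]] L(2) that
        by (auto simp: add.assoc)
    qed
    finally show ?thesis
      by (simp add: True ennreal_Phi[OF K p] ennreal_Phi[OF L(1) p] add_right_mono add.assoc)
  next
    case False
    have kern: "kern p (wt K) (centroid K) x z \<le> kern p (wt L) (centroid L) x z + ennreal \<theta>"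
      if x: "x \<in> L" and z: "z \<in> L" for x z
    proof -
      have xK: "x \<in> K" "z \<in> K" using x z L by auto
      have "\<bar>cr (centroid K) x z\<bar> \<le> (1 - \<theta>) * \<bar>cr (centroid L) x z\<bar> + \<theta> * (2 * area K)"
        unfolding cr_affine[of "centroid _"]
        by (rule centroid_subset[OF K L _ \<theta>_def]) (use cr_le_area[OF K _ xK] in \<open>simp add: cr_affine\<close>)
      then have "\<bar>cr (centroid K) x z\<bar> * wt K \<le> ((1 - \<theta>) * \<bar>cr (centroid L) x z\<bar> + \<theta> * (2 * area K)) * wt K"
        using aK by (intro mult_right_mono) auto
      also have "\<dots> = (1 - \<theta>) * (\<bar>cr (centroid L) x z\<bar> * wt K) + \<theta>"
        using aK by (simp add: field_simps)
      also have "\<dots> \<le> (1 - \<theta>) * (\<bar>cr (centroid L) x z\<bar> * wt L) + \<theta>"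
        using w \<theta> by (intro add_right_mono mult_left_mono) auto
      finally have "(\<bar>cr (centroid K) x z\<bar> * wt K) powr p \<le> ((1 - \<theta>) * (\<bar>cr (centroid L) x z\<bar> * wt L) + \<theta>) powr p"
        using p aK by (intro powr_mono2) auto
      \<comment> \<open>Convexity between the normalised area and the value 1 keeps the additive
        error at \<theta>, without a factor p.\<close>
      also have "\<dots> \<le> (1 - \<theta>) * (\<bar>cr (centroid L) x z\<bar> * wt L) powr p + \<theta>"
        using abs_powr_convex[OF p, of "1 - \<theta>" "\<bar>cr (centroid L) x z\<bar> * wt L" 1] \<theta> aL by simp
      also have "\<dots> \<le> (\<bar>cr (centroid L) x z\<bar> * wt L) powr p + \<theta>"
        using \<theta> by (simp add: mult_left_le_one_le)
      finally show ?thesis using \<theta> by (simp add: kern_def ennreal_plus[symmetric] del: ennreal_plus)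
    qed
    have "N2 p (wt K) (centroid K) L \<le> N2 p (wt L) (centroid L) L + ennreal \<theta>"
      unfolding N2_def
      by (intro nn_integral_unif_add_const[OF L(1)] kern_integral_measurable[OF L(1)] kern) auto
    from order_trans[OF two[OF centroid_mem[OF K]] add_right_mono[OF add_right_mono[OF this]]]
    show ?thesis by (simp add: False ennreal_Phi[OF K p] ennreal_Phi[OF L(1) p])
  qed
  also have "\<dots> = ennreal (Phi m p L + 3 * \<theta>)"
    using \<theta> Phi_bounds(1)[OF L(1) p] by (simp add: ennreal_plus[symmetric] del: ennreal_plus)
  finally show ?thesis
    using \<theta> Phi_bounds(1)[OF L(1) p, of m] ennreal_le_iff[of "Phi m p L + 3 * \<theta>" "Phi m p K"]
    by (simp add: \<theta>_def[symmetric] del: ennreal_plus)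
qed

section \<open>The convexity gap along a fold\<close>

text \<open>Subtracting \<open>e powr (q - 2) * x\<^sup>2\<close> from \<open>x powr q\<close>
  leaves a convex function on x > e, because the second derivative of the power is at least
  \<open>2 * e powr (q - 2)\<close> there. The claim is its tangent inequality.\<close>

lemma powr_above_tangent:
  fixes q e x z :: real
  assumes q: "q \<ge> 2" and e: "e > 0" and x: "x > e" and z: "z > e"
  shows "z powr q + q * z powr (q - 1) * (x - z) + e powr (q - 2) * (x - z)\<^sup>2 \<le> x powr q"
proof -
  define c where "c = e powr (q - 2)"
  define f where "f = (\<lambda>x. x powr q - c * x\<^sup>2)"
  have d1: "(f has_real_derivative (q * y powr (q - 1) - c * (2 * y))) (at y)" if "y > e" for y
    unfolding f_def using that e by (auto intro!: derivative_eq_intros simp: powr_diff)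
  have cvx: "convex_on {e<..} f"
  proof (rule f''_ge0_imp_convex)
    show "((\<lambda>y. q * y powr (q - 1) - c * (2 * y)) has_real_derivative (q * ((q - 1) * y powr (q - 2)) - c * 2)) (at y)"
      if "y \<in> {e<..}" for y
      using that e by (auto intro!: derivative_eq_intros)
    show "0 \<le> q * ((q - 1) * y powr (q - 2)) - c * 2" if "y \<in> {e<..}" for y
    proof -
      have "c \<le> y powr (q - 2)" unfolding c_def using that e q by (intro powr_mono2) auto
      moreover have "2 * 1 \<le> q * (q - 1)" using q by (intro mult_mono) auto
      ultimately have "2 * c \<le> (q * (q - 1)) * y powr (q - 2)"
        using e by (intro mult_mono) (auto simp: c_def)
      then show ?thesis by (simp add: mult.assoc)
    qed
  qed (auto intro: d1)
  have "f x - f z \<ge> (q * z powr (q - 1) - c * (2 * z)) * (x - z)"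
    using x z d1[OF z] by (intro convex_on_imp_above_tangent[OF cvx]) (auto intro: DERIV_subset simp: interior_open)
  then show ?thesis by (simp add: f_def c_def[symmetric] power2_eq_square algebra_simps)
qed

text \<open>The weights b / (a + b) and a / (a + b) at the displacements -a d and b d have mean 0
  and variance a b d^2, so the linear terms of the tangent inequality cancel.\<close>

lemma powr_convexity_gap:
  fixes q e z a b d :: real
  assumes q: "q \<ge> 2" and e: "e > 0" and ab: "a > 0" "b > 0"
    and z: "z > e" "z - a * d > e" "z + b * d > e"
  shows "z powr q + e powr (q - 2) * (a * b * d\<^sup>2) \<le> b / (a + b) * (z - a * d) powr q + a / (a + b) * (z + b * d) powr q"
proof -
  let ?l = "b / (a + b)" and ?m = "a / (a + b)" and ?c = "e powr (q - 2)"
  have lm: "?l + ?m = 1" "?l \<ge> 0" "?m \<ge> 0" "?l * a = ?m * b" "?l * a + ?m * b = 2 * (a * b / (a + b))"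
    using ab by (simp_all add: add_divide_distrib[symmetric] field_simps)
  have s2: "?l * a\<^sup>2 + ?m * b\<^sup>2 = a * b"
  proof -
    have "?l * a\<^sup>2 + ?m * b\<^sup>2 = (b * a\<^sup>2 + a * b\<^sup>2) / (a + b)" by (simp add: add_divide_distrib)
    also have "b * a\<^sup>2 + a * b\<^sup>2 = (a * b) * (a + b)" by (simp add: power2_eq_square algebra_simps)
    finally show ?thesis using ab by simp
  qed
  have "z powr q + q * z powr (q - 1) * (- a * d) + ?c * (a * d)\<^sup>2 \<le> (z - a * d) powr q"
    using powr_above_tangent[OF q e z(2) z(1)] by simp
  then have 1: "?l * (z powr q + q * z powr (q - 1) * (- a * d) + ?c * (a * d)\<^sup>2) \<le> ?l * (z - a * d) powr q"
    using lm by (intro mult_left_mono) auto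
  have "z powr q + q * z powr (q - 1) * (b * d) + ?c * (b * d)\<^sup>2 \<le> (z + b * d) powr q"
    using powr_above_tangent[OF q e z(3) z(1)] by simp
  then have 2: "?m * (z powr q + q * z powr (q - 1) * (b * d) + ?c * (b * d)\<^sup>2) \<le> ?m * (z + b * d) powr q"
    using lm by (intro mult_left_mono) auto
  have "?l * (z powr q + q * z powr (q - 1) * (- a * d) + ?c * (a * d)\<^sup>2)
      + ?m * (z powr q + q * z powr (q - 1) * (b * d) + ?c * (b * d)\<^sup>2)
    = (?l + ?m) * z powr q + (q * z powr (q - 1) * d) * (?m * b - ?l * a) + ?c * d\<^sup>2 * (?l * a\<^sup>2 + ?m * b\<^sup>2)"
    by (simp only: power_mult_distrib) (simp add: algebra_simps)
  also have "\<dots> = z powr q + ?c * (a * b * d\<^sup>2)"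
    unfolding s2 lm(1) using lm(4) by simp
  finally show ?thesis using 1 2 by linarith
qed

lemma DERIV_powr_primitive:
  fixes u p :: real
  assumes p: "p \<ge> 1"
  shows "((\<lambda>u. u * \<bar>u\<bar> powr p / (p + 1)) has_real_derivative \<bar>u\<bar> powr p) (at u)"
proof -
  consider "u > 0" | "u < 0" | "u = 0" by linarith
  then show ?thesis
  proof cases
    case 1
    have "((\<lambda>u. u powr (p + 1) / (p + 1)) has_real_derivative \<bar>u\<bar> powr p) (at u)"
      using 1 p by (auto intro!: derivative_eq_intros)
    then show ?thesis
      by (rule has_field_derivative_transform_within_open[where S = "{0<..}"]) (use 1 in \<open>auto simp: powr_add\<close>)
  next
    case 2
    have "((\<lambda>u. - ((- u) powr (p + 1) / (p + 1))) has_real_derivative \<bar>u\<bar> powr p) (at u)"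
      using 2 p by (auto intro!: derivative_eq_intros)
    then show ?thesis
      by (rule has_field_derivative_transform_within_open[where S = "{..<0}"]) (use 2 in \<open>auto simp: powr_add\<close>)
  next
    case 3
    have "((\<lambda>u. \<bar>u\<bar> powr p / (p + 1)) \<longlongrightarrow> 0 powr p / (p + 1)) (at (0::real))"
      using p by (intro tendsto_intros tendsto_rabs_zero) auto
    then have "((\<lambda>u. \<bar>u\<bar> powr p / (p + 1)) \<longlongrightarrow> \<bar>0\<bar> powr p) (at (0::real))" by simp
    then have "((\<lambda>y. (y * \<bar>y\<bar> powr p / (p + 1) - 0 * \<bar>0\<bar> powr p / (p + 1)) / (y - 0)) \<longlongrightarrow> \<bar>0\<bar> powr p) (at (0::real))"
      by (rule Lim_transform_eventually) (auto simp: eventually_at intro!: exI[of _ 1])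
    then show ?thesis unfolding 3 has_field_derivative_iff by simp
  qed
qed

text \<open>Over a segment on which the affine function changes sign, the convexity gap of \<open>|u|^p\<close> has an
  integral of quadratic order, uniformly down to \<open>p = 1\<close>, although it may vanish pointwise.\<close>
lemma integrated_convexity_gap:
  fixes p e a b d u0 u1 s0 s1 :: real
  assumes p: "p \<ge> 1" and e: "e > 0" and ab: "a > 0" "b > 0" and u1: "u1 > 0" and s: "s0 \<le> s1"
    and lo: "\<And>t. t \<in> {- a, 0, b} \<Longrightarrow> u0 + u1 * s0 + t * d < - e"
    and hi: "\<And>t. t \<in> {- a, 0, b} \<Longrightarrow> u0 + u1 * s1 + t * d > e"
  shows "ennreal (2 * (e powr (p - 1) * (a * b * d\<^sup>2)) / ((p + 1) * u1)) \<le>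
    (\<integral>\<^sup>+s. ennreal (b / (a + b) * \<bar>u0 + u1 * s - a * d\<bar> powr p + a / (a + b) * \<bar>u0 + u1 * s + b * d\<bar> powr p
        - \<bar>u0 + u1 * s\<bar> powr p) * indicator {s0..s1} s \<partial>lborel)"
proof -
  let ?l = "b / (a + b)" and ?m = "a / (a + b)"
  let ?f = "\<lambda>s. ?l * \<bar>u0 + u1 * s - a * d\<bar> powr p + ?m * \<bar>u0 + u1 * s + b * d\<bar> powr p - \<bar>u0 + u1 * s\<bar> powr p"
  \<comment> \<open>A primitive of |u|^p. It has degree p + 1 >= 2, so the quadratic gap is
    available for it even at p = 1. It is odd, so the gaps at the two ends, where u has opposite
    signs, add up.\<close>
  define H where "H = (\<lambda>u. u * \<bar>u\<bar> powr p / (p + 1))"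
  define F where "F = (\<lambda>s. (?l * H (u0 + u1 * s - a * d) + ?m * H (u0 + u1 * s + b * d) - H (u0 + u1 * s)) / u1)"
  have lm: "?l + ?m = 1" "?l \<ge> 0" "?m \<ge> 0" "?l * a = ?m * b" "1 - ?l = ?m"
    using ab by (simp_all add: add_divide_distrib[symmetric] field_simps)
  have l1: "?l \<le> 1" using lm by linarith
  have dH: "((\<lambda>s. H (c + u1 * s)) has_real_derivative (\<bar>c + u1 * s\<bar> powr p * u1)) (at s)" for c s
    unfolding H_def by (rule DERIV_chain'[OF _ DERIV_powr_primitive[OF p], of "\<lambda>s. c + u1 * s" u1 s, simplified])
      (auto intro!: derivative_eq_intros)
  have dF: "(F has_real_derivative ?f s) (at s)" for s
  proof -
    have 1: "((\<lambda>s. H (u0 + u1 * s - a * d)) has_real_derivative (\<bar>u0 + u1 * s - a * d\<bar> powr p * u1)) (at s)"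
      using dH[of "u0 - a * d" s] by (simp add: algebra_simps)
    have 2: "((\<lambda>s. H (u0 + u1 * s + b * d)) has_real_derivative (\<bar>u0 + u1 * s + b * d\<bar> powr p * u1)) (at s)"
      using dH[of "u0 + b * d" s] by (simp add: algebra_simps)
    have "((\<lambda>s. ?l * H (u0 + u1 * s - a * d) + ?m * H (u0 + u1 * s + b * d) - H (u0 + u1 * s)) has_real_derivative (?f s * u1)) (at s)"
      by (rule derivative_eq_intros 1 2 dH[of u0 s] refl)+ (simp add: algebra_simps)
    from DERIV_cdivide[OF this, of u1] show ?thesis unfolding F_def using u1 by simp
  qed
  have f0: "0 \<le> ?f s" for s
  proof -
    have "?l * (u0 + u1 * s - a * d) + (1 - ?l) * (u0 + u1 * s + b * d) = (?l + ?m) * (u0 + u1 * s) + d * (?m * b - ?l * a)"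
      unfolding lm(5) by (simp only: distrib_left distrib_right right_diff_distrib left_diff_distrib mult_ac)
    also have "\<dots> = u0 + u1 * s" unfolding lm(1,4) by simp
    finally have "?l * (u0 + u1 * s - a * d) + (1 - ?l) * (u0 + u1 * s + b * d) = u0 + u1 * s" .
    then show ?thesis
      using abs_powr_convex[OF p lm(2) l1, of "u0 + u1 * s - a * d" "u0 + u1 * s + b * d"] unfolding lm(5) by simp
  qed
  have Hpos: "H u = u powr (p + 1) / (p + 1)" "H (- u) = - (u powr (p + 1) / (p + 1))" if "u > 0" for u
    using that by (simp_all add: H_def powr_add mult.commute)
  let ?g = "e powr (p - 1) * (a * b * d\<^sup>2)"
  have q: "p + 1 \<ge> 2" "p + 1 - 2 = p - 1" using p by auto
  have pp: "p + 1 > 0" using p by simp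
  have top: "?l * H (u0 + u1 * s1 - a * d) + ?m * H (u0 + u1 * s1 + b * d) - H (u0 + u1 * s1) \<ge> ?g / (p + 1)"
  proof -
    let ?z = "u0 + u1 * s1"
    have z: "?z > e" "?z - a * d > e" "?z + b * d > e" using hi[of 0] hi[of "-a"] hi[of b] by auto
    have "?z powr (p + 1) + ?g \<le> ?l * (?z - a * d) powr (p + 1) + ?m * (?z + b * d) powr (p + 1)"
      using powr_convexity_gap[OF q(1) e ab z] unfolding q(2) .
    then have "(?z powr (p + 1) + ?g) / (p + 1) \<le> (?l * (?z - a * d) powr (p + 1) + ?m * (?z + b * d) powr (p + 1)) / (p + 1)"
      using pp by (intro divide_right_mono) auto
    then show ?thesis using z e by (simp add: Hpos add_divide_distrib)
  qed
  have bot: "?l * H (u0 + u1 * s0 - a * d) + ?m * H (u0 + u1 * s0 + b * d) - H (u0 + u1 * s0) \<le> - (?g / (p + 1))"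
  proof -
    let ?z = "- (u0 + u1 * s0)"
    have z: "?z > e" "?z - a * (- d) > e" "?z + b * (- d) > e" using lo[of 0] lo[of "-a"] lo[of b] by auto
    have "?z powr (p + 1) + ?g \<le> ?l * (?z - a * (- d)) powr (p + 1) + ?m * (?z + b * (- d)) powr (p + 1)"
      using powr_convexity_gap[OF q(1) e ab z] unfolding q(2) by simp
    then have le: "(?z powr (p + 1) + ?g) / (p + 1) \<le> (?l * (?z - a * (- d)) powr (p + 1) + ?m * (?z + b * (- d)) powr (p + 1)) / (p + 1)"
      using pp by (intro divide_right_mono) auto
    have "H (u0 + u1 * s0 - a * d) = - ((?z - a * (- d)) powr (p + 1) / (p + 1))"
      "H (u0 + u1 * s0 + b * d) = - ((?z + b * (- d)) powr (p + 1) / (p + 1))"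
      "H (u0 + u1 * s0) = - (?z powr (p + 1) / (p + 1))"
      using Hpos(2)[of "?z - a * (- d)"] Hpos(2)[of "?z + b * (- d)"] Hpos(2)[of ?z] z e by (simp_all add: algebra_simps)
    then show ?thesis using le by (simp add: add_divide_distrib)
  qed
  have "2 * ?g / ((p + 1) * u1) = (?g / (p + 1) - - (?g / (p + 1))) / u1" by simp
  also have "\<dots> \<le> F s1 - F s0"
    unfolding F_def diff_divide_distrib[symmetric] using u1
    by (intro divide_right_mono diff_mono top bot) simp
  finally have "ennreal (2 * ?g / ((p + 1) * u1)) \<le> ennreal (F s1 - F s0)" by (rule ennreal_leI)
  also have "\<dots> = (\<integral>\<^sup>+s. ennreal (?f s) * indicator {s0..s1} s \<partial>lborel)"
    by (rule nn_integral_FTC_Icc[symmetric]) (use dF f0 s in auto)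
  finally show ?thesis .
qed

text \<open>Fubini along the lines of slope \<sigma>. When \<sigma> is the slope of the displacement
  v, two points of such a line differ by a multiple of v, so the rate of change of the determinant
  is constant on the line.\<close>

lemma nn_integral_sheared_plane:
  fixes f :: "real^2 \<Rightarrow> ennreal"
  assumes f [measurable]: "f \<in> borel_measurable borel"
  shows "(\<integral>\<^sup>+z. f z \<partial>lborel) = (\<integral>\<^sup>+r. \<integral>\<^sup>+s. f (vector [s, \<sigma> * s + r]) \<partial>lborel \<partial>lborel)"
proof -
  define c :: "real \<times> real \<Rightarrow> real^2" where "c = (\<lambda>x. fst x *\<^sub>R axis 1 1 + snd x *\<^sub>R axis 2 1)"
  have c: "c (s, r) = vector [s, r]" for s r
    by (simp add: c_def vec_eq_iff forall_2 axis_def vector_2)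
  have [measurable]: "c \<in> borel_measurable borel"
    unfolding c_def by (intro borel_measurable_continuous_onI continuous_intros)
  then have cm [measurable]: "c \<in> borel_measurable (lborel \<Otimes>\<^sub>M lborel)" by (simp add: lborel_prod)
  have B: "(Basis :: (real^2) set) = {axis 1 1, axis 2 1}"
    by (auto simp: Basis_vec_def UNIV_2)
  have "lborel = distr (lborel \<Otimes>\<^sub>M lborel) borel c"
  proof (rule lborel_eqI)
    fix l u :: "real^2" assume le: "\<And>b. b \<in> Basis \<Longrightarrow> l \<bullet> b \<le> u \<bullet> b"
    have lu: "l$1 \<le> u$1" "l$2 \<le> u$2" using le[of "axis 1 1"] le[of "axis 2 1"] by (simp_all add: B inner_axis)
    have "c -` box l u = {l$1<..<u$1} \<times> {l$2<..<u$2}"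
      by (auto simp: c mem_box_cart forall_2 vector_2)
    moreover have "emeasure (distr (lborel \<Otimes>\<^sub>M lborel) borel c) (box l u) = emeasure (lborel \<Otimes>\<^sub>M lborel) (c -` box l u)"
      by (subst emeasure_distr) (simp_all add: lborel_prod)
    moreover have "emeasure (lborel \<Otimes>\<^sub>M lborel) ({l$1<..<u$1} \<times> {l$2<..<u$2}) = emeasure lborel {l$1<..<u$1} * emeasure lborel {l$2<..<u$2}"
      by (rule lborel.emeasure_pair_measure_Times) simp_all
    ultimately have "emeasure (distr (lborel \<Otimes>\<^sub>M lborel) borel c) (box l u) = ennreal ((u$1 - l$1) * (u$2 - l$2))"
      using lu by (simp add: ennreal_mult)
    also have "(u$1 - l$1) * (u$2 - l$2) = (\<Prod>b\<in>Basis. (u - l) \<bullet> b)"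
      by (simp add: B inner_axis axis_eq_axis)
    finally show "emeasure (distr (lborel \<Otimes>\<^sub>M lborel) borel c) (box l u) = ennreal (\<Prod>b\<in>Basis. (u - l) \<bullet> b)" .
  qed simp
  then have "(\<integral>\<^sup>+z. f z \<partial>lborel) = (\<integral>\<^sup>+z. f z \<partial>distr (lborel \<Otimes>\<^sub>M lborel) borel c)" by simp
  also have "\<dots> = (\<integral>\<^sup>+x. f (c x) \<partial>(lborel \<Otimes>\<^sub>M lborel))"
    by (rule nn_integral_distr) simp_all
  also have "\<dots> = (\<integral>\<^sup>+s. \<integral>\<^sup>+r. f (c (s, r)) \<partial>lborel \<partial>lborel)"
    by (rule lborel.nn_integral_fst[symmetric]) simp
  also have "\<dots> = (\<integral>\<^sup>+s. \<integral>\<^sup>+r. f (c (s, \<sigma> * s + r)) \<partial>lborel \<partial>lborel)"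
  proof (rule nn_integral_cong)
    fix s
    have [measurable]: "(\<lambda>r. f (c (s, r))) \<in> borel_measurable borel"
    proof -
      have "(\<lambda>r::real. c (s, r)) \<in> borel_measurable borel"
        unfolding c_def by (intro borel_measurable_continuous_onI continuous_intros)
      from measurable_compose[OF this f] show ?thesis .
    qed
    show "(\<integral>\<^sup>+r. f (c (s, r)) \<partial>lborel) = (\<integral>\<^sup>+r. f (c (s, \<sigma> * s + r)) \<partial>lborel)"
      using nn_integral_real_affine[of "\<lambda>r. f (c (s, r))" 1 "\<sigma> * s"] by simp
  qed
  also have "\<dots> = (\<integral>\<^sup>+r. \<integral>\<^sup>+s. f (c (s, \<sigma> * s + r)) \<partial>lborel \<partial>lborel)"
  proof (rule lborel_pair.Fubini'[symmetric])
    have "(\<lambda>x::real \<times> real. c (fst x, \<sigma> * fst x + snd x)) \<in> borel_measurable borel"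
      unfolding c_def by (intro borel_measurable_continuous_onI continuous_intros)
    from measurable_compose[OF this f]
    show "(\<lambda>(s, r). f (c (s, \<sigma> * s + r))) \<in> borel_measurable (lborel \<Otimes>\<^sub>M lborel)"
      by (simp add: case_prod_beta lborel_prod)
  qed
  finally show ?thesis by (simp add: c)
qed

text \<open>All displacements are parallel to v, so their mutual determinants vanish and no
  quadratic term appears. This makes the determinants affine in the sliding parameter.\<close>

lemma cr_displaced:
  "cr (X + s1 *\<^sub>R v) (Y + s2 *\<^sub>R v) (Z + s3 *\<^sub>R v) = cr X Y Z
    + s1 * ((Y$2 - Z$2) * v$1 + (Z$1 - Y$1) * v$2)
    + s2 * ((Z$2 - X$2) * v$1 + (X$1 - Z$1) * v$2)
    + s3 * ((X$2 - Y$2) * v$1 + (Y$1 - X$1) * v$2)"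
  by (simp add: cr_def algebra_simps)

lemma powr_split_two:
  fixes u v x :: real
  assumes p: "p \<ge> 1" and ab: "a > 0" "b > 0" and u: "u = c - a * d" and v: "v = c + b * d" and w: "w \<ge> 0"
  shows "(\<bar>c\<bar> * w) powr p \<le> b / (a + b) * (\<bar>u\<bar> * w) powr p + a / (a + b) * (\<bar>v\<bar> * w) powr p"
proof -
  let ?l = "b / (a + b)" and ?m = "a / (a + b)"
  have lm: "?l + ?m = 1" "?l \<ge> 0" "?m \<ge> 0" "?l * a = ?m * b" "1 - ?l = ?m"
    using ab by (simp_all add: add_divide_distrib[symmetric] field_simps)
  have l1: "?l \<le> 1" using lm by linarith
  have "?l * (u * w) + (1 - ?l) * (v * w) = (?l + ?m) * (c * w) + d * w * (?m * b - ?l * a)"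
    unfolding lm(5) u v by (simp add: algebra_simps)
  also have "\<dots> = c * w" unfolding lm(1,4) by simp
  finally have "?l * (u * w) + (1 - ?l) * (v * w) = c * w" .
  then show ?thesis
    using abs_powr_convex[OF p lm(2) l1, of "u * w" "v * w"] w unfolding lm(5) by (simp add: abs_mult)
qed

section \<open>Convexity of the functionals along a fold\<close>

context fold
begin

text \<open>The innermost integral as a function of the second point. The first point g moves with
  speed \<beta>, which is \<open>max 0 (h g)\<close> for a random point of the body and
  \<open>drift K\<close> for the centroid; so one estimate serves both functionals.\<close>

definition fibre :: "(real^2) set \<Rightarrow> real \<Rightarrow> real^2 \<Rightarrow> real \<Rightarrow> real \<Rightarrow> real^2 \<Rightarrow> ennreal" where
  "fibre K p g \<beta> t x = (\<integral>\<^sup>+z. kern p (wt K) (g + (t * \<beta>) *\<^sub>R v) (fold_map v h t x) (fold_map v h t z) \<partial>unif K)"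

lemma fold_measurable [measurable]: "fold_map v h t \<in> borel_measurable borel"
  by (intro borel_measurable_continuous_onI continuous_on_fold)

lemma
  assumes K: "planar_convex_body K" and fK: "planar_convex_body (fold_map v h t ` K)"
  shows area_fold: "area (fold_map v h t ` K) = area K"
    and unif_fold: "distr (unif K) borel (fold_map v h t) = unif (fold_map v h t ` K)"
proof -
  note * = K fK fold_measurable inj_fold
  show "area (fold_map v h t ` K) = area K"
    using area_push[OF *, of 1] emeasure_vimage_fold by simp
  show "distr (unif K) borel (fold_map v h t) = unif (fold_map v h t ` K)"
    using unif_push[OF *, of 1] emeasure_vimage_fold by simp
qed

definition drift :: "(real^2) set \<Rightarrow> real" where
  "drift K = (\<integral>x. max 0 (h x) \<partial>unif K)"

lemma drift_nonneg: "drift K \<ge> 0"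
  unfolding drift_def by (intro integral_nonneg_AE) auto

lemma centroid_fold:
  assumes K: "planar_convex_body K" and fK: "planar_convex_body (fold_map v h t ` K)"
  shows "centroid (fold_map v h t ` K) = centroid K + (t * drift K) *\<^sub>R v"
proof -
  have i1: "integrable (unif K) (\<lambda>x. x $ i)" for i
    by (rule integrable_unif[OF K]) (intro continuous_intros)
  have i2: "integrable (unif K) (\<lambda>x. max 0 (h x))"
    by (rule integrable_unif[OF K]) (intro continuous_intros continuous_on_h)
  have "centroid (fold_map v h t ` K) $ i = centroid K $ i + (t * drift K) * v $ i" for i
  proof -
    have "centroid (fold_map v h t ` K) $ i = (\<integral>x. x $ i + (t * v $ i) * max 0 (h x) \<partial>unif K)"
      unfolding centroid_push[OF K fK fold_measurable unif_fold[OF K fK]]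
      by (intro Bochner_Integration.integral_cong) (simp_all add: fold_map_def)
    also have "\<dots> = centroid K $ i + (t * v $ i) * drift K"
      unfolding centroid_nth[OF K] drift_def by (subst Bochner_Integration.integral_add) (use i1 i2 in auto)
    finally show ?thesis by (simp add: mult_ac)
  qed
  then show ?thesis by (simp add: vec_eq_iff)
qed

lemma N2_fold:
  assumes K: "planar_convex_body K" and fK: "planar_convex_body (fold_map v h t ` K)"
  shows "N2 p (wt K) (g + (t * \<beta>) *\<^sub>R v) (fold_map v h t ` K) = (\<integral>\<^sup>+x. fibre K p g \<beta> t x \<partial>unif K)"
  unfolding N2_push[OF K fK fold_measurable unif_fold[OF K fK]] fibre_def ..

lemma ennreal_Phi_fold:
  assumes K: "planar_convex_body K" and fK: "planar_convex_body (fold_map v h t ` K)" and p: "p \<ge> 1"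
  shows "ennreal (Phi m p (fold_map v h t ` K)) =
    (if m then \<integral>\<^sup>+g. \<integral>\<^sup>+x. fibre K p g (max 0 (h g)) t x \<partial>unif K \<partial>unif K
     else \<integral>\<^sup>+x. fibre K p (centroid K) (drift K) t x \<partial>unif K)"
proof -
  have "N3 p (wt K) (fold_map v h t ` K) = (\<integral>\<^sup>+g. \<integral>\<^sup>+x. fibre K p g (max 0 (h g)) t x \<partial>unif K \<partial>unif K)"
    unfolding N3_push[OF K fK fold_measurable unif_fold[OF K fK]] N2_fold[OF K fK, symmetric]
    by (simp add: fold_map_def)
  then show ?thesis
    by (simp add: ennreal_Phi[OF fK p] area_fold[OF K fK] centroid_fold[OF K fK] N2_fold[OF K fK])
qed

lemma fibre_measurable:
  assumes K: "planar_convex_body K"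
  shows "(\<lambda>x. fibre K p g \<beta> t x) \<in> borel_measurable borel"
  unfolding fibre_def by (intro kern_integral_measurable[OF K]) simp_all

lemma fibre_integral_measurable:
  assumes K: "planar_convex_body K"
  shows "(\<lambda>g. \<integral>\<^sup>+x. fibre K p g (max 0 (h g)) t x \<partial>unif K) \<in> borel_measurable borel"
proof -
  have "(\<lambda>g. g + (t * max 0 (h g)) *\<^sub>R v) \<in> borel_measurable borel"
    using fold_measurable[of t] by (simp add: fold_map_def[abs_def])
  then show ?thesis unfolding fibre_def by (intro kern_integral2_measurable[OF K]) simp_all
qed

lemma kern_fold_convex:
  assumes p: "p \<ge> 1" and ab: "a > 0" "b > 0" and w: "w \<ge> 0"
  shows "kern p w g (fold_map v h 0 x) (fold_map v h 0 z)
    \<le> ennreal (b / (a + b)) * kern p w (g + ((- a) * \<beta>) *\<^sub>R v) (fold_map v h (- a) x) (fold_map v h (- a) z)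
     + ennreal (a / (a + b)) * kern p w (g + (b * \<beta>) *\<^sub>R v) (fold_map v h b x) (fold_map v h b z)"
proof -
  define d where "d = \<beta> * ((x$2 - z$2) * v$1 + (z$1 - x$1) * v$2)
    + max 0 (h x) * ((z$2 - g$2) * v$1 + (g$1 - z$1) * v$2)
    + max 0 (h z) * ((g$2 - x$2) * v$1 + (x$1 - g$1) * v$2)"
  have cr: "cr (g + (t * \<beta>) *\<^sub>R v) (fold_map v h t x) (fold_map v h t z) = cr g x z + t * d" for t
    unfolding fold_map_def cr_displaced d_def by (simp add: algebra_simps)
  show ?thesis
    unfolding kern_def cr fold_0
    using ab powr_split_two[OF p ab refl refl w, of "cr g x z" d]
    by (simp add: ennreal_mult[symmetric] ennreal_plus[symmetric] del: ennreal_plus) 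
qed

lemma fibre_convex:
  assumes K: "planar_convex_body K" and p: "p \<ge> 1" and ab: "a > 0" "b > 0"
  shows "fibre K p g \<beta> 0 x \<le> ennreal (b / (a + b)) * fibre K p g \<beta> (- a) x + ennreal (a / (a + b)) * fibre K p g \<beta> b x"
proof -
  have w: "wt K \<ge> 0" using body_emeasure(2)[OF K] by simp
  have [measurable]: "fold_map v h t \<in> borel_measurable (unif K)" for t using fold_measurable by simp
  have "fibre K p g \<beta> 0 x \<le> (\<integral>\<^sup>+z. ennreal (b / (a + b)) * kern p (wt K) (g + ((- a) * \<beta>) *\<^sub>R v) (fold_map v h (- a) x) (fold_map v h (- a) z)
     + ennreal (a / (a + b)) * kern p (wt K) (g + (b * \<beta>) *\<^sub>R v) (fold_map v h b x) (fold_map v h b z) \<partial>unif K)"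
    unfolding fibre_def using kern_fold_convex[OF p ab w] by (intro nn_integral_mono) simp
  also have "\<dots> = ennreal (b / (a + b)) * fibre K p g \<beta> (- a) x + ennreal (a / (a + b)) * fibre K p g \<beta> b x"
    unfolding fibre_def by (subst nn_integral_add) (simp_all add: nn_integral_cmult)
  finally show ?thesis .
qed

lemma fibre_gap_integral:
  assumes K: "planar_convex_body K" and p: "p \<ge> 1" and ab: "a > 0" "b > 0" and X: "X \<in> sets borel"
    and gap: "\<And>x. x \<in> X \<Longrightarrow> fibre K p g \<beta> 0 x + k
      \<le> ennreal (b / (a + b)) * fibre K p g \<beta> (- a) x + ennreal (a / (a + b)) * fibre K p g \<beta> b x"
  shows "(\<integral>\<^sup>+x. fibre K p g \<beta> 0 x \<partial>unif K) + k * emeasure (unif K) X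
    \<le> ennreal (b / (a + b)) * (\<integral>\<^sup>+x. fibre K p g \<beta> (- a) x \<partial>unif K) + ennreal (a / (a + b)) * (\<integral>\<^sup>+x. fibre K p g \<beta> b x \<partial>unif K)"
proof -
  have [measurable]: "(\<lambda>x. fibre K p g \<beta> t x) \<in> borel_measurable (unif K)" for t
    using fibre_measurable[OF K] by simp
  have [measurable]: "X \<in> sets (unif K)" using X by simp
  have "(\<integral>\<^sup>+x. fibre K p g \<beta> 0 x \<partial>unif K) + k * emeasure (unif K) X
    = (\<integral>\<^sup>+x. fibre K p g \<beta> 0 x + k * indicator X x \<partial>unif K)"
    using X by (subst nn_integral_add) (simp_all add: nn_integral_cmult_indicator)
  also have "\<dots> \<le> (\<integral>\<^sup>+x. ennreal (b / (a + b)) * fibre K p g \<beta> (- a) x + ennreal (a / (a + b)) * fibre K p g \<beta> b x \<partial>unif K)"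
    using gap fibre_convex[OF K p ab] by (intro nn_integral_mono) (auto split: split_indicator)
  also have "\<dots> = ennreal (b / (a + b)) * (\<integral>\<^sup>+x. fibre K p g \<beta> (- a) x \<partial>unif K) + ennreal (a / (a + b)) * (\<integral>\<^sup>+x. fibre K p g \<beta> b x \<partial>unif K)"
    by (subst nn_integral_add) (simp_all add: nn_integral_cmult)
  finally show ?thesis .
qed

text \<open>The gap k is asked for only on \<open>X\<close> and, with three random points, on
  \<open>B\<close>; elsewhere the convexity of the fibres is enough. With k = 0 and empty sets the
  result is plain convexity along the motion.\<close>

lemma Phi_fold_gap:
  assumes K: "planar_convex_body K" and p: "p \<ge> 1" and ab: "a > 0" "b > 0"
    and Ka: "planar_convex_body (fold_map v h (- a) ` K)" and Kb: "planar_convex_body (fold_map v h b ` K)"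
    and X: "X \<in> sets borel" and B: "B \<in> sets borel" and k: "k \<ge> 0"
    and gap3: "\<And>g x. m \<Longrightarrow> g \<in> B \<Longrightarrow> x \<in> X \<Longrightarrow> fibre K p g (max 0 (h g)) 0 x + ennreal k
      \<le> ennreal (b / (a + b)) * fibre K p g (max 0 (h g)) (- a) x + ennreal (a / (a + b)) * fibre K p g (max 0 (h g)) b x"
    and gapc: "\<And>x. \<not> m \<Longrightarrow> x \<in> X \<Longrightarrow> fibre K p (centroid K) (drift K) 0 x + ennreal k
      \<le> ennreal (b / (a + b)) * fibre K p (centroid K) (drift K) (- a) x + ennreal (a / (a + b)) * fibre K p (centroid K) (drift K) b x"
  shows "Phi m p K + k * measure (unif K) X * (if m then measure (unif K) B else 1)
    \<le> b / (a + b) * Phi m p (fold_map v h (- a) ` K) + a / (a + b) * Phi m p (fold_map v h b ` K)"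
proof -
  interpret finite_measure "unif K" by (rule unif_finite[OF K])
  let ?l = "ennreal (b / (a + b))" and ?m = "ennreal (a / (a + b))"
  have K0: "planar_convex_body (fold_map v h 0 ` K)" using K by simp
  let ?Q = "\<lambda>t g. \<integral>\<^sup>+x. fibre K p g (max 0 (h g)) t x \<partial>unif K"
  have "ennreal (Phi m p K) + ennreal k * emeasure (unif K) X * (if m then emeasure (unif K) B else 1)
    \<le> ?l * ennreal (Phi m p (fold_map v h (- a) ` K)) + ?m * ennreal (Phi m p (fold_map v h b ` K))"
  proof (cases m)
    case True
    have [measurable]: "?Q t \<in> borel_measurable (unif K)" for t
      using fibre_integral_measurable[OF K] by simp
    have [measurable]: "B \<in> sets (unif K)" using B by simp
    have "(\<integral>\<^sup>+g. ?Q 0 g \<partial>unif K) + (ennreal k * emeasure (unif K) X) * emeasure (unif K) B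
      = (\<integral>\<^sup>+g. ?Q 0 g + (ennreal k * emeasure (unif K) X) * indicator B g \<partial>unif K)"
      using B by (subst nn_integral_add) (simp_all add: nn_integral_cmult_indicator)
    also have "\<dots> \<le> (\<integral>\<^sup>+g. ?l * ?Q (- a) g + ?m * ?Q b g \<partial>unif K)"
    proof (rule nn_integral_mono)
      fix g
      show "?Q 0 g + (ennreal k * emeasure (unif K) X) * indicator B g \<le> ?l * ?Q (- a) g + ?m * ?Q b g"
      proof (cases "g \<in> B")
        case True
        then show ?thesis using fibre_gap_integral[OF K p ab X gap3[OF \<open>m\<close>]] by simp
      next
        case False
        then show ?thesis using fibre_gap_integral[OF K p ab, of "{}" g "max 0 (h g)" 0] by simp
      qed
    qed
    also have "\<dots> = ?l * (\<integral>\<^sup>+g. ?Q (- a) g \<partial>unif K) + ?m * (\<integral>\<^sup>+g. ?Q b g \<partial>unif K)"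
      by (subst nn_integral_add) (simp_all add: nn_integral_cmult)
    finally show ?thesis
      using ennreal_Phi_fold[OF K K0 p, of m] by (simp add: True ennreal_Phi_fold[OF K Ka p] ennreal_Phi_fold[OF K Kb p])
  next
    case False
    then show ?thesis
      using ennreal_Phi_fold[OF K K0 p, of m] fibre_gap_integral[OF K p ab X gapc]
      by (simp add: ennreal_Phi_fold[OF K Ka p] ennreal_Phi_fold[OF K Kb p])
  qed
  also have "?l * ennreal (Phi m p (fold_map v h (- a) ` K)) + ?m * ennreal (Phi m p (fold_map v h b ` K))
    = ennreal (b / (a + b) * Phi m p (fold_map v h (- a) ` K) + a / (a + b) * Phi m p (fold_map v h b ` K))"
    using ab Phi_bounds(1)[OF Ka p] Phi_bounds(1)[OF Kb p]
    by (simp add: ennreal_mult[symmetric] ennreal_plus[symmetric] del: ennreal_plus)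
  also have "ennreal (Phi m p K) + ennreal k * emeasure (unif K) X * (if m then emeasure (unif K) B else 1)
    = ennreal (Phi m p K + k * measure (unif K) X * (if m then measure (unif K) B else 1))"
    using k Phi_bounds(1)[OF K p]
    by (simp add: emeasure_eq_measure ennreal_mult[symmetric] ennreal_plus[symmetric] del: ennreal_plus)
  finally show ?thesis
    using ab Phi_bounds(1)[OF Ka p] Phi_bounds(1)[OF Kb p]
    by (subst (asm) ennreal_le_iff) auto
qed

end

section \<open>The reference triangle and the gain in normalised position\<close>

lemma triangle_memI:
  assumes "cr X Y W > 0" "cr X Y Z \<ge> 0" "cr Y W Z \<ge> 0" "cr W X Z \<ge> 0"
  shows "Z \<in> convex hull {X, Y, W}"
proof -
  let ?c = "cr X Y W"
  have sum: "cr Y W Z + cr W X Z + cr X Y Z = ?c" by (simp add: cr_def algebra_simps)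
  have "?c *\<^sub>R Z = cr Y W Z *\<^sub>R X + cr W X Z *\<^sub>R Y + cr X Y Z *\<^sub>R W"
    by (simp add: vec_eq_iff forall_2 cr_def algebra_simps)
  then have "(1 / ?c) *\<^sub>R (?c *\<^sub>R Z) = (1 / ?c) *\<^sub>R (cr Y W Z *\<^sub>R X + cr W X Z *\<^sub>R Y + cr X Y Z *\<^sub>R W)" by simp
  then have Z: "Z = (cr Y W Z / ?c) *\<^sub>R X + (cr W X Z / ?c) *\<^sub>R Y + (cr X Y Z / ?c) *\<^sub>R W"
    using assms(1) by (simp add: scaleR_add_right)
  have "cr Y W Z / ?c + cr W X Z / ?c + cr X Y Z / ?c = 1"
    using assms(1) sum by (simp add: add_divide_distrib[symmetric])
  then show ?thesis unfolding convex_hull_3 mem_Collect_eq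
    using assms Z divide_nonneg_pos[OF _ assms(1)] by blast
qed

lemma affmap_hull: "affmap A u ` (convex hull S) = convex hull (affmap A u ` S)"
proof -
  have eq: "affmap A u ` X = (+) u ` ((*v) A ` X)" for X
    by (auto simp: affmap_def image_image add.commute)
  show ?thesis unfolding eq by (simp add: convex_hull_linear_image[symmetric] convex_hull_translation)
qed

lemma body_triangle:
  assumes "cr X Y W \<noteq> 0"
  shows "planar_convex_body (convex hull {X, Y, W})"
proof -
  have "convex hull {X, Y, W} \<notin> null_sets lborel"
    using assms area_triangle[of X Y W] by (auto simp: area_def measure_def null_sets_def)
  moreover have c: "compact (convex hull {X, Y, W})" by (intro finite_imp_compact_convex_hull) auto
  ultimately have "\<not> negligible (convex hull {X, Y, W})"
    by (simp add: negligible_iff_null_sets null_sets_completion_iff borel_closed compact_imp_closed)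
  then have "interior (convex hull {X, Y, W}) \<noteq> {}"
    using negligible_convex_interior[of "convex hull {X, Y, W}"] by auto
  then show ?thesis using c by (simp add: planar_convex_body_def)
qed

abbreviation "PP \<equiv> (vector [0, 0] :: real^2)"
abbreviation "QQ \<equiv> (vector [1, 0] :: real^2)"
abbreviation "SS \<equiv> (vector [0, 1] :: real^2)"

definition T0 :: "(real^2) set" where "T0 = convex hull {PP, QQ, SS}"

lemma mem_T0: "z \<in> T0 \<longleftrightarrow> 0 \<le> z$1 \<and> 0 \<le> z$2 \<and> z$1 + z$2 \<le> 1"
proof
  assume "z \<in> T0"
  then show "0 \<le> z$1 \<and> 0 \<le> z$2 \<and> z$1 + z$2 \<le> 1"
    by (auto simp: T0_def convex_hull_3)
next
  assume "0 \<le> z$1 \<and> 0 \<le> z$2 \<and> z$1 + z$2 \<le> 1"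
  then show "z \<in> T0" unfolding T0_def by (intro triangle_memI) (auto simp: cr_def)
qed

lemma body_T0: "planar_convex_body T0"
  unfolding T0_def by (rule body_triangle) (simp add: cr_def)

lemma area_T0: "area T0 = 1/2"
  by (simp add: T0_def area_triangle cr_def)

text \<open>The affine map that permutes the vertices cyclically preserves \<open>T0\<close> and
  hence fixes the centroid. This yields two linear equations for the coordinates and avoids
  integration.\<close>

lemma centroid_T0: "centroid T0 $ 1 = 1/3" "centroid T0 $ 2 = 1/3"
proof -
  define A :: "real^2^2" where "A = vector [vector [-1, -1], vector [1, 0]]"
  have A: "A$1$1 = -1" "A$1$2 = -1" "A$2$1 = 1" "A$2$2 = 0" by (simp_all add: A_def)
  have inv: "invertible A" by (simp add: invertible_det_nz det_2 A)
  have "affmap A QQ PP = QQ" "affmap A QQ QQ = SS" "affmap A QQ SS = PP"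
    by (simp_all add: vec_eq_iff forall_2 affmap_nth A)
  then have T: "affmap A QQ ` T0 = T0" unfolding T0_def affmap_hull by (simp add: insert_commute)
  have m: "affmap A QQ \<in> borel_measurable borel"
    by (intro borel_measurable_continuous_onI continuous_on_affmap)
  have "centroid T0 $ i = (\<integral>x. affmap A QQ x $ i \<partial>unif T0)" for i
    using centroid_push[OF body_T0 _ m] unif_affmap[OF inv body_T0, of QQ] body_T0 by (simp add: T)
  then have "centroid T0 $ 1 = - centroid T0 $ 1 - centroid T0 $ 2 + 1" "centroid T0 $ 2 = centroid T0 $ 1"
    using centroid_affine[OF body_T0, of "-1" "-1" 1] centroid_affine[OF body_T0, of 1 0 0]
    by (simp_all add: affmap_nth A)
  then show "centroid T0 $ 1 = 1/3" "centroid T0 $ 2 = 1/3" by simp_all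
qed

text \<open>The part of \<open>K\<close> outside \<open>T0\<close> is at most 1/2000 of its area,
  and coordinates differ from 1/3 by at most 2.\<close>

lemma centroid_near:
  assumes K: "planar_convex_body K" and T: "T0 \<subseteq> K"
    and bd: "\<And>z. z \<in> K \<Longrightarrow> \<bar>z$1 - 1/3\<bar> \<le> 2 \<and> \<bar>z$2 - 1/3\<bar> \<le> 2" and ar: "area K \<le> 1/2 + 1/4000"
  shows "\<bar>centroid K$1 - 1/3\<bar> \<le> 1/1000" "\<bar>centroid K$2 - 1/3\<bar> \<le> 1/1000"
proof -
  define \<theta> where "\<theta> = (area K - area T0) / area K"
  have a: "1/2 \<le> area K" using area_mono[OF K T body_borel[OF body_T0]] by (simp add: area_T0)
  have "\<theta> \<le> (1/4000) / (1/2)" unfolding \<theta>_def area_T0 using a ar by (intro frac_le) auto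
  then have "\<theta> * 2 \<le> 1/1000" by simp
  moreover have "\<bar>centroid K$1 - 1/3\<bar> \<le> \<theta> * 2"
    using centroid_subset[OF K body_T0 T _ \<theta>_def, of 1 0 "- (1/3)" 2] bd by (simp add: centroid_T0)
  moreover have "\<bar>centroid K$2 - 1/3\<bar> \<le> \<theta> * 2"
    using centroid_subset[OF K body_T0 T _ \<theta>_def, of 0 1 "- (1/3)" 2] bd by (simp add: centroid_T0)
  ultimately have "\<bar>centroid K$1 - 1/3\<bar> \<le> 1/1000 \<and> \<bar>centroid K$2 - 1/3\<bar> \<le> 1/1000" by (meson order_trans)
  then show "\<bar>centroid K$1 - 1/3\<bar> \<le> 1/1000" "\<bar>centroid K$2 - 1/3\<bar> \<le> 1/1000" by auto
qed

lemma abs_prod_le: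
  fixes a b :: real
  assumes "\<bar>a\<bar> \<le> A" "\<bar>b\<bar> \<le> B"
  shows "\<bar>a * b\<bar> \<le> A * B"
  unfolding abs_mult using assms by (intro mult_mono) auto

text \<open>The line joining the centroid of \<open>T0\<close> to a point of the bottom side meets
  the height 1/6 halfway, at an abscissa between 1/6 and 2/3, hence strictly between 1/12 and 3/4.
  In the unperturbed position the two determinants are at most -1/36 and at least 1/36;
  perturbations by thousandths cost less than half of this.\<close>

lemma cr_probe:
  assumes g: "\<bar>g$1 - 1/3\<bar> \<le> 1/1000" "\<bar>g$2 - 1/3\<bar> \<le> 1/1000"
    and x: "-1/1000 \<le> x$1" "x$1 \<le> 1 + 1/1000" "\<bar>x$2\<bar> \<le> 1/1000" and z: "\<bar>z$2 - 1/6\<bar> \<le> 2/1000"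
  shows "z$1 = 1/12 \<Longrightarrow> cr g x z < - (1/72)" "z$1 = 3/4 \<Longrightarrow> 1/72 < cr g x z"
proof -
  let ?e = "z$2 - g$2 + 1/6" and ?f = "g$2 - x$2 - 1/3"
  have eq: "cr g x z = - (x$1 - g$1) / 6 + (x$1 - g$1) * ?e + (z$1 - g$1) / 3 + (z$1 - g$1) * ?f"
    by (simp add: cr_def field_simps)
  have 1: "\<bar>(x$1 - g$1) * ?e\<bar> \<le> (7/10) * (3/1000)"
    using g x z by (intro abs_prod_le) linarith+
  have 2: "\<bar>(z$1 - g$1) * ?f\<bar> \<le> (1/2) * (2/1000)" if "z$1 = 1/12 \<or> z$1 = 3/4"
  proof (rule abs_prod_le)
    show "\<bar>z$1 - g$1\<bar> \<le> 1/2" using g(1) that by (elim disjE) linarith+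
    show "\<bar>?f\<bar> \<le> 2/1000" using g(2) x(3) by linarith
  qed
  show "z$1 = 1/12 \<Longrightarrow> cr g x z < - (1/72)" unfolding eq using 1[unfolded abs_le_iff] 2[unfolded abs_le_iff] g[unfolded abs_le_iff] x by argo
  show "z$1 = 3/4 \<Longrightarrow> 1/72 < cr g x z" unfolding eq using 1[unfolded abs_le_iff] 2[unfolded abs_le_iff] g[unfolded abs_le_iff] x by argo
qed

context fold
begin

text \<open>The third point runs over a strip at height about 1/6, which the motion does not touch.
  For a first point near the centroid and a second one in the ear near the bottom side, the
  determinant changes sign along every line of the strip, at all three times; so the integrated gap
  applies line by line.\<close>

lemma fibre_gap:
  assumes K: "planar_convex_body K" and p: "p \<ge> 1" and ab: "a > 0" "b > 0"
    and ar: "1/2 \<le> area K" "area K \<le> 1" and v: "v$1 > 0" "\<bar>v$2\<bar> \<le> v$1 / 1000"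
    and \<Omega>K: "\<And>z. 1/12 \<le> z$1 \<Longrightarrow> z$1 \<le> 3/4 \<Longrightarrow> 1/8 \<le> z$2 \<Longrightarrow> z$2 \<le> 1/5 \<Longrightarrow> z \<in> K \<and> h z \<le> 0"
    and hx: "1/2 \<le> h x" and \<beta>: "\<beta> \<ge> 0"
    and g: "\<And>t. t \<in> {- a, 0, b} \<Longrightarrow> \<bar>(g + (t * \<beta>) *\<^sub>R v)$1 - 1/3\<bar> \<le> 1/1000 \<and> \<bar>(g + (t * \<beta>) *\<^sub>R v)$2 - 1/3\<bar> \<le> 1/1000"
    and x: "\<And>t. t \<in> {- a, 0, b} \<Longrightarrow> -1/1000 \<le> fold_map v h t x $ 1 \<and> fold_map v h t x $ 1 \<le> 1 + 1/1000 \<and> \<bar>fold_map v h t x $ 2\<bar> \<le> 1/1000"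
  shows "fibre K p g \<beta> 0 x + ennreal ((1/144) powr (p - 1) * (a * b * (v$1)\<^sup>2) / (576000 * (p + 1)))
    \<le> ennreal (b / (a + b)) * fibre K p g \<beta> (- a) x + ennreal (a / (a + b)) * fibre K p g \<beta> b x"
proof -
  define \<sigma> where "\<sigma> = v$2 / v$1"
  have \<sigma>: "\<bar>\<sigma>\<bar> \<le> 1/1000" using v by (simp add: \<sigma>_def abs_divide pos_divide_le_eq)
  have v2: "v$2 = \<sigma> * v$1" using v by (simp add: \<sigma>_def)
  define w where "w = wt K"
  have w: "1/2 \<le> w" "w \<le> 1" "0 \<le> w" using ar by (auto simp: w_def field_simps)
  define gt where "gt = (\<lambda>t. g + (t * \<beta>) *\<^sub>R v)"
  define xt where "xt = (\<lambda>t. fold_map v h t x)"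
  have g0: "\<bar>g$1 - 1/3\<bar> \<le> 1/1000" "\<bar>g$2 - 1/3\<bar> \<le> 1/1000" using g[of 0] by auto
  have x0: "-1/1000 \<le> x$1" "x$1 \<le> 1 + 1/1000" "\<bar>x$2\<bar> \<le> 1/1000" using x[of 0] by auto
  define Z where "Z = (\<lambda>s r. vector [s, \<sigma> * s + r] :: real^2)"
  have Z: "Z s r $ 1 = s" "Z s r $ 2 = \<sigma> * s + r" for s r by (simp_all add: Z_def)
  define \<Omega> where "\<Omega> = {z::real^2. 1/12 \<le> z$1 \<and> z$1 \<le> 3/4 \<and> 1/6 \<le> z$2 - \<sigma> * z$1 \<and> z$2 - \<sigma> * z$1 \<le> 1/6 + 1/1000}"
  have [measurable]: "\<Omega> \<in> sets borel" unfolding \<Omega>_def by measurable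
  have \<sigma>s: "\<bar>\<sigma> * s\<bar> \<le> 1/1000" if "1/12 \<le> s" "s \<le> 3/4" for s
    using abs_prod_le[OF \<sigma>, of s 1] that by simp
  have \<Omega>: "z \<in> K \<and> h z \<le> 0" if "z \<in> \<Omega>" for z
    using that \<sigma>s[of "z$1"] by (intro \<Omega>K) (auto simp: \<Omega>_def abs_le_iff)
  have fz: "fold_map v h t z = z" if "z \<in> \<Omega>" for z t
    using \<Omega>[OF that] by (simp add: fold_map_def max_def)
  define c where "c = (\<lambda>t z. cr (gt t) (xt t) z)"
  define gp where "gp = (\<lambda>z. b / (a + b) * (\<bar>c (- a) z\<bar> * w) powr p + a / (a + b) * (\<bar>c b z\<bar> * w) powr p - (\<bar>c 0 z\<bar> * w) powr p)"
  define G where "G = (\<lambda>z. ennreal (gp z) * indicator \<Omega> z)"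
  have [measurable]: "c t \<in> borel_measurable borel" for t unfolding c_def by measurable
  have gpm [measurable]: "gp \<in> borel_measurable borel" unfolding gp_def by measurable
  have [measurable]: "G \<in> borel_measurable borel" unfolding G_def by measurable
  \<comment> \<open>The rate of change of the determinant on the line with parameter r. On the strip
    both summands are nonpositive, so the drift of g cannot cancel the motion of x.\<close>
  define d where "d = (\<lambda>r. v$1 * (\<beta> * (x$2 - r - \<sigma> * x$1) + h x * (r - g$2 + \<sigma> * g$1)))"
  define u1 where "u1 = (g$2 - x$2) + \<sigma> * (x$1 - g$1)"
  define u0 where "u0 = (\<lambda>r. cr g x (Z 0 r))"
  have cZ: "c t (Z s r) = u0 r + u1 * s + t * d r" for t s r
  proof -
    have "c t (Z s r) = cr (g + (t * \<beta>) *\<^sub>R v) (x + (t * h x) *\<^sub>R v) (Z s r + 0 *\<^sub>R v)"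
      using hx by (simp add: c_def gt_def xt_def fold_map_def max_def)
    also have "\<dots> = u0 r + u1 * s + t * d r"
      unfolding cr_displaced by (simp add: u0_def u1_def d_def cr_def Z v2 algebra_simps)
    finally show ?thesis .
  qed
  have \<sigma>x: "\<bar>\<sigma> * x$1\<bar> \<le> 1/1000 * 2" using x0 by (intro abs_prod_le \<sigma>) linarith
  have \<sigma>g: "\<bar>\<sigma> * g$1\<bar> \<le> 1/1000 * 1" using g0 by (intro abs_prod_le \<sigma>) linarith
  have "u1 = (g$2 - x$2) + (\<sigma> * x$1 - \<sigma> * g$1)" by (simp add: u1_def algebra_simps)
  then have u1: "1/4 \<le> u1" "u1 \<le> 1/2"
    using \<sigma>x \<sigma>g g0(2) x0(3) by linarith+
  have d: "(v$1)\<^sup>2 / 576 \<le> (d r)\<^sup>2" if r: "1/6 \<le> r" "r \<le> 1/6 + 1/1000" for r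
  proof -
    have "x$2 - r - \<sigma> * x$1 \<le> 0" using x0 \<sigma>x r by (auto simp: abs_le_iff)
    then have 1: "\<beta> * (x$2 - r - \<sigma> * x$1) \<le> 0" using \<beta> by (simp add: mult_nonneg_nonpos)
    have "r - g$2 + \<sigma> * g$1 \<le> - (1/12)" using g0(2) \<sigma>g r by linarith
    then have "h x * (r - g$2 + \<sigma> * g$1) \<le> h x * (- (1/12))" using hx by (intro mult_left_mono) auto
    then have "\<beta> * (x$2 - r - \<sigma> * x$1) + h x * (r - g$2 + \<sigma> * g$1) \<le> - (1/24)" using 1 hx by simp
    then have "d r \<le> v$1 * (- (1/24))" unfolding d_def using v by (intro mult_left_mono) auto
    then have "v$1 / 24 \<le> - d r" by simp
    then have "(v$1 / 24)\<^sup>2 \<le> (- d r)\<^sup>2" using v by (intro power_mono) auto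
    then show ?thesis by (simp add: power_divide)
  qed
  \<comment> \<open>1/144 is the margin 1/72 times the weight w >= 1/2, and 576 = 24^2 stems from
    the bound v1 / 24 for |d|. The width 1/1000 of the strip finally turns 576 into 576000.\<close>
  define k1 where "k1 = (1/144) powr (p - 1) * (a * b * (v$1)\<^sup>2) / (576 * (p + 1))"
  have k1: "ennreal k1 \<le> (\<integral>\<^sup>+s. G (Z s r) \<partial>lborel)" if r: "1/6 \<le> r" "r \<le> 1/6 + 1/1000" for r
  proof -
    have zr: "\<bar>Z s r $ 2 - 1/6\<bar> \<le> 2/1000" if "1/12 \<le> s" "s \<le> 3/4" for s
      unfolding Z using \<sigma>s[OF that] r by linarith
    have probe: "c t (Z (1/12) r) < - (1/72)" "1/72 < c t (Z (3/4) r)" if "t \<in> {- a, 0, b}" for t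
    proof -
      have gg: "\<bar>gt t $ 1 - 1/3\<bar> \<le> 1/1000" "\<bar>gt t $ 2 - 1/3\<bar> \<le> 1/1000"
        using g[OF that] unfolding gt_def by blast+
      have xx: "-1/1000 \<le> xt t $ 1" "xt t $ 1 \<le> 1 + 1/1000" "\<bar>xt t $ 2\<bar> \<le> 1/1000"
        using x[OF that] unfolding xt_def by blast+
      show "c t (Z (1/12) r) < - (1/72)" "1/72 < c t (Z (3/4) r)"
        unfolding c_def by (rule cr_probe[OF gg xx zr]; simp add: Z)+
    qed
    have "w * c t (Z (1/12) r) < - (1/144)" "1/144 < w * c t (Z (3/4) r)" if "t \<in> {- a, 0, b}" for t
    proof -
      have "w * (1/72) \<ge> 1/144" using w by simp
      moreover have "w * c t (Z (1/12) r) < w * (- (1/72))" "w * (1/72) < w * c t (Z (3/4) r)"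
        using probe[OF that] w by (intro mult_strict_left_mono; simp)+
      ultimately show "w * c t (Z (1/12) r) < - (1/144)" "1/144 < w * c t (Z (3/4) r)" by linarith+
    qed
    then have lo: "w * u0 r + (w * u1) * (1/12) + t * (w * d r) < - (1/144)"
      and hi: "1/144 < w * u0 r + (w * u1) * (3/4) + t * (w * d r)" if "t \<in> {- a, 0, b}" for t
      using that by (simp_all add: cZ algebra_simps)
    have e: "(0::real) < 1/144" and s: "(1/12::real) \<le> 3/4" and wu: "0 < w * u1" using w u1 by auto
    have "k1 \<le> 2 * ((1/144) powr (p - 1) * (a * b * (w * d r)\<^sup>2)) / ((p + 1) * (w * u1))"
    proof -
      have "(v$1)\<^sup>2 / 576 * 1 \<le> (d r)\<^sup>2 * (2 * w / u1)"
        using d[OF r] w u1 by (intro mult_mono) (auto simp: pos_le_divide_eq)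
      then have "(1/144) powr (p - 1) * (a * b) / (p + 1) * ((v$1)\<^sup>2 / 576 * 1) \<le> (1/144) powr (p - 1) * (a * b) / (p + 1) * ((d r)\<^sup>2 * (2 * w / u1))"
        using ab p by (intro mult_left_mono) auto
      also have "\<dots> = 2 * ((1/144) powr (p - 1) * (a * b * (w * d r)\<^sup>2)) / ((p + 1) * (w * u1))"
      proof -
        have ne: "w \<noteq> 0" "u1 \<noteq> 0" "p + 1 \<noteq> 0" using w u1 p by linarith+
        have "2 * ((1/144) powr (p - 1) * (a * b * (w * d r)\<^sup>2)) / ((p + 1) * (w * u1))
          = (w * (2 * ((1/144) powr (p - 1) * (a * b * (w * (d r)\<^sup>2))))) / (w * ((p + 1) * u1))"
          by (simp add: power2_eq_square mult_ac)
        also have "\<dots> = (2 * ((1/144) powr (p - 1) * (a * b * (w * (d r)\<^sup>2)))) / ((p + 1) * u1)"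
          using ne(1) by (rule mult_divide_mult_cancel_left)
        also have "\<dots> = (1/144) powr (p - 1) * (a * b) / (p + 1) * ((d r)\<^sup>2 * (2 * w / u1))"
          by (simp add: mult_ac)
        finally show ?thesis by (rule sym)
      qed
      finally show ?thesis using p by (simp add: k1_def field_simps)
    qed
    then have "ennreal k1 \<le> ennreal (2 * ((1/144) powr (p - 1) * (a * b * (w * d r)\<^sup>2)) / ((p + 1) * (w * u1)))"
      by (rule ennreal_leI)
    also have "\<dots> \<le> (\<integral>\<^sup>+s. ennreal (b / (a + b) * \<bar>w * u0 r + w * u1 * s - a * (w * d r)\<bar> powr p + a / (a + b) * \<bar>w * u0 r + w * u1 * s + b * (w * d r)\<bar> powr p
        - \<bar>w * u0 r + w * u1 * s\<bar> powr p) * indicator {1/12..3/4} s \<partial>lborel)"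
      by (rule integrated_convexity_gap[OF p e ab wu s lo hi])
    also have "\<dots> = (\<integral>\<^sup>+s. G (Z s r) \<partial>lborel)"
    proof (rule nn_integral_cong)
      fix s :: real
      have ind: "indicator \<Omega> (Z s r) = (indicator {1/12..3/4} s :: ennreal)"
        using r by (auto simp: \<Omega>_def Z indicator_def)
      have "w * u0 r + w * u1 * s - a * (w * d r) = c (- a) (Z s r) * w" "w * u0 r + w * u1 * s + b * (w * d r) = c b (Z s r) * w"
        "w * u0 r + w * u1 * s = c 0 (Z s r) * w" by (simp_all add: cZ algebra_simps)
      then show "ennreal (b / (a + b) * \<bar>w * u0 r + w * u1 * s - a * (w * d r)\<bar> powr p + a / (a + b) * \<bar>w * u0 r + w * u1 * s + b * (w * d r)\<bar> powr p
        - \<bar>w * u0 r + w * u1 * s\<bar> powr p) * indicator {1/12..3/4} s = G (Z s r)"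
        unfolding G_def gp_def ind using w by (simp only: abs_mult abs_of_nonneg)
    qed
    finally show ?thesis .
  qed
  have "ennreal (k1 * (1/1000)) = ennreal k1 * emeasure lborel {1/6..1/6 + 1/1000::real}"
    using ab p by (simp add: k1_def ennreal_mult[symmetric])
  also have "\<dots> = (\<integral>\<^sup>+r. ennreal k1 * indicator {1/6..1/6 + 1/1000::real} r \<partial>lborel)"
    by (rule nn_integral_cmult_indicator[symmetric]) simp
  also have "\<dots> \<le> (\<integral>\<^sup>+r. \<integral>\<^sup>+s. G (Z s r) \<partial>lborel \<partial>lborel)"
    using k1 by (intro nn_integral_mono) (auto split: split_indicator)
  also have "\<dots> = (\<integral>\<^sup>+z. G z \<partial>lborel)"
    unfolding Z_def by (rule nn_integral_sheared_plane[symmetric]) simp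
  also have "\<dots> = (\<integral>\<^sup>+z. G z * indicator K z \<partial>lborel)"
    using \<Omega> by (intro nn_integral_cong) (auto simp: G_def split: split_indicator)
  also have "\<dots> \<le> (\<integral>\<^sup>+z. G z * indicator K z \<partial>lborel) / emeasure lborel K"
  proof -
    have "1 \<le> inverse (ennreal (area K))"
      using ar by (subst inverse_ennreal) (auto simp: ennreal_1[symmetric] one_le_inverse_iff simp del: ennreal_1 intro!: ennreal_leI)
    from mult_left_mono[OF this, of "\<integral>\<^sup>+z. G z * indicator K z \<partial>lborel"]
    show ?thesis by (simp add: divide_ennreal_def body_emeasure(1)[OF K])
  qed
  also have "\<dots> = (\<integral>\<^sup>+z. G z \<partial>unif K)"
    using body_borel[OF K] by (intro nn_integral_uniform_measure[symmetric]) simp_all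
  finally have Gk: "ennreal (k1 * (1/1000)) \<le> (\<integral>\<^sup>+z. G z \<partial>unif K)" .
  have point: "kern p w (gt 0) (xt 0) (fold_map v h 0 z) + G z
    \<le> ennreal (b / (a + b)) * kern p w (gt (- a)) (xt (- a)) (fold_map v h (- a) z)
     + ennreal (a / (a + b)) * kern p w (gt b) (xt b) (fold_map v h b z)" for z
  proof (cases "z \<in> \<Omega>")
    case False
    then show ?thesis using kern_fold_convex[OF p ab w(3), of g x z \<beta>] by (simp add: G_def gt_def xt_def)
  next
    case True
    then have "z = Z (z$1) (z$2 - \<sigma> * z$1)" by (simp add: vec_eq_iff forall_2 Z)
    then obtain s r where "z = Z s r" by blast
    then have "0 \<le> gp z" unfolding gp_def
      using powr_split_two[OF p ab _ _ w(3), of "c (- a) z" "c 0 z" "d r" "c b z"] by (simp add: cZ)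
    then have "kern p w (gt 0) (xt 0) z + G z = ennreal ((\<bar>c 0 z\<bar> * w) powr p + gp z)"
      using True by (simp add: G_def kern_def c_def ennreal_plus[symmetric] del: ennreal_plus)
    also have "\<dots> = ennreal (b / (a + b)) * kern p w (gt (- a)) (xt (- a)) z + ennreal (a / (a + b)) * kern p w (gt b) (xt b) z"
      using ab by (simp add: gp_def kern_def c_def ennreal_mult[symmetric] ennreal_plus[symmetric] del: ennreal_plus)
    finally show ?thesis by (simp add: fz[OF True])
  qed
  have [measurable]: "fold_map v h t \<in> borel_measurable (unif K)" "G \<in> borel_measurable (unif K)" for t
    using fold_measurable by simp_all
  have "fibre K p g \<beta> 0 x + ennreal (k1 * (1/1000)) \<le> fibre K p g \<beta> 0 x + (\<integral>\<^sup>+z. G z \<partial>unif K)"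
    using Gk by (rule add_left_mono)
  also have "\<dots> = (\<integral>\<^sup>+z. kern p w (gt 0) (xt 0) (fold_map v h 0 z) + G z \<partial>unif K)"
    unfolding fibre_def gt_def xt_def w_def by (subst nn_integral_add) simp_all
  also have "\<dots> \<le> (\<integral>\<^sup>+z. ennreal (b / (a + b)) * kern p w (gt (- a)) (xt (- a)) (fold_map v h (- a) z)
     + ennreal (a / (a + b)) * kern p w (gt b) (xt b) (fold_map v h b z) \<partial>unif K)"
    by (intro nn_integral_mono point)
  also have "\<dots> = ennreal (b / (a + b)) * fibre K p g \<beta> (- a) x + ennreal (a / (a + b)) * fibre K p g \<beta> b x"
    unfolding fibre_def gt_def xt_def w_def by (subst nn_integral_add) (simp_all add: nn_integral_cmult)
  finally show ?thesis using p by (simp add: k1_def field_simps)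
qed

text \<open>The square \<open>B\<close> about the centroid of \<open>T0\<close> lies where
  \<open>h\<close> is not positive. A random first point in it stays at rest and plays the part of
  the centroid. 1/250000 is the area of \<open>B\<close>, and a lower bound for its probability
  because \<open>area K\<close> is below 1.\<close>

lemma Phi_gap_normalized:
  assumes K: "planar_convex_body K" and p: "p \<ge> 1" and ab: "a > 0" "b > 0"
    and Ka: "planar_convex_body (fold_map v h (- a) ` K)" and Kb: "planar_convex_body (fold_map v h b ` K)"
    and T: "\<And>t. t \<in> {- a, 0, b} \<Longrightarrow> T0 \<subseteq> fold_map v h t ` K"
    and ar: "area K \<le> 1/2 + 1/4000"
    and bd: "\<And>t z. t \<in> {- a, 0, b} \<Longrightarrow> z \<in> fold_map v h t ` K \<Longrightarrow> \<bar>z$1 - 1/3\<bar> \<le> 2 \<and> \<bar>z$2 - 1/3\<bar> \<le> 2"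
    and v: "v$1 > 0" "\<bar>v$2\<bar> \<le> v$1 / 1000"
    and hz: "\<And>z. z \<in> K \<Longrightarrow> 1/8 \<le> z$2 \<Longrightarrow> h z \<le> 0"
    and X: "\<And>t x. t \<in> {- a, 0, b} \<Longrightarrow> x \<in> K \<Longrightarrow> 1/2 \<le> h x \<Longrightarrow>
      -1/1000 \<le> fold_map v h t x $ 1 \<and> fold_map v h t x $ 1 \<le> 1 + 1/1000 \<and> \<bar>fold_map v h t x $ 2\<bar> \<le> 1/1000"
    and \<xi>: "0 \<le> \<xi>" "\<xi> \<le> measure (unif K) {x \<in> K. 1/2 \<le> h x}"
  shows "Phi m p K + (1/144) powr (p - 1) * (a * b * (v$1)\<^sup>2) / (576000 * (p + 1)) * \<xi> * (1/250000)
    \<le> b / (a + b) * Phi m p (fold_map v h (- a) ` K) + a / (a + b) * Phi m p (fold_map v h b ` K)"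
proof -
  let ?k = "(1/144) powr (p - 1) * (a * b * (v$1)\<^sup>2) / (576000 * (p + 1))"
  let ?X = "{x \<in> K. 1/2 \<le> h x}"
  define B where "B = cbox (vector [1/3 - 1/1000, 1/3 - 1/1000]) (vector [1/3 + 1/1000, 1/3 + 1/1000] :: real^2)"
  have B: "g \<in> B \<longleftrightarrow> \<bar>g$1 - 1/3\<bar> \<le> 1/1000 \<and> \<bar>g$2 - 1/3\<bar> \<le> 1/1000" for g
    unfolding B_def mem_box_cart forall_2 vector_2 by (simp only: abs_le_iff) argo
  have TK: "T0 \<subseteq> K" using T[of 0] by simp
  have a1: "1/2 \<le> area K" using area_mono[OF K TK body_borel[OF body_T0]] by (simp add: area_T0)
  have BK: "B \<subseteq> K"
  proof
    fix g assume "g \<in> B"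
    then have "g \<in> T0" unfolding B mem_T0 abs_le_iff by argo
    then show "g \<in> K" using TK by blast
  qed
  have Xb: "?X \<in> sets borel"
  proof -
    have [measurable]: "h \<in> borel_measurable borel"
      by (intro borel_measurable_continuous_onI continuous_on_h)
    have [measurable]: "K \<in> sets borel" by (rule body_borel[OF K])
    show ?thesis by measurable
  qed
  have k0: "0 \<le> ?k" using ab p by simp
  have \<Omega>K: "z \<in> K \<and> h z \<le> 0" if "1/12 \<le> z$1" "z$1 \<le> 3/4" "1/8 \<le> z$2" "z$2 \<le> 1/5" for z
  proof -
    have "z \<in> T0" using that by (simp add: mem_T0)
    then show ?thesis using TK hz that by blast
  qed
  have gap: "Phi m p K + ?k * measure (unif K) ?X * (if m then measure (unif K) B else 1)
    \<le> b / (a + b) * Phi m p (fold_map v h (- a) ` K) + a / (a + b) * Phi m p (fold_map v h b ` K)"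
  proof (rule Phi_fold_gap[OF K p ab Ka Kb Xb _ k0])
    show "B \<in> sets borel" by (simp add: B_def)
  next
    fix g x assume gB: "g \<in> B" and x: "x \<in> ?X"
    have "g$2 \<ge> 1/8" using gB unfolding B abs_le_iff by argo
    then have "max 0 (h g) = 0" using hz BK gB by (simp add: max_def subset_iff order_antisym)
    then show "fibre K p g (max 0 (h g)) 0 x + ennreal ?k
      \<le> ennreal (b / (a + b)) * fibre K p g (max 0 (h g)) (- a) x + ennreal (a / (a + b)) * fibre K p g (max 0 (h g)) b x"
      using x gB a1 ar by (intro fibre_gap[OF K p ab _ _ v \<Omega>K] X) (auto simp: B)
  next
    fix x assume x: "x \<in> ?X"
    have "\<bar>(centroid K + (t * drift K) *\<^sub>R v)$1 - 1/3\<bar> \<le> 1/1000 \<and> \<bar>(centroid K + (t * drift K) *\<^sub>R v)$2 - 1/3\<bar> \<le> 1/1000"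
      if t: "t \<in> {- a, 0, b}" for t
    proof -
      have fK: "planar_convex_body (fold_map v h t ` K)" using t K Ka Kb by auto
      show ?thesis
        unfolding centroid_fold[OF K fK, symmetric]
        using centroid_near[OF fK T[OF t] bd[OF t]] ar by (simp add: area_fold[OF K fK])
    qed
    then show "fibre K p (centroid K) (drift K) 0 x + ennreal ?k
      \<le> ennreal (b / (a + b)) * fibre K p (centroid K) (drift K) (- a) x + ennreal (a / (a + b)) * fibre K p (centroid K) (drift K) b x"
      using x a1 ar drift_nonneg by (intro fibre_gap[OF K p ab _ _ v \<Omega>K] X) auto
  qed
  have Bm: "1/250000 \<le> measure (unif K) B"
  proof -
    have "measure lborel B = 1/250000"
      unfolding B_def by (subst content_cbox_cart) (auto simp: interval_ne_empty_cart forall_2 UNIV_2)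
    moreover have "measure (unif K) B = measure lborel B / area K"
      using body_emeasure[OF K] body_borel[OF K] BK
      by (subst measure_uniform_measure) (auto simp: area_def B_def Int_absorb1)
    ultimately have eq: "measure (unif K) B = (1/250000) / area K" by (simp only:)
    show ?thesis unfolding eq using a1 ar by (simp add: pos_le_divide_eq)
  qed
  have "\<xi> * (1/250000) \<le> measure (unif K) ?X * (if m then measure (unif K) B else 1)"
    using \<xi> Bm by (intro mult_mono) auto
  then have "?k * (\<xi> * (1/250000)) \<le> ?k * (measure (unif K) ?X * (if m then measure (unif K) B else 1))"
    using k0 by (rule mult_left_mono)
  then show ?thesis using gap by (simp only: mult.assoc)
qed

end

section \<open>Counterclockwise polygons and sliding a vertex\<close>

text \<open>A convex polygon is the list of its vertices in counterclockwise order.\<close>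
fun ccw :: "(real^2) list \<Rightarrow> bool" where
  "ccw [] = True"
| "ccw (a # xs) = (sorted_wrt (\<lambda>X Y. 0 < cr a X Y) xs \<and> ccw xs)"

abbreviation poly :: "(real^2) list \<Rightarrow> (real^2) set" where
  "poly xs \<equiv> convex hull (set xs)"

lemma cr_rotate: "cr Y Z X = cr X Y Z"
  by (simp add: cr_def algebra_simps)

lemma cr_swap: "cr Y X Z = - cr X Y Z"
  by (simp add: cr_def algebra_simps)

lemma cr_same [simp]: "cr X X Y = 0" "cr X Y Y = 0" "cr X Y X = 0"
  by (simp_all add: cr_def)

lemma ccw_append:
  "ccw (xs @ ys) \<longleftrightarrow> ccw xs \<and> ccw ys \<and> (\<forall>x\<in>set xs. sorted_wrt (\<lambda>X Y. 0 < cr x X Y) ys)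
    \<and> (\<forall>y\<in>set ys. sorted_wrt (\<lambda>X Y. 0 < cr X Y y) xs)"
  by (induction xs) (auto simp: sorted_wrt_append)

lemma ccw_rotate: "ccw (xs @ ys) \<Longrightarrow> ccw (ys @ xs)"
  by (simp add: ccw_append cr_rotate[of _ _ _] sorted_wrt_iff_nth_less)

lemma ccw_body:
  assumes "ccw xs" "length xs \<ge> 3"
  shows "planar_convex_body (poly xs)"
proof -
  obtain X Y Z zs where xs: "xs = X # Y # Z # zs"
    using assms(2) by (metis Suc_le_length_iff numeral_3_eq_3)
  have "cr X Y Z \<noteq> 0" using assms(1) by (simp add: xs)
  then have "interior (convex hull {X, Y, Z}) \<noteq> {}"
    using body_triangle by (simp add: planar_convex_body_def)
  moreover have "convex hull {X, Y, Z} \<subseteq> poly xs" by (intro hull_mono) (auto simp: xs)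
  ultimately have "interior (poly xs) \<noteq> {}" using interior_mono by blast
  then show ?thesis by (simp add: planar_convex_body_def finite_imp_compact_convex_hull)
qed

lemma convex_cr_halfplanes:
  "convex {y. 0 \<le> cr A C y}" "convex {y. 0 \<le> cr A y B}" "convex {y. cr A C y \<le> m}"
proof -
  have 1: "cr A C y = vector [A$2 - C$2, C$1 - A$1] \<bullet> y + (A$1 * C$2 - A$2 * C$1)" for A C y
    by (simp add: cr_def inner_vec_def sum_2 algebra_simps)
  have "{y. 0 \<le> cr A C y} = {y. vector [A$2 - C$2, C$1 - A$1] \<bullet> y \<ge> - (A$1 * C$2 - A$2 * C$1)}" for A C
    by (auto simp: 1)
  then have c: "convex {y. 0 \<le> cr A C y}" for A C using convex_halfspace_ge by simp
  then show "convex {y. 0 \<le> cr A C y}" .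
  have "{y. cr A C y \<le> m} = {y. vector [A$2 - C$2, C$1 - A$1] \<bullet> y \<le> m - (A$1 * C$2 - A$2 * C$1)}"
    by (auto simp: 1)
  then show "convex {y. cr A C y \<le> m}" using convex_halfspace_le by simp
  show "convex {y. 0 \<le> cr A y B}" using c[of B A] by (simp add: cr_rotate[of A _ B])
qed

lemma hull_ind:
  assumes "y \<in> convex hull R" "convex {y. P y}" "\<And>r. r \<in> R \<Longrightarrow> P r"
  shows "P y"
  using assms hull_minimal[of R "{y. P y}" convex] by blast

text \<open>With \<alpha> = \<open>cr A C B\<close> this is the affine function that vanishes on the
  line through B and C and equals 1 at A; the fold in direction C - B then moves A by exactly t
  times C - B.\<close>

definition ear_height :: "real^2 \<Rightarrow> real^2 \<Rightarrow> real \<Rightarrow> real^2 \<Rightarrow> real" where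
  "ear_height B C \<alpha> x = cr B x C / \<alpha>"

lemma fold_ear: "fold (C - B) (ear_height B C \<alpha>) ((C$2 - B$2) / \<alpha>) ((B$1 - C$1) / \<alpha>) ((C$1 * B$2 - C$2 * B$1) / \<alpha>)"
proof
  show "ear_height B C \<alpha> x = (C$2 - B$2) / \<alpha> * x$1 + (B$1 - C$1) / \<alpha> * x$2 + (C$1 * B$2 - C$2 * B$1) / \<alpha>" for x
    unfolding ear_height_def cr_rotate[of x B C, symmetric] cr_rotate[of C B x, symmetric] cr_affine
    by (simp add: cr_def add_divide_distrib diff_divide_distrib algebra_simps)
  show "(C$2 - B$2) / \<alpha> * (C - B)$1 + (B$1 - C$1) / \<alpha> * (C - B)$2 = 0"
    by (simp add: algebra_simps diff_divide_distrib)
qed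

text \<open>The point \<open>e\<close> below is where the segment from \<open>A\<close> to
  \<open>y\<close> crosses the diagonal; \<open>vis\<close> puts it between \<open>B\<close> and
  \<open>C\<close>. The fold fixes \<open>e\<close>, so it carries the piece from \<open>e\<close>
  to \<open>A\<close> to the segment from \<open>e\<close> to the moved vertex, and leaves the piece
  from \<open>y\<close> to \<open>e\<close> inside the hull of \<open>R\<close>.\<close>

lemma fold_ear_subset:
  assumes R: "B \<in> R" "C \<in> R" and \<alpha>: "\<alpha> = cr A C B" "\<alpha> > 0"
    and vis: "\<And>r. r \<in> R \<Longrightarrow> 0 \<le> cr A C r \<and> 0 \<le> cr A r B \<and> 0 \<le> cr C r B"
  shows "fold_map (C - B) (ear_height B C \<alpha>) t ` (convex hull (insert A R)) \<subseteq> convex hull (insert (A + t *\<^sub>R (C - B)) R)"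
proof (rule image_subsetI)
  fix z assume "z \<in> convex hull (insert A R)"
  then obtain u w y where uw: "0 \<le> u" "0 \<le> w" "u + w = 1" and y0: "y \<in> convex hull R" "z = u *\<^sub>R A + w *\<^sub>R y"
    using convex_hull_insert[of R A] R(1) by auto
  then have w: "w = 1 - u" by simp
  have uy: "0 \<le> u" "u \<le> 1" "y \<in> convex hull R" "z = u *\<^sub>R A + (1 - u) *\<^sub>R y"
    using uw y0 w by auto
  have y: "0 \<le> cr A C y" "0 \<le> cr A y B" "0 \<le> cr C y B"
    using vis by (auto intro: hull_ind[OF uy(3)] convex_cr_halfplanes)
  \<comment> \<open>The depth of y behind the diagonal in units of the height of the ear, that is,
    minus \<open>ear_height\<close> at y.\<close>
  define \<eta> where "\<eta> = cr C y B / \<alpha>"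
  have \<eta>: "\<eta> \<ge> 0" using y \<alpha> by (simp add: \<eta>_def)
  define e where "e = (1 / (\<alpha> * (1 + \<eta>))) *\<^sub>R (cr A y B *\<^sub>R C + cr A C y *\<^sub>R B)"
  have sum: "cr A y B + cr A C y = \<alpha> * (1 + \<eta>)"
    using \<alpha> by (simp add: \<eta>_def distrib_left) (simp add: cr_def algebra_simps)
  have pos: "\<alpha> * (1 + \<eta>) > 0" using \<alpha> \<eta> by simp
  have eh: "e \<in> convex hull R"
  proof -
    have "e = (cr A y B / (\<alpha> * (1 + \<eta>))) *\<^sub>R C + (cr A C y / (\<alpha> * (1 + \<eta>))) *\<^sub>R B"
      by (simp add: e_def scaleR_add_right)
    moreover have "cr A y B / (\<alpha> * (1 + \<eta>)) + cr A C y / (\<alpha> * (1 + \<eta>)) = 1"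
      unfolding add_divide_distrib[symmetric] sum using pos by (intro divide_self) linarith
    moreover have "C \<in> convex hull R" "B \<in> convex hull R" using R by (auto intro: hull_inc)
    moreover have "0 \<le> cr A y B / (\<alpha> * (1 + \<eta>))" "0 \<le> cr A C y / (\<alpha> * (1 + \<eta>))"
      using y pos by (simp_all del: mult_pos_pos)
    ultimately show ?thesis using convexD[OF convex_convex_hull] by metis
  qed
  have "\<alpha> *\<^sub>R y + cr C y B *\<^sub>R A = cr A y B *\<^sub>R C + cr A C y *\<^sub>R B"
    unfolding \<alpha>(1) by (simp add: vec_eq_iff forall_2 cr_def algebra_simps)
  moreover have "cr C y B = \<alpha> * \<eta>" using \<alpha> by (simp add: \<eta>_def)
  ultimately have "\<alpha> *\<^sub>R (y + \<eta> *\<^sub>R A) = cr A y B *\<^sub>R C + cr A C y *\<^sub>R B"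
    by (simp add: scaleR_add_right)
  then have "(\<alpha> * (1 + \<eta>)) *\<^sub>R e = \<alpha> *\<^sub>R (y + \<eta> *\<^sub>R A)"
    using \<alpha>(2) \<eta> by (simp add: e_def)
  then have e: "(1 + \<eta>) *\<^sub>R e = y + \<eta> *\<^sub>R A"
    using \<alpha> by (simp only: scaleR_scaleR[symmetric] scaleR_cancel_left) simp
  have hz: "ear_height B C \<alpha> z = u - (1 - u) * \<eta>"
  proof -
    have "cr B z C = u * cr A C B - (1 - u) * cr C y B" unfolding uy(4) by (simp add: cr_def algebra_simps)
    then show ?thesis using \<alpha> by (simp add: ear_height_def \<eta>_def diff_divide_distrib)
  qed
  let ?A = "A + t *\<^sub>R (C - B)"
  show "fold_map (C - B) (ear_height B C \<alpha>) t z \<in> convex hull (insert ?A R)"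
  proof (cases "ear_height B C \<alpha> z > 0")
    case True
    define \<tau> where "\<tau> = u - (1 - u) * \<eta>"
    have \<tau>: "0 < \<tau>" "\<tau> \<le> 1"
    proof -
      have "0 \<le> (1 - u) * \<eta>" using uy(2) \<eta> by simp
      then show "0 < \<tau>" "\<tau> \<le> 1" using True hz uy(2) by (simp_all add: \<tau>_def)
    qed
    have "1 - \<tau> = (1 - u) * (1 + \<eta>)" by (simp add: \<tau>_def algebra_simps)
    then have "(1 - \<tau>) *\<^sub>R e = (1 - u) *\<^sub>R (y + \<eta> *\<^sub>R A)" by (simp add: e[symmetric])
    then have "z = (1 - \<tau>) *\<^sub>R e + \<tau> *\<^sub>R A" by (simp add: uy(4) \<tau>_def algebra_simps)
    then have "fold_map (C - B) (ear_height B C \<alpha>) t z = (1 - \<tau>) *\<^sub>R e + \<tau> *\<^sub>R ?A"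
      using True hz by (simp add: fold_map_def \<tau>_def scaleR_add_right mult.commute)
    moreover have "e \<in> convex hull (insert ?A R)" using eh hull_mono[of R "insert ?A R"] by blast
    moreover have "?A \<in> convex hull (insert ?A R)" by (simp add: hull_inc)
    ultimately show ?thesis using \<tau> by (simp add: convexD_alt[OF convex_convex_hull])
  next
    case False
    then have le: "u \<le> (1 - u) * \<eta>" using hz by simp
    have "z \<in> convex hull R"
    proof (cases "\<eta> = 0")
      case True
      then show ?thesis using le uy by simp
    next
      case False
      then have \<eta>': "\<eta> > 0" using \<eta> by simp
      define s where "s = u * (1 + \<eta>) / \<eta>"
      have s: "0 \<le> s" "s \<le> 1" using le uy \<eta>' by (auto simp: s_def field_simps)
      have "s *\<^sub>R e = (u / \<eta>) *\<^sub>R (y + \<eta> *\<^sub>R A)" by (simp add: s_def e[symmetric])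
      also have "\<dots> = (u / \<eta>) *\<^sub>R y + u *\<^sub>R A" using \<eta>' by (simp add: scaleR_add_right)
      finally have se: "s *\<^sub>R e = (u / \<eta>) *\<^sub>R y + u *\<^sub>R A" .
      have s_eq: "s = u + u / \<eta>" using \<eta>' by (simp add: s_def field_simps)
      have "z = (1 - s) *\<^sub>R y + s *\<^sub>R e" unfolding se by (simp add: uy(4) s_eq algebra_simps)
      then show ?thesis using s eh uy(3) by (simp add: convexD_alt[OF convex_convex_hull])
    qed
    then have "z \<in> convex hull (insert ?A R)" using hull_mono[of R "insert ?A R"] by blast
    then show ?thesis using False by (simp add: fold_map_def max_def)
  qed
qed

text \<open>The vertex \<open>A\<close> slides parallel to the diagonal joining its neighbours \<open>B\<close>, \<open>C\<close>; at the ends of the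
  admissible interval one of these two neighbours ceases to be a vertex.\<close>
locale ear =
  fixes A B C :: "real^2" and mid
  assumes ccw: "ccw (A # C # mid @ [B])" and mid: "mid \<noteq> []"
begin

definition slide :: "real \<Rightarrow> real^2" where "slide t = A + t *\<^sub>R (C - B)"
text \<open>The backward time at which the moving vertex becomes collinear with \<open>B\<close> and
  \<open>last mid\<close>, so that \<open>B\<close> stops being a vertex; \<open>tb\<close> is the
  forward time for \<open>C\<close> and \<open>hd mid\<close>.\<close>

definition ta :: real where "ta = cr A (last mid) B / cr C (last mid) B"
definition tb :: real where "tb = cr A C (hd mid) / cr C (hd mid) B"
definition \<alpha> :: real where "\<alpha> = cr A C B"

lemma slide_0 [simp]: "slide 0 = A" by (simp add: slide_def)

lemma cr_slide: "cr (slide t) X Y = cr A X Y + t * (cr C X Y - cr B X Y)"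
  by (simp add: slide_def cr_def algebra_simps)

lemma alpha_pos: "0 < \<alpha>" and cr_slide_CB [simp]: "cr (slide t) C B = \<alpha>"
  using ccw by (simp_all add: sorted_wrt_append cr_slide \<alpha>_def)

lemma hd_mid: "hd mid \<in> set mid" and last_mid: "last mid \<in> set mid"
  using mid by simp_all

lemma mid_pos: "x \<in> set mid \<Longrightarrow> 0 < cr A C x \<and> 0 < cr A x B \<and> 0 < cr C x B"
  using ccw by (auto simp: sorted_wrt_append)

lemma hd_pos: "x \<in> set (tl mid) \<Longrightarrow> 0 < cr C (hd mid) x"
  using ccw mid by (cases mid) auto

lemma last_pos: "x \<in> set (butlast mid) \<Longrightarrow> 0 < cr x (last mid) B"
proof -
  obtain ys y where y: "mid = ys @ [y]" using mid by (metis rev_exhaust)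
  show "x \<in> set (butlast mid) \<Longrightarrow> 0 < cr x (last mid) B"
    using ccw by (auto simp: y ccw_append sorted_wrt_append)
qed

lemma mid_sorted: "sorted_wrt (\<lambda>X Y. 0 < cr C X Y \<and> 0 < cr X Y B) mid"
proof -
  have "sorted_wrt (\<lambda>X Y. 0 < cr C X Y) mid" "sorted_wrt (\<lambda>X Y. 0 < cr X Y B) mid"
    using ccw by (auto simp: ccw_append sorted_wrt_append)
  then show ?thesis by (simp add: sorted_wrt_iff_nth_less)
qed

lemma ta_pos: "ta > 0" and tb_pos: "tb > 0"
  using mid_pos[OF hd_mid] mid_pos[OF last_mid] by (simp_all add: ta_def tb_def)

lemma slide_hd: "cr (slide t) C (hd mid) = (tb - t) * cr C (hd mid) B"
  using mid_pos[OF hd_mid] by (simp add: cr_slide tb_def field_simps) (simp add: cr_def algebra_simps)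

lemma slide_last: "cr (slide t) (last mid) B = (ta + t) * cr C (last mid) B"
  using mid_pos[OF last_mid] by (simp add: cr_slide ta_def field_simps)

text \<open>A three-term relation expresses the determinant at x by the one at \<open>hd mid\<close>
  and by determinants of fixed vertices. So the first vertex after \<open>C\<close> is the critical
  one, and strict positivity can fail only there, at time \<open>tb\<close>.\<close>

lemma slide_C:
  assumes "t \<le> tb" "x \<in> set mid"
  shows "0 \<le> cr (slide t) C x" "x \<in> set (tl mid) \<or> t < tb \<Longrightarrow> 0 < cr (slide t) C x"
proof -
  have pos: "cr C (hd mid) B > 0" "cr C x B > 0" using mid_pos[OF hd_mid] mid_pos[OF assms(2)] by auto
  have "cr (slide t) C x * cr C (hd mid) B = cr (slide t) C B * cr C (hd mid) x + cr (slide t) C (hd mid) * cr C x B"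
    by (simp add: cr_def algebra_simps)
  then have eq: "cr (slide t) C x * cr C (hd mid) B = \<alpha> * cr C (hd mid) x + (tb - t) * (cr C (hd mid) B * cr C x B)"
    by (simp add: slide_hd mult.assoc)
  have x: "x = hd mid \<or> x \<in> set (tl mid)" using assms(2) mid by (cases mid) auto
  have 1: "0 \<le> \<alpha> * cr C (hd mid) x" and 2: "0 \<le> (tb - t) * (cr C (hd mid) B * cr C x B)"
    using x hd_pos[of x] alpha_pos assms(1) pos by auto
  have "0 \<le> cr (slide t) C x * cr C (hd mid) B" using eq 1 2 by linarith
  then show "0 \<le> cr (slide t) C x" using pos by (simp add: zero_le_mult_iff)
  assume "x \<in> set (tl mid) \<or> t < tb"
  then have "0 < \<alpha> * cr C (hd mid) x \<or> 0 < (tb - t) * (cr C (hd mid) B * cr C x B)"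
    using hd_pos[of x] alpha_pos pos by auto
  then have "0 < cr (slide t) C x * cr C (hd mid) B" using eq 1 2 by linarith
  then show "0 < cr (slide t) C x" using pos by (simp add: zero_less_mult_iff)
qed

lemma slide_B:
  assumes "- ta \<le> t" "x \<in> set mid"
  shows "0 \<le> cr (slide t) x B" "x \<in> set (butlast mid) \<or> - ta < t \<Longrightarrow> 0 < cr (slide t) x B"
proof -
  have pos: "cr C (last mid) B > 0" "cr C x B > 0" using mid_pos[OF last_mid] mid_pos[OF assms(2)] by auto
  have "cr (slide t) x B * cr C (last mid) B = cr (slide t) C B * cr x (last mid) B + cr (slide t) (last mid) B * cr C x B"
    by (simp add: cr_def algebra_simps)
  then have eq: "cr (slide t) x B * cr C (last mid) B = \<alpha> * cr x (last mid) B + (ta + t) * (cr C (last mid) B * cr C x B)"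
    by (simp add: slide_last mult.assoc)
  have x: "x = last mid \<or> x \<in> set (butlast mid)"
    using assms(2) mid by (metis append_butlast_last_id rotate1.simps(2) set_ConsD set_rotate1)
  have 1: "0 \<le> \<alpha> * cr x (last mid) B" and 2: "0 \<le> (ta + t) * (cr C (last mid) B * cr C x B)"
    using x last_pos[of x] alpha_pos assms(1) pos by auto
  have "0 \<le> cr (slide t) x B * cr C (last mid) B" using eq 1 2 by linarith
  then show "0 \<le> cr (slide t) x B" using pos by (simp add: zero_le_mult_iff)
  assume "x \<in> set (butlast mid) \<or> - ta < t"
  then have "0 < \<alpha> * cr x (last mid) B \<or> 0 < (ta + t) * (cr C (last mid) B * cr C x B)"
    using last_pos[of x] alpha_pos pos by auto
  then have "0 < cr (slide t) x B * cr C (last mid) B" using eq 1 2 by linarith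
  then show "0 < cr (slide t) x B" using pos by (simp add: zero_less_mult_iff)
qed

text \<open>At an end of the interval one of the two coefficients in the three-term relation may
  vanish, but their sum is positive; so these orientations stay strict on the closed
  interval.\<close>

lemma slide_mid:
  assumes "- ta \<le> t" "t \<le> tb"
  shows "sorted_wrt (\<lambda>X Y. 0 < cr (slide t) X Y) mid"
proof (rule sorted_wrt_mono_rel[OF _ mid_sorted])
  fix X Y assume X: "X \<in> set mid" and "Y \<in> set mid" and XY: "0 < cr C X Y \<and> 0 < cr X Y B"
  have eq: "cr (slide t) X Y * cr C X B = cr (slide t) X B * cr C X Y + cr (slide t) C X * cr X Y B"
    by (simp add: cr_def algebra_simps)
  have nn: "0 \<le> cr (slide t) X B" "0 \<le> cr (slide t) C X" using slide_B slide_C assms X by auto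
  have "cr (slide t) X B + cr (slide t) C X = cr C X B + cr (slide t) C B"
    by (simp add: cr_def algebra_simps)
  then have "cr (slide t) X B > 0 \<or> cr (slide t) C X > 0" using mid_pos[OF X] alpha_pos nn by auto
  then have "0 < cr (slide t) X B * cr C X Y + cr (slide t) C X * cr X Y B"
    using nn XY by (auto intro: add_pos_nonneg add_nonneg_pos)
  then show "0 < cr (slide t) X Y" unfolding eq[symmetric] using mid_pos[OF X] by (simp add: zero_less_mult_iff)
qed

lemma rest_ccw: "ccw (C # mid @ [B])" using ccw by simp

lemma ccw_slide:
  assumes "- ta < t" "t < tb"
  shows "ccw (slide t # C # mid @ [B])"
  using rest_ccw slide_mid[of t] slide_B[of t] slide_C[of t] assms alpha_pos by (auto simp: sorted_wrt_append)

lemma ccw_tb: "ccw (slide tb # mid @ [B])"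
  using rest_ccw slide_mid[of tb] slide_B(2)[of tb] ta_pos tb_pos by (auto simp: sorted_wrt_append)

lemma ccw_ta: "ccw (slide (- ta) # C # mid)"
  using rest_ccw slide_mid[of "- ta"] slide_C(2)[of "- ta"] ta_pos tb_pos by (auto simp: ccw_append sorted_wrt_append)

lemma poly_tb: "poly (slide tb # mid @ [B]) = poly (slide tb # C # mid @ [B])"
proof -
  have "C \<in> convex hull {slide tb, hd mid, B}"
  proof (rule triangle_memI)
    show "0 < cr (slide tb) (hd mid) B" using slide_B(2)[of tb "hd mid"] hd_mid ta_pos tb_pos by auto
    show "0 \<le> cr (slide tb) (hd mid) C" using slide_hd[of tb] by (simp add: cr_def algebra_simps)
    show "0 \<le> cr (hd mid) B C" using mid_pos[OF hd_mid] by (simp add: cr_rotate)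
    show "0 \<le> cr B (slide tb) C" using alpha_pos by (simp add: cr_rotate[of "slide tb" C B, symmetric])
  qed
  also have "\<dots> \<subseteq> poly (slide tb # mid @ [B])" using hd_mid by (intro hull_mono) auto
  finally show ?thesis using hull_redundant[of C convex "set (slide tb # mid @ [B])"] by (simp add: insert_commute)
qed

lemma poly_ta: "poly (slide (- ta) # C # mid) = poly (slide (- ta) # C # mid @ [B])"
proof -
  have "B \<in> convex hull {slide (- ta), C, last mid}"
  proof (rule triangle_memI)
    show "0 < cr (slide (- ta)) C (last mid)" using slide_C(2)[of "- ta" "last mid"] last_mid ta_pos tb_pos by auto
    show "0 \<le> cr (slide (- ta)) C B" using alpha_pos by simp
    show "0 \<le> cr C (last mid) B" using mid_pos[OF last_mid] by simp
    show "0 \<le> cr (last mid) (slide (- ta)) B" using slide_last[of "- ta"] by (simp add: cr_swap[of "last mid"])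
  qed
  also have "\<dots> \<subseteq> poly (slide (- ta) # C # mid)" using last_mid by (intro hull_mono) auto
  finally show ?thesis using hull_redundant[of B convex "set (slide (- ta) # C # mid)"] by (simp add: insert_commute)
qed

abbreviation "psi \<equiv> fold_map (C - B) (ear_height B C \<alpha>)"

sublocale fold "C - B" "ear_height B C \<alpha>" "(C$2 - B$2) / \<alpha>" "(B$1 - C$1) / \<alpha>" "(C$1 * B$2 - C$2 * B$1) / \<alpha>"
  by (rule fold_ear)

lemma psi_poly:
  assumes t: "- ta \<le> t" "t \<le> tb"
  shows "psi t ` poly (A # C # mid @ [B]) = poly (slide t # C # mid @ [B])"
proof -
  let ?R = "set (C # mid @ [B])"
  have BC: "B \<in> ?R" "C \<in> ?R" by auto
  have vis: "0 \<le> cr (slide s) C r \<and> 0 \<le> cr (slide s) r B \<and> 0 \<le> cr C r B"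
    if "- ta \<le> s" "s \<le> tb" "r \<in> ?R" for s r
    using that slide_C(1)[of s r] slide_B(1)[of s r] mid_pos[of r] alpha_pos by auto
  have sub: "psi u ` (convex hull (insert (slide s) ?R)) \<subseteq> convex hull (insert (slide s + u *\<^sub>R (C - B)) ?R)"
    if "- ta \<le> s" "s \<le> tb" for s u
    using alpha_pos vis that by (intro fold_ear_subset[OF BC]) auto
  have 1: "psi t ` poly (A # C # mid @ [B]) \<subseteq> poly (slide t # C # mid @ [B])"
    using sub[of 0 t] ta_pos tb_pos by (simp add: slide_def)
  \<comment> \<open>The reverse inclusion is the same statement for the backward motion, started at
    the moved vertex.\<close>
  have "psi (- t) ` poly (slide t # C # mid @ [B]) \<subseteq> poly (A # C # mid @ [B])"
    using sub[OF t, of "- t"] by (simp add: slide_def)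
  then have "psi t ` psi (- t) ` poly (slide t # C # mid @ [B]) \<subseteq> psi t ` poly (A # C # mid @ [B])"
    by (rule image_mono)
  then show ?thesis using 1 by (simp add: image_image fold_inverse)
qed

lemma body_slide:
  assumes t: "- ta \<le> t" "t \<le> tb"
  shows "planar_convex_body (poly (slide t # C # mid @ [B]))"
proof -
  consider "- ta < t" "t < tb" | "t = - ta" | "t = tb" using t by linarith
  then show ?thesis
  proof cases
    case 1
    then show ?thesis by (intro ccw_body ccw_slide) auto
  next
    case 2
    have "planar_convex_body (poly (slide (- ta) # C # mid))"
      using mid by (intro ccw_body ccw_ta) (cases mid; simp)
    then show ?thesis using 2 poly_ta by simp
  next
    case 3
    have "planar_convex_body (poly (slide tb # mid @ [B]))"
      using mid by (intro ccw_body ccw_tb) (cases mid; simp)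
    then show ?thesis using 3 poly_tb by simp
  qed
qed

lemma body: "planar_convex_body (poly (A # C # mid @ [B]))"
  using body_slide[of 0] ta_pos tb_pos by simp

lemma area_slide:
  assumes "- ta \<le> t" "t \<le> tb"
  shows "area (poly (slide t # C # mid @ [B])) = area (poly (A # C # mid @ [B]))"
  using area_fold[OF body, of t] body_slide[OF assms] psi_poly[OF assms] by simp

lemma Phi_slide_convex:
  assumes p: "p \<ge> 1" and s: "0 < s" "s \<le> ta" and t: "0 < t" "t \<le> tb"
  shows "Phi m p (poly (A # C # mid @ [B])) \<le> t / (s + t) * Phi m p (poly (slide (- s) # C # mid @ [B]))
    + s / (s + t) * Phi m p (poly (slide t # C # mid @ [B]))"
proof -
  have "Phi m p (poly (A # C # mid @ [B])) + 0 * measure (unif (poly (A # C # mid @ [B]))) {} *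
      (if m then measure (unif (poly (A # C # mid @ [B]))) {} else 1)
    \<le> t / (s + t) * Phi m p (psi (- s) ` poly (A # C # mid @ [B])) + s / (s + t) * Phi m p (psi t ` poly (A # C # mid @ [B]))"
    using s t body_slide[of "- s"] body_slide[of t] psi_poly[of "- s"] psi_poly[of t]
    by (intro Phi_fold_gap[OF body p]) auto
  then show ?thesis using psi_poly[of "- s"] psi_poly[of t] s t by simp
qed

lemma Phi_slide_max:
  assumes p: "p \<ge> 1" and s: "0 < s" "s \<le> ta" and t: "0 < t" "t \<le> tb"
  shows "Phi m p (poly (A # C # mid @ [B])) \<le> Phi m p (poly (slide (- s) # C # mid @ [B]))
    \<or> Phi m p (poly (A # C # mid @ [B])) \<le> Phi m p (poly (slide t # C # mid @ [B]))"
proof (rule ccontr)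
  let ?K = "Phi m p (poly (A # C # mid @ [B]))"
  assume "\<not> ?thesis"
  then have lt: "Phi m p (poly (slide (- s) # C # mid @ [B])) < ?K" "Phi m p (poly (slide t # C # mid @ [B])) < ?K"
    by (simp_all only: de_Morgan_disj not_le)
  have "0 < t / (s + t)" "0 < s / (s + t)" using s t by simp_all
  from mult_strict_left_mono[OF lt(1) this(1)] mult_strict_left_mono[OF lt(2) this(2)]
  have "t / (s + t) * Phi m p (poly (slide (- s) # C # mid @ [B])) < t / (s + t) * ?K"
    "s / (s + t) * Phi m p (poly (slide t # C # mid @ [B])) < s / (s + t) * ?K" .
  moreover have "t / (s + t) * ?K + s / (s + t) * ?K = ?K"
  proof -
    have "t / (s + t) + s / (s + t) = 1" using s t by (simp add: add_divide_distrib[symmetric])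
    then show ?thesis by (simp only: distrib_right[symmetric] mult_1)
  qed
  ultimately show False using Phi_slide_convex[OF p s t, of m] by linarith
qed

end

section \<open>Inscribed triangles of maximal area\<close>

text \<open>A bound for twice the area of every triangle with vertices in \<open>R\<close>: odd
  permutations change the sign of \<open>cr\<close>, so absolute values are bounded as well.\<close>

definition bnd :: "real \<Rightarrow> (real^2) set \<Rightarrow> bool" where
  "bnd \<mu> R \<longleftrightarrow> (\<forall>X\<in>R. \<forall>Y\<in>R. \<forall>Z\<in>R. cr X Y Z \<le> \<mu>)"

lemma bndD: "bnd \<mu> R \<Longrightarrow> X \<in> R \<Longrightarrow> Y \<in> R \<Longrightarrow> Z \<in> R \<Longrightarrow> cr X Y Z \<le> \<mu>"
  by (simp add: bnd_def)

lemma bnd_abs: "bnd \<mu> R \<Longrightarrow> X \<in> R \<Longrightarrow> Y \<in> R \<Longrightarrow> Z \<in> R \<Longrightarrow> \<bar>cr X Y Z\<bar> \<le> \<mu>"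
  using bndD[of \<mu> R X Y Z] bndD[of \<mu> R Y X Z] by (simp add: cr_swap[of Y X Z])

lemma bnd_subset: "bnd \<mu> R \<Longrightarrow> R' \<subseteq> R \<Longrightarrow> bnd \<mu> R'"
  by (auto simp: bnd_def)

lemma bnd_insert:
  assumes R: "bnd \<mu> R" "\<mu> \<ge> 0" and A: "\<And>Y Z. Y \<in> R \<Longrightarrow> Z \<in> R \<Longrightarrow> cr A Y Z \<le> \<mu>"
  shows "bnd \<mu> (insert A R)"
  unfolding bnd_def
proof (intro ballI)
  fix X Y Z assume *: "X \<in> insert A R" "Y \<in> insert A R" "Z \<in> insert A R"
  show "cr X Y Z \<le> \<mu>"
  proof (cases "X = A \<or> Y = A \<or> Z = A")
    case False
    then show ?thesis using * R(1) by (auto intro: bndD)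
  next
    case True
    then consider "X = A" | "X \<noteq> A" "Y = A" | "X \<noteq> A" "Y \<noteq> A" "Z = A" by blast
    then show ?thesis
    proof cases
      case 1
      then show ?thesis using * R(2) A[of Y Z] by (cases "Y = A"; cases "Z = A") auto
    next
      case 2
      then show ?thesis using * R(2) A[of Z X] cr_rotate[of A Z X] by (cases "Z = A") auto
    next
      case 3
      then show ?thesis using * A[of X Y] cr_rotate[of X Y A] by auto
    qed
  qed
qed

text \<open>The determinant is affine in each argument, so the three arguments can be moved from
  \<open>R\<close> to its hull one at a time. The largest triangle in a polygon is thus found among
  its vertices.\<close>

lemma bnd_hull:
  assumes "bnd \<mu> R"
  shows "bnd \<mu> (convex hull R)"
proof -
  have c: "convex {y. cr A C y \<le> \<mu>}" for A C by (rule convex_cr_halfplanes)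
  have 1: "cr X Y Z \<le> \<mu>" if "X \<in> R" "Y \<in> R" "Z \<in> convex hull R" for X Y Z
    using that assms by (intro hull_ind[OF that(3) c]) (auto simp: bnd_def)
  have 2: "cr X Y Z \<le> \<mu>" if "X \<in> R" "Y \<in> convex hull R" "Z \<in> convex hull R" for X Y Z
  proof -
    have "cr Z X Y \<le> \<mu>"
      using 1[of X _ Z] that by (intro hull_ind[OF that(2) c]) (simp add: cr_rotate[of X _ Z, symmetric])
    then show ?thesis by (simp add: cr_rotate[of X Y Z])
  qed
  show ?thesis unfolding bnd_def
  proof (intro ballI)
    fix X Y Z assume *: "X \<in> convex hull R" "Y \<in> convex hull R" "Z \<in> convex hull R"
    have "cr Y Z X \<le> \<mu>"
      using 2[of _ Y Z] * by (intro hull_ind[OF *(1) c]) (simp add: cr_rotate[of Y Z])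
    then show "cr X Y Z \<le> \<mu>" by (simp add: cr_rotate[of Y Z X])
  qed
qed

text \<open>Indexed by positions instead of points, so that along a slide it is the maximum of a
  fixed finite family of continuous functions.\<close>

definition mxc :: "(real^2) list \<Rightarrow> real" where
  "mxc xs = Max ((\<lambda>(i, j, k). cr (xs ! i) (xs ! j) (xs ! k)) ` ({..<length xs} \<times> {..<length xs} \<times> {..<length xs}))"

lemma mxc_le_iff:
  assumes "xs \<noteq> []"
  shows "mxc xs \<le> \<mu> \<longleftrightarrow> bnd \<mu> (set xs)"
proof -
  have "mxc xs \<le> \<mu> \<longleftrightarrow> (\<forall>i<length xs. \<forall>j<length xs. \<forall>k<length xs. cr (xs ! i) (xs ! j) (xs ! k) \<le> \<mu>)"
    unfolding mxc_def using assms by (subst Max_le_iff) (auto simp: Sigma_empty_iff)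
  then show ?thesis by (simp add: bnd_def all_set_conv_all_nth)
qed

lemma bnd_mxc: "xs \<noteq> [] \<Longrightarrow> bnd (mxc xs) (set xs)"
  using mxc_le_iff[of xs "mxc xs"] by simp

lemma mxc_attained:
  assumes "xs \<noteq> []"
  shows "\<exists>X\<in>set xs. \<exists>Y\<in>set xs. \<exists>Z\<in>set xs. cr X Y Z = mxc xs"
proof -
  have "mxc xs \<in> (\<lambda>(i, j, k). cr (xs ! i) (xs ! j) (xs ! k)) ` ({..<length xs} \<times> {..<length xs} \<times> {..<length xs})"
    unfolding mxc_def using assms by (intro Max_in) auto
  then show ?thesis by (auto intro!: bexI)
qed

lemma mxc_pos:
  assumes "ccw xs" "length xs \<ge> 3"
  shows "mxc xs > 0"
proof -
  obtain X Y Z zs where xs: "xs = X # Y # Z # zs"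
    using assms(2) by (metis Suc_le_length_iff numeral_3_eq_3)
  have "cr X Y Z \<le> mxc xs" using bnd_mxc[of xs] by (auto simp: xs intro: bndD)
  then show ?thesis using assms(1) by (simp add: xs)
qed

lemma continuous_on_Max_image:
  fixes f :: "'i \<Rightarrow> real \<Rightarrow> real"
  assumes "finite I" "I \<noteq> {}" "\<And>i. i \<in> I \<Longrightarrow> continuous_on S (f i)"
  shows "continuous_on S (\<lambda>t. Max ((\<lambda>i. f i t) ` I))"
  using assms by (induction I rule: finite_ne_induct) (auto intro!: continuous_intros)

lemma continuous_on_mxc_Cons:
  fixes a :: "real \<Rightarrow> real^2"
  assumes "continuous_on S a"
  shows "continuous_on S (\<lambda>t. mxc (a t # xs))"
proof -
  have nth: "continuous_on S (\<lambda>t. (a t # xs) ! i)" for i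
    using assms by (cases i) auto
  let ?I = "{..<length (a 0 # xs)}"
  have "continuous_on S (\<lambda>t. Max ((\<lambda>i. cr ((a t # xs) ! fst i) ((a t # xs) ! fst (snd i)) ((a t # xs) ! snd (snd i))) ` (?I \<times> ?I \<times> ?I)))"
    by (rule continuous_on_Max_image) (auto intro!: continuous_on_cr nth)
  then show ?thesis unfolding mxc_def case_prod_beta by simp
qed

lemma affine_frame:
  assumes "cr X Y Z > 0"
  obtains A where "invertible A" "det A = cr X Y Z" "affmap A X PP = X" "affmap A X QQ = Y" "affmap A X SS = Z"
proof -
  define A :: "real^2^2" where "A = vector [vector [Y$1 - X$1, Z$1 - X$1], vector [Y$2 - X$2, Z$2 - X$2]]"
  have A: "A$1$1 = Y$1 - X$1" "A$1$2 = Z$1 - X$1" "A$2$1 = Y$2 - X$2" "A$2$2 = Z$2 - X$2" by (simp_all add: A_def)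
  have "det A = cr X Y Z" by (simp add: det_2 A cr_def algebra_simps)
  moreover from this have "invertible A" using assms by (simp add: invertible_det_nz)
  moreover have "affmap A X PP = X" "affmap A X QQ = Y" "affmap A X SS = Z"
    by (simp_all add: vec_eq_iff forall_2 affmap_nth A)
  ultimately show ?thesis using that by blast
qed

lemma Phi_triangle:
  assumes "cr X Y Z > 0" "p \<ge> 1"
  shows "Phi m p (convex hull {X, Y, Z}) = Phi m p T0"
proof -
  obtain A where A: "invertible A" "affmap A X PP = X" "affmap A X QQ = Y" "affmap A X SS = Z"
    using affine_frame[OF assms(1)] by blast
  have "affmap A X ` T0 = convex hull {X, Y, Z}" unfolding T0_def affmap_hull by (simp add: A)
  then show ?thesis using Phi_affmap[OF A(1) body_T0 assms(2), of m X] by simp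
qed

lemma long_list:
  assumes "length xs \<ge> 4"
  obtains A C mid B where "xs = A # C # mid @ [B]" "mid \<noteq> []"
proof -
  obtain A C D ys where xs: "xs = A # C # D # ys" "ys \<noteq> []"
    using assms by (auto simp: eval_nat_numeral Suc_le_length_iff)
  then have "xs = A # C # (D # butlast ys) @ [last ys]" by simp
  then show ?thesis using that by blast
qed

lemma ccw_3:
  assumes "ccw xs" "length xs = 3"
  obtains X Y Z where "xs = [X, Y, Z]" "cr X Y Z > 0"
  using assms by (auto simp: numeral_3_eq_3 length_Suc_conv)

lemma Phi_le_triangle:
  assumes "p \<ge> 1" "ccw xs" "length xs \<ge> 3"
  shows "Phi m p (poly xs) \<le> Phi m p T0"
  using assms(2,3)
proof (induction "length xs" arbitrary: xs rule: less_induct)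
  case less
  show ?case
  proof (cases "length xs = 3")
    case True
    then obtain X Y Z where "xs = [X, Y, Z]" "cr X Y Z > 0" using ccw_3 less.prems by metis
    then show ?thesis using Phi_triangle[OF _ assms(1)] by simp
  next
    case False
    then have "length xs \<ge> 4" using less.prems by simp
    then obtain A C mid B where xs: "xs = A # C # mid @ [B]" "mid \<noteq> []" using long_list by blast
    interpret ear A B C mid using less.prems xs by unfold_locales auto
    have l: "length mid \<ge> 1" using mid by (cases mid) auto
    have "Phi m p (poly (slide (- ta) # C # mid)) \<le> Phi m p T0"
      by (rule less.hyps[OF _ ccw_ta]; use l in \<open>simp add: xs(1)\<close>)
    moreover have "Phi m p (poly (slide tb # mid @ [B])) \<le> Phi m p T0"
      by (rule less.hyps[OF _ ccw_tb]; use l in \<open>simp add: xs(1)\<close>)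
    ultimately show ?thesis
      using Phi_slide_max[OF assms(1), of ta tb m] ta_pos tb_pos unfolding poly_ta poly_tb xs by auto
  qed
qed

text \<open>Along a slide the area is constant and \<open>mxc\<close> is continuous. In either
  direction, proceed until the ratio has dropped to 1 + e or, failing that, to the end, where a
  vertex is lost and the induction applies. By convexity the functional does not decrease at one of
  the two stopping positions.\<close>

lemma exact_ratio:
  assumes p: "p \<ge> 1" and e: "e > 0" and "ccw xs" "length xs \<ge> 3" "(1 + e) * mxc xs \<le> 2 * area (poly xs)"
  shows "\<exists>ys. ccw ys \<and> 3 \<le> length ys \<and> length ys \<le> length xs \<and> 2 * area (poly ys) = (1 + e) * mxc ys
    \<and> Phi m p (poly xs) \<le> Phi m p (poly ys)"
  using assms(3-5)
proof (induction "length xs" arbitrary: xs rule: less_induct)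
  case less
  show ?case
  proof (cases "(1 + e) * mxc xs = 2 * area (poly xs)")
    case True
    then show ?thesis using less.prems by (intro exI[of _ xs]) auto
  next
    case False
    then have lt: "(1 + e) * mxc xs < 2 * area (poly xs)" using less.prems by simp
    have "length xs \<noteq> 3"
    proof
      assume "length xs = 3"
      then obtain X Y Z where xyz: "xs = [X, Y, Z]" "cr X Y Z > 0" using ccw_3 less.prems by metis
      then have "cr X Y Z \<le> mxc xs" using bnd_mxc[of xs] by (auto intro: bndD)
      then have "2 * area (poly xs) \<le> 1 * mxc xs" using xyz by (simp add: area_triangle)
      also have "\<dots> \<le> (1 + e) * mxc xs" using mxc_pos less.prems e by (intro mult_right_mono) (auto simp: less_imp_le)
      finally show False using lt by simp
    qed
    then have "length xs \<ge> 4" using less.prems by simp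
    then obtain A C mid B where xs: "xs = A # C # mid @ [B]" "mid \<noteq> []" using long_list by blast
    interpret ear A B C mid using less.prems xs by unfold_locales auto
    have l: "length mid \<ge> 1" using mid by (cases mid) auto
    let ?f = "\<lambda>t. (1 + e) * mxc (slide t # C # mid @ [B])"
    have cont: "continuous_on S ?f" for S
      unfolding slide_def by (intro continuous_intros continuous_on_mxc_Cons)
    let ?good = "\<lambda>t. \<exists>ys. ccw ys \<and> 3 \<le> length ys \<and> length ys \<le> length xs \<and> 2 * area (poly ys) = (1 + e) * mxc ys
      \<and> Phi m p (poly (slide t # C # mid @ [B])) \<le> Phi m p (poly ys)"
    have mono: "mxc ys \<le> mxc zs" if "set ys \<subseteq> set zs" "ys \<noteq> []" for ys zs
    proof -
      have "zs \<noteq> []" using that by auto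
      from bnd_subset[OF bnd_mxc[OF this] that(1)] show ?thesis by (simp add: mxc_le_iff[OF that(2)])
    qed
    have end_good: "?good t" if t: "- ta \<le> t" "t \<le> tb" and ft: "?f t \<le> 2 * area (poly xs)"
      and ys: "ccw ys" "length ys < length xs" "3 \<le> length ys" "set ys \<subseteq> set (slide t # C # mid @ [B])"
        "poly ys = poly (slide t # C # mid @ [B])" for t ys
    proof -
      have ne: "ys \<noteq> []" using ys(3) by auto
      have "(1 + e) * mxc ys \<le> ?f t" using mono[OF ys(4) ne] e by (intro mult_left_mono) auto
      also have "\<dots> \<le> 2 * area (poly ys)" using ft area_slide[OF t] by (simp add: ys(5) xs(1))
      finally show ?thesis using less.hyps[OF ys(2,1,3)] ys(2) unfolding ys(5)
        by (meson less_imp_le order_trans)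
    qed
    have inner_good: "?good t" if "- ta < t" "t < tb" "?f t = 2 * area (poly xs)" for t
      using that ccw_slide[OF that(1,2)] area_slide[of t] by (intro exI[of _ "slide t # C # mid @ [B]"]) (auto simp: xs(1))
    have R: "\<exists>t>0. t \<le> tb \<and> ?good t"
    proof (cases "?f tb \<le> 2 * area (poly xs)")
      case True
      have "?good tb" using ta_pos tb_pos l
        by (intro end_good[OF _ _ True ccw_tb _ _ _ poly_tb]) (auto simp: xs(1))
      then show ?thesis using tb_pos by blast
    next
      case False
      then obtain t where "0 \<le> t" "t \<le> tb" "?f t = 2 * area (poly xs)"
        using IVT'[of ?f 0 "2 * area (poly xs)" tb] lt tb_pos cont by (auto simp: xs(1))
      moreover have "t \<noteq> 0" using lt calculation by (auto simp: xs(1))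
      moreover have "t \<noteq> tb" using False calculation by auto
      ultimately show ?thesis using inner_good[of t] ta_pos by (intro exI[of _ t]) auto
    qed
    have L: "\<exists>s>0. s \<le> ta \<and> ?good (- s)"
    proof (cases "?f (- ta) \<le> 2 * area (poly xs)")
      case True
      have "?good (- ta)" using ta_pos tb_pos l
        by (intro end_good[OF _ _ True ccw_ta _ _ _ poly_ta]) (auto simp: xs(1))
      then show ?thesis using ta_pos by blast
    next
      case False
      then obtain t where "- ta \<le> t" "t \<le> 0" "?f t = 2 * area (poly xs)"
        using IVT2'[of ?f 0 "2 * area (poly xs)" "- ta"] lt ta_pos cont by (auto simp: xs(1))
      moreover have "t \<noteq> 0" using lt calculation by (auto simp: xs(1))
      moreover have "t \<noteq> - ta" using False calculation by auto
      ultimately show ?thesis using inner_good[of t] tb_pos by (intro exI[of _ "- t"]) auto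
    qed
    obtain s t where st: "0 < s" "s \<le> ta" "?good (- s)" "0 < t" "t \<le> tb" "?good t" using L R by blast
    from Phi_slide_max[OF p st(1,2,4,5), of m] st(3,6) show ?thesis
      unfolding xs(1)[symmetric] by (meson order_trans)
  qed
qed

section \<open>Stability for polygons with a bounded number of vertices\<close>

definition stab :: "nat \<Rightarrow> real \<Rightarrow> real \<Rightarrow> bool" where
  "stab n c e0 \<longleftrightarrow> (\<forall>m p xs \<mu> e. ccw xs \<longrightarrow> 3 \<le> length xs \<longrightarrow> length xs \<le> n \<longrightarrow> 1 \<le> p \<longrightarrow>
    0 \<le> e \<longrightarrow> e \<le> e0 \<longrightarrow> bnd \<mu> (set xs) \<longrightarrow> (1 + e) * \<mu> \<le> 2 * area (poly xs) \<longrightarrow>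
    Phi m p (poly xs) \<le> Phi m p T0 - c powr p * e\<^sup>2)"

lemma stabD:
  assumes "stab n c e0" "ccw xs" "3 \<le> length xs" "length xs \<le> n" "1 \<le> p" "0 \<le> e" "e \<le> e0"
    "bnd \<mu> (set xs)" "(1 + e) * \<mu> \<le> 2 * area (poly xs)"
  shows "Phi m p (poly xs) \<le> Phi m p T0 - c powr p * e\<^sup>2"
  using assms unfolding stab_def by blast

lemma bnd_mono: "bnd \<mu> R \<Longrightarrow> \<mu> \<le> \<mu>' \<Longrightarrow> bnd \<mu>' R"
  by (force simp: bnd_def)

text \<open>If z and W lie on different sides of the line XY, the triangles XYW and XYz meet only on
  this line and fit into \<open>K\<close> together. In normalised position, no point sticks out
  beyond a side by more than \<open>2 * area K - 1\<close>.\<close>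

lemma cap_bound:
  assumes K: "planar_convex_body K" and XYW: "X \<in> K" "Y \<in> K" "W \<in> K" "cr X Y W > 0" and z: "z \<in> K"
  shows "- cr X Y z \<le> 2 * area K - cr X Y W"
proof (cases "cr X Y z \<ge> 0")
  case True
  then show ?thesis using cr_le_area[OF K XYW(1-3)] by linarith
next
  case False
  let ?T1 = "convex hull {X, Y, W}" and ?T2 = "convex hull {X, Y, z}" and ?H = "{y. cr X Y y < 0}"
  define a where "a = (vector [X$2 - Y$2, Y$1 - X$1] :: real^2)"
  have cr_a: "cr X Y y = a \<bullet> y + (X$1 * Y$2 - X$2 * Y$1)" for y
    by (simp add: a_def cr_def inner_vec_def sum_2 algebra_simps)
  have "a \<noteq> 0" using XYW(4) by (auto simp: a_def vec_eq_iff forall_2 cr_def)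
  have "{y. cr X Y y = 0} = {y. a \<bullet> y = - (X$1 * Y$2 - X$2 * Y$1)}" by (auto simp: cr_a)
  then have "negligible {y. cr X Y y = 0}" using \<open>a \<noteq> 0\<close> by (simp only:) (intro negligible_hyperplane disjI1)
  moreover have b0: "{y. cr X Y y = 0} \<in> sets borel" by measurable
  ultimately have "{y. cr X Y y = 0} \<in> null_sets lborel"
    by (simp add: negligible_iff_null_sets null_sets_completion_iff)
  then have ae: "AE y in lborel. cr X Y y \<noteq> 0" using AE_not_in by force
  have cb: "?T1 \<in> sets borel" "?T2 \<in> sets borel"
    by (auto intro!: borel_closed compact_imp_closed finite_imp_compact_convex_hull)
  have Hb: "?H \<in> sets borel" by measurable
  have T2: "cr X Y y \<le> 0" if "y \<in> ?T2" for y
    using that False by (intro hull_ind[OF that convex_cr_halfplanes(3)]) auto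
  have T1: "0 \<le> cr X Y y" if "y \<in> ?T1" for y
    using that XYW by (intro hull_ind[OF that convex_cr_halfplanes(1)]) auto
  have "area ?T2 = area (?T2 \<inter> ?H)"
    unfolding area_def
  proof (rule measure_eq_AE)
    show "AE y in lborel. (y \<in> ?T2) = (y \<in> ?T2 \<inter> ?H)"
      using ae by eventually_elim (use T2 in force)
  qed (use cb Hb in auto)
  have sub: "?T1 \<subseteq> K" "?T2 \<subseteq> K"
    using XYW z K by (simp_all add: hull_minimal planar_convex_body_def)
  have fin: "emeasure lborel S \<noteq> \<infinity>" if "S \<subseteq> K" "S \<in> sets borel" for S
    using emeasure_mono[OF that(1), of lborel] body_borel[OF K] body_emeasure(1)[OF K] by (auto simp: top_unique)
  have disj: "?T1 \<inter> (?T2 \<inter> ?H) = {}" using T1 by force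
  have "?T2 \<inter> ?H \<subseteq> K" using sub by blast
  then have "area ?T1 + area (?T2 \<inter> ?H) = area (?T1 \<union> (?T2 \<inter> ?H))"
    unfolding area_def using cb Hb fin[of ?T1] fin[of "?T2 \<inter> ?H"] sub disj
    by (intro measure_Union[symmetric]) simp_all
  also have "\<dots> \<le> area K" using cb Hb sub by (intro area_mono[OF K]) auto
  finally show ?thesis
    using \<open>area ?T2 = area (?T2 \<inter> ?H)\<close> XYW(4) False by (simp add: area_triangle)
qed

lemma convex_comb_le:
  fixes s t x y T g :: real
  assumes "0 < s" "0 < t" "x \<le> T - g" "y \<le> T - g"
  shows "t / (s + t) * x + s / (s + t) * y \<le> T - g"
proof -
  have "t / (s + t) * x + s / (s + t) * y \<le> t / (s + t) * (T - g) + s / (s + t) * (T - g)"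
    using assms by (intro add_mono mult_left_mono) auto
  also have "\<dots> = (t / (s + t) + s / (s + t)) * (T - g)" by (simp only: distrib_right)
  also have "t / (s + t) + s / (s + t) = 1" using assms by (simp add: add_divide_distrib[symmetric])
  finally show ?thesis by simp
qed

text \<open>The nearer end of a slide carries at least half the weight, so an improvement at this
  end alone still counts half.\<close>

lemma convex_comb_le_half:
  fixes s t x y T g :: real
  assumes st: "0 < s" "s \<le> t" and x: "x \<le> T - g" and y: "y \<le> T" and g: "0 \<le> g"
  shows "t / (s + t) * x + s / (s + t) * y \<le> T - g / 2"
proof -
  have "t / (s + t) * x + s / (s + t) * y \<le> t / (s + t) * (T - g) + s / (s + t) * T"
    using assms by (intro add_mono mult_left_mono) auto
  also have "\<dots> = (t / (s + t) + s / (s + t)) * T - t / (s + t) * g" by (simp only: distrib_right right_diff_distrib)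
  also have "t / (s + t) + s / (s + t) = 1" using st by (simp add: add_divide_distrib[symmetric])
  also have "1 / 2 * g \<le> t / (s + t) * g" using st g by (intro mult_right_mono) (auto simp: field_simps)
  then have "1 * T - t / (s + t) * g \<le> T - g / 2" by simp
  finally show ?thesis .
qed

section \<open>Thin ears, short slides and wide ears\<close>

context ear
begin

lemma bnd_slide:
  assumes b: "bnd 1 (set (A # C # mid @ [B]))"
  shows "bnd (1 + 2 * \<bar>t\<bar>) (set (slide t # C # mid @ [B]))"
proof -
  let ?R = "set (C # mid @ [B])"
  have bR: "bnd 1 ?R" by (rule bnd_subset[OF b]) auto
  have "bnd (1 + 2 * \<bar>t\<bar>) (insert (slide t) ?R)"
  proof (rule bnd_insert)
    show "bnd (1 + 2 * \<bar>t\<bar>) ?R" by (rule bnd_mono[OF bR]) simp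
    fix Y Z assume YZ: "Y \<in> ?R" "Z \<in> ?R"
    have "\<bar>cr C Y Z\<bar> \<le> 1" "\<bar>cr B Y Z\<bar> \<le> 1" using YZ by (auto intro!: bnd_abs[OF bR])
    then have "\<bar>t * (cr C Y Z - cr B Y Z)\<bar> \<le> \<bar>t\<bar> * 2"
      unfolding abs_mult by (intro mult_left_mono) auto
    moreover have "cr A Y Z \<le> 1" using YZ by (intro bndD[OF b]) auto
    ultimately show "cr (slide t) Y Z \<le> 1 + 2 * \<bar>t\<bar>" unfolding cr_slide by linarith
  qed simp
  then show ?thesis by simp
qed

text \<open>Barycentric coordinates of the moving vertex with respect to \<open>B\<close>,
  \<open>C\<close> and a vertex \<open>S\<close> of \<open>mid\<close>, multiplied by
  \<open>cr B C S\<close>. Only the coefficient of \<open>S\<close> is negative, and it is the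
  constant -\<alpha>.\<close>

lemma slide_frame:
  assumes S: "S \<in> set mid" and t: "- ta \<le> t" "t \<le> tb"
  shows "0 \<le> cr (slide t) C S" "0 \<le> cr (slide t) S B" "cr (slide t) C S + cr (slide t) S B = cr B C S + \<alpha>"
    "cr B C S *\<^sub>R slide t = cr (slide t) C S *\<^sub>R B + cr (slide t) S B *\<^sub>R C - \<alpha> *\<^sub>R S"
proof -
  show "0 \<le> cr (slide t) C S" "0 \<le> cr (slide t) S B" using slide_C(1) slide_B(1) S t by auto
  have \<alpha>: "\<alpha> = cr (slide t) C B" by simp
  show "cr (slide t) C S + cr (slide t) S B = cr B C S + \<alpha>"
    unfolding \<alpha> by (simp add: cr_def algebra_simps)
  show "cr B C S *\<^sub>R slide t = cr (slide t) C S *\<^sub>R B + cr (slide t) S B *\<^sub>R C - \<alpha> *\<^sub>R S"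
    unfolding \<alpha> by (simp only: vec_eq_iff forall_2 vector_add_component vector_minus_component vector_scaleR_component cr_def)
      (simp add: algebra_simps)
qed

text \<open>By \<open>slide_frame\<close>, the determinant at the moved vertex is a combination of
  determinants of fixed vertices, with nonnegative coefficients of sum
  \<open>cr B C S + \<alpha>\<close> and one coefficient -\<alpha>. So a thin ear hardly raises the
  maximum, however far its vertex slides.\<close>

lemma bnd_slide_ear:
  assumes b: "bnd 1 (set (A # C # mid @ [B]))" and S: "S \<in> set mid" and t: "- ta \<le> t" "t \<le> tb"
    and q: "\<alpha> \<le> q * cr B C S"
  shows "bnd (1 + 2 * q) (set (slide t # C # mid @ [B]))"
proof -
  let ?R = "set (C # mid @ [B])" and ?D = "cr B C S"
  have bR: "bnd 1 ?R" by (rule bnd_subset[OF b]) auto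
  have D: "?D > 0" using mid_pos[OF S] cr_rotate[of C S B] by simp
  have "0 < q * ?D" using q alpha_pos by linarith
  then have q0: "q \<ge> 0" using D by (simp add: zero_less_mult_iff)
  have "bnd (1 + 2 * q) (insert (slide t) ?R)"
  proof (rule bnd_insert)
    show "bnd (1 + 2 * q) ?R" by (rule bnd_mono[OF bR]) (use q0 in simp)
    show "0 \<le> 1 + 2 * q" using q0 by simp
    fix Y Z assume YZ: "Y \<in> ?R" "Z \<in> ?R"
    note fr = slide_frame[OF S t]
    have "?D * cr (slide t) Y Z = cr (slide t) C S * cr B Y Z + cr (slide t) S B * cr C Y Z - cr (slide t) C B * cr S Y Z"
      by (simp add: cr_def algebra_simps)
    moreover have "cr (slide t) C S * cr B Y Z \<le> cr (slide t) C S * 1" "cr (slide t) S B * cr C Y Z \<le> cr (slide t) S B * 1"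
      using fr YZ by (auto intro!: mult_left_mono bndD[OF bR] simp del: mult_1_right)
    moreover have "\<alpha> * (- 1) \<le> \<alpha> * cr S Y Z"
      using alpha_pos YZ S bnd_abs[OF bR, of S Y Z] by (intro mult_left_mono) auto
    ultimately have "?D * cr (slide t) Y Z \<le> ?D + 2 * \<alpha>" using fr(3) by simp
    also have "\<dots> \<le> ?D * (1 + 2 * q)" using q by (simp add: algebra_simps)
    finally show "cr (slide t) Y Z \<le> 1 + 2 * q" using D by simp
  qed
  then show ?thesis by simp
qed

lemma Phi_ends_le:
  assumes "p \<ge> 1"
  shows "Phi m p (poly (slide tb # C # mid @ [B])) \<le> Phi m p T0"
    "Phi m p (poly (slide (- ta) # C # mid @ [B])) \<le> Phi m p T0"
proof -
  have l: "length mid \<ge> 1" using mid by (cases mid) auto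
  show "Phi m p (poly (slide tb # C # mid @ [B])) \<le> Phi m p T0"
    unfolding poly_tb[symmetric] using l by (intro Phi_le_triangle[OF assms ccw_tb]) simp
  show "Phi m p (poly (slide (- ta) # C # mid @ [B])) \<le> Phi m p T0"
    unfolding poly_ta[symmetric] using l by (intro Phi_le_triangle[OF assms ccw_ta]) simp
qed

context
  fixes n :: nat and c e0 e p :: real
  assumes st: "stab n c e0" and len: "length mid + 2 \<le> n" and p: "p \<ge> 1" and e: "0 \<le> e" "e \<le> e0" "e \<le> 1"
    and ar: "2 * area (poly (A # C # mid @ [B])) = 1 + e"
begin

text \<open>If a slide raises the maximal triangle by a factor of at most 1 + e / 4 while the area
  is kept, the ratio is still at least 1 + e / 2. The thresholds e / 8 below are half of e / 4,
  since both bounds for a slide come with a factor 2.\<close>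

lemma ratio_half: "(1 + e / 2) * (1 + e / 4) \<le> 1 + e"
proof -
  have "e * e \<le> e * 1" using e by (intro mult_left_mono) auto
  then show ?thesis using e(1) by (simp add: algebra_simps)
qed

lemma Phi_end_tb:
  assumes "bnd (1 + e / 4) (set (slide tb # C # mid @ [B]))"
  shows "Phi m p (poly (slide tb # C # mid @ [B])) \<le> Phi m p T0 - c powr p * (e / 2)\<^sup>2"
  unfolding poly_tb[symmetric]
proof (rule stabD[OF st ccw_tb _ _ p, where \<mu> = "1 + e / 4"])
  show "bnd (1 + e / 4) (set (slide tb # mid @ [B]))" by (rule bnd_subset[OF assms]) auto
  show "(1 + e / 2) * (1 + e / 4) \<le> 2 * area (poly (slide tb # mid @ [B]))"
    unfolding poly_tb using ratio_half ar area_slide[of tb] ta_pos tb_pos by simp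
  show "3 \<le> length (slide tb # mid @ [B])" using mid by (cases mid) auto
qed (use len e in auto)

lemma Phi_end_ta:
  assumes "bnd (1 + e / 4) (set (slide (- ta) # C # mid @ [B]))"
  shows "Phi m p (poly (slide (- ta) # C # mid @ [B])) \<le> Phi m p T0 - c powr p * (e / 2)\<^sup>2"
  unfolding poly_ta[symmetric]
proof (rule stabD[OF st ccw_ta _ _ p, where \<mu> = "1 + e / 4"])
  show "bnd (1 + e / 4) (set (slide (- ta) # C # mid))" by (rule bnd_subset[OF assms]) auto
  show "(1 + e / 2) * (1 + e / 4) \<le> 2 * area (poly (slide (- ta) # C # mid))"
    unfolding poly_ta using ratio_half ar area_slide[of "- ta"] ta_pos tb_pos by simp
  show "3 \<le> length (slide (- ta) # C # mid)" using mid by (cases mid) auto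
qed (use len e in auto)

lemma Phi_small_ear:
  assumes b: "bnd 1 (set (A # C # mid @ [B]))" and S: "S \<in> set mid" and q: "\<alpha> \<le> (e / 8) * cr B C S"
  shows "Phi m p (poly (A # C # mid @ [B])) \<le> Phi m p T0 - c powr p * (e / 2)\<^sup>2"
proof -
  have "bnd (1 + e / 4) (set (slide t # C # mid @ [B]))" if "- ta \<le> t" "t \<le> tb" for t
    using bnd_slide_ear[OF b S that q] by simp
  then have "Phi m p (poly (slide tb # C # mid @ [B])) \<le> Phi m p T0 - c powr p * (e / 2)\<^sup>2"
    "Phi m p (poly (slide (- ta) # C # mid @ [B])) \<le> Phi m p T0 - c powr p * (e / 2)\<^sup>2"
    using ta_pos tb_pos by (auto intro!: Phi_end_tb Phi_end_ta simp del: list.set set_append)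
  then show ?thesis
    using Phi_slide_convex[OF p, of ta tb m] ta_pos tb_pos convex_comb_le[OF ta_pos tb_pos] by (meson order_refl order_trans)
qed

text \<open>Only the nearer end is known to keep the ratio above 1 + e / 2; the farther one is
  merely compared with the triangle, which costs the last factor 1/2.\<close>

lemma Phi_short_slide:
  assumes b: "bnd 1 (set (A # C # mid @ [B]))" and "ta \<le> e / 8 \<or> tb \<le> e / 8"
  shows "Phi m p (poly (A # C # mid @ [B])) \<le> Phi m p T0 - c powr p * (e / 2)\<^sup>2 / 2"
proof -
  have g: "0 \<le> c powr p * (e / 2)\<^sup>2" by simp
  have bt: "bnd (1 + e / 4) (set (slide t # C # mid @ [B]))" if "\<bar>t\<bar> \<le> e / 8" for t
  proof -
    have "bnd (1 + 2 * \<bar>t\<bar>) (set (slide t # C # mid @ [B]))" by (rule bnd_slide[OF b])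
    then show ?thesis using that by (rule_tac bnd_mono) auto
  qed
  note cvx = Phi_slide_convex[OF p ta_pos order_refl tb_pos order_refl, of m]
  show ?thesis
  proof (cases "ta \<le> tb")
    case True
    then have "\<bar>- ta\<bar> \<le> e / 8" using assms(2) ta_pos by auto
    from convex_comb_le_half[OF ta_pos True Phi_end_ta[OF bt[OF this], of m] Phi_ends_le(1)[OF p] g] cvx
    show ?thesis by linarith
  next
    case False
    then have "\<bar>tb\<bar> \<le> e / 8" "tb \<le> ta" using assms(2) tb_pos by auto
    from convex_comb_le_half[OF tb_pos this(2) Phi_end_tb[OF bt[OF this(1)], of m] Phi_ends_le(2)[OF p] g] cvx
    show ?thesis by (simp add: add.commute)
  qed
qed

end

text \<open>By \<open>slide_frame\<close> with the top vertex \<open>SS\<close>, the moving vertex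
  is an affine combination of \<open>B\<close> and \<open>C\<close>, both near the bottom side, and
  of \<open>SS\<close> with a coefficient of at least -k. So it stays near the bottom side even on a
  long slide.\<close>

lemma slide_bounds:
  assumes b: "bnd 1 (set (A # C # mid @ [B]))" and S: "SS \<in> set mid" and t: "- ta \<le> t" "t \<le> tb"
    and co: "\<And>z. z \<in> {B, C} \<Longrightarrow> - e \<le> z$1 \<and> z$1 \<le> 1 \<and> - e \<le> z$2 \<and> z$2 \<le> 0"
    and k: "\<alpha> \<le> k * cr B C SS" "k \<le> 1/2500" and e: "0 \<le> e" "e \<le> 1/5000"
  shows "-1/1000 \<le> slide t $ 1 \<and> slide t $ 1 \<le> 1 + 1/1000 \<and> \<bar>slide t $ 2\<bar> \<le> 1/1000"
proof -
  let ?D = "cr B C SS"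
  have D: "?D > 0" using mid_pos[OF S] cr_rotate[of C SS B] by simp
  note fr = slide_frame[OF S t]
  let ?x = "cr (slide t) C SS" and ?y = "cr (slide t) SS B"
  have 1: "?D * slide t $ 1 = ?x * B$1 + ?y * C$1" and 2: "?D * slide t $ 2 = ?x * B$2 + ?y * C$2 - \<alpha>"
    using arg_cong[OF fr(4), of "\<lambda>z. z$1"] arg_cong[OF fr(4), of "\<lambda>z. z$2"] by simp_all
  have s: "?x + ?y \<le> ?D * (1 + k)" using fr(3) k by (simp add: algebra_simps)
  have coB: "- e \<le> B$1 \<and> B$1 \<le> 1 \<and> - e \<le> B$2 \<and> B$2 \<le> 0" and coC: "- e \<le> C$1 \<and> C$1 \<le> 1 \<and> - e \<le> C$2 \<and> C$2 \<le> 0"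
    using co by auto
  have lin: "?x * a + ?y * c \<le> (?x + ?y) * u" if "a \<le> u" "c \<le> u" for a c u
    using that fr(1,2) by (simp add: distrib_right add_mono mult_left_mono)
  have "?x * B$1 + ?y * C$1 \<le> (?x + ?y) * 1" using coB coC by (intro lin) auto
  then have "?D * slide t $ 1 \<le> ?D * (1 + k)" using s 1 by simp
  then have a: "slide t $ 1 \<le> 1 + k" using D by simp
  have e2: "(?x + ?y) * e \<le> ?D * (2 * e)"
  proof -
    have "(?x + ?y) * e \<le> ?D * (1 + k) * e" using s e by (intro mult_right_mono) auto
    also have "\<dots> \<le> ?D * 2 * e" using D k e by (intro mult_right_mono mult_left_mono) auto
    finally show ?thesis by (simp add: mult.assoc)
  qed
  have "?x * (- B$1) + ?y * (- C$1) \<le> (?x + ?y) * e" using coB coC by (intro lin) auto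
  then have "?D * (- slide t $ 1) \<le> ?D * (2 * e)" using e2 1 by simp
  then have b: "- slide t $ 1 \<le> 2 * e" using D by (simp only: mult_le_cancel_left_pos)
  have "?x * (- B$2) + ?y * (- C$2) \<le> (?x + ?y) * e" using coB coC by (intro lin) auto
  then have "?D * (- slide t $ 2) \<le> ?D * (2 * e + k)" using e2 2 k by (simp add: algebra_simps)
  then have c: "- slide t $ 2 \<le> 2 * e + k" using D by (simp only: mult_le_cancel_left_pos)
  have "?x * B$2 + ?y * C$2 \<le> (?x + ?y) * 0" using coB coC by (intro lin) auto
  then have "?D * slide t $ 2 \<le> ?D * 0" using 2 alpha_pos by simp
  then have d: "slide t $ 2 \<le> 0" using D by (simp only: mult_le_cancel_left_pos)
  show ?thesis using a b c d k(2) e(2) by (simp add: abs_le_iff)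
qed

text \<open>The fold keeps the height, so the point stays beyond the diagonal, where the polygon
  consists of the ear alone.\<close>

lemma psi_in_ear:
  assumes t: "- ta \<le> t" "t \<le> tb" and x: "x \<in> poly (A # C # mid @ [B])" and h: "0 < ear_height B C \<alpha> x"
  shows "psi t x \<in> convex hull {slide t, C, B}"
proof -
  let ?R = "set (slide t # C # mid @ [B])"
  have y: "psi t x \<in> convex hull ?R" using x psi_poly[OF t] by blast
  show ?thesis
  proof (rule triangle_memI)
    show "0 < cr (slide t) C B" using alpha_pos by simp
    show "0 \<le> cr (slide t) C (psi t x)"
      using slide_C(1)[OF t(2)] alpha_pos by (intro hull_ind[OF y convex_cr_halfplanes(1)]) auto
    have "0 \<le> cr (slide t) (psi t x) B"
      using slide_B(1)[OF t(1)] alpha_pos by (intro hull_ind[OF y convex_cr_halfplanes(2)]) auto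
    then show "0 \<le> cr B (slide t) (psi t x)" by (simp add: cr_rotate[of "slide t" "psi t x" B, symmetric])
    have "0 < ear_height B C \<alpha> (psi t x)" using h h_fold[of t x] by simp
    then have "0 < cr B (psi t x) C / \<alpha>" unfolding ear_height_def[of B C \<alpha> "psi t x"] .
    then have "0 < cr B (psi t x) C" using alpha_pos by (simp add: zero_less_divide_iff)
    then show "0 \<le> cr C B (psi t x)" by (simp add: cr_rotate[of B "psi t x" C])
  qed
qed

text \<open>The ear shrunk by 1/2 towards \<open>A\<close> consists of points of height at least
  1/2. Its area is a quarter of \<alpha> / 2, and its probability is no smaller because the polygon
  has area at most 1.\<close>

lemma ear_measure: "\<alpha> / 8 \<le> measure (unif (poly (A # C # mid @ [B]))) {x \<in> poly (A # C # mid @ [B]). 1/2 \<le> ear_height B C \<alpha> x}"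
  if ar: "area (poly (A # C # mid @ [B])) \<le> 1"
proof -
  let ?K = "poly (A # C # mid @ [B])" and ?X = "{x \<in> poly (A # C # mid @ [B]). 1/2 \<le> ear_height B C \<alpha> x}"
  let ?M = "\<lambda>Z. (1/2) *\<^sub>R A + (1/2) *\<^sub>R Z"
  let ?T = "convex hull {A, ?M C, ?M B}"
  have "cr A (?M C) (?M B) = \<alpha> / 4" by (simp add: \<alpha>_def cr_def algebra_simps)
  then have aT: "area ?T = \<alpha> / 8" using alpha_pos by (simp add: area_triangle)
  have inK: "?M Z \<in> ?K" if "Z \<in> set (C # mid @ [B])" for Z
    using that by (intro convexD[OF convex_convex_hull] hull_inc) auto
  have TK: "?T \<subseteq> ?K" using inK by (intro hull_minimal) (auto intro: hull_inc)
  have "1/2 \<le> ear_height B C \<alpha> x" if "x \<in> ?T" for x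
  proof -
    have eq: "{x. 1/2 \<le> ear_height B C \<alpha> x} = {x. vector [(C$2 - B$2) / \<alpha>, (B$1 - C$1) / \<alpha>] \<bullet> x \<ge> 1/2 - (C$1 * B$2 - C$2 * B$1) / \<alpha>}"
    proof (intro set_eqI)
      fix x
      have hx: "ear_height B C \<alpha> x = vector [(C$2 - B$2) / \<alpha>, (B$1 - C$1) / \<alpha>] \<bullet> x + (C$1 * B$2 - C$2 * B$1) / \<alpha>"
        by (simp add: h inner_vec_def sum_2)
      show "x \<in> {x. 1/2 \<le> ear_height B C \<alpha> x} \<longleftrightarrow> x \<in> {x. vector [(C$2 - B$2) / \<alpha>, (B$1 - C$1) / \<alpha>] \<bullet> x \<ge> 1/2 - (C$1 * B$2 - C$2 * B$1) / \<alpha>}"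
        unfolding mem_Collect_eq hx by linarith
    qed
    have conv: "convex {x. 1/2 \<le> ear_height B C \<alpha> x}" unfolding eq by (rule convex_halfspace_ge)
    have hA: "ear_height B C \<alpha> A = 1"
      using alpha_pos by (simp add: ear_height_def \<alpha>_def cr_rotate[of B A C] cr_rotate[of C B A])
    have hM: "ear_height B C \<alpha> (?M Z) = (ear_height B C \<alpha> A + ear_height B C \<alpha> Z) / 2" for Z
    proof -
      have "cr B (?M Z) C = (cr B A C + cr B Z C) / 2" by (simp add: cr_def field_simps)
      then show ?thesis by (simp add: ear_height_def add_divide_distrib)
    qed
    have "ear_height B C \<alpha> (?M Z) = 1/2" if "Z = B \<or> Z = C" for Z
      unfolding hM hA using that by (auto simp: ear_height_def)
    then show ?thesis using hA by (intro hull_ind[OF that conv]) auto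
  qed
  then have TX: "?T \<subseteq> ?X" using TK by blast
  have [measurable]: "ear_height B C \<alpha> \<in> borel_measurable borel"
    by (intro borel_measurable_continuous_onI continuous_on_h)
  have [measurable]: "?K \<in> sets borel" by (rule body_borel[OF body])
  have X: "?X \<in> sets borel" by measurable
  note aK = body_emeasure[OF body]
  have T: "?T \<in> sets borel" by (auto intro!: borel_closed compact_imp_closed finite_imp_compact_convex_hull)
  have "\<alpha> / 8 \<le> area ?T / area ?K"
  proof -
    have "\<alpha> / 8 * area ?K \<le> \<alpha> / 8 * 1" using ar alpha_pos by (intro mult_left_mono) auto
    then show ?thesis unfolding aT using aK(2) by (simp only: pos_le_divide_eq mult_1_right)
  qed
  also have "\<dots> = measure (unif ?K) ?T"
  proof -
    have "measure (unif ?K) ?T = measure lborel (?K \<inter> ?T) / measure lborel ?K"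
      by (rule measure_uniform_measure) (use aK T in simp_all)
    then show ?thesis unfolding Int_absorb1[OF TK] area_def by (rule sym)
  qed
  also have "\<dots> \<le> measure (unif ?K) ?X"
    by (rule finite_measure.finite_measure_mono[OF unif_finite[OF body] TX]) (use X in simp)
  finally show ?thesis .
qed

end

text \<open>Collects the constants of the gain into a single p-th power: Q <= 1 gives
  \<open>Q powr p \<le> Q\<close>, the factor 1 / (p + 1) is absorbed by p + 1 <= exp p <=
  \<open>3 powr p\<close>, and 432 = 3 * 144.\<close>

lemma powr_constants:
  fixes p Q :: real
  assumes p: "p \<ge> 1" and Q: "0 < Q" "Q \<le> 1"
  shows "(Q / 432) powr p \<le> (1/144) powr (p - 1) * (Q / (p + 1))"
proof -
  have "Q powr p \<le> Q" using powr_mono'[OF p, of Q] Q by simp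
  moreover have "(1/144) powr p \<le> (1/144) powr (p - 1)" by (intro powr_mono') auto
  moreover have "(1/3) powr p \<le> 1 / (p + 1)"
  proof -
    have "p + 1 \<le> exp p" using exp_ge_add_one_self[of p] by linarith
    also have "\<dots> = exp 1 powr p" by (simp add: exp_powr_real)
    also have "\<dots> \<le> 3 powr p" using exp_le p by (intro powr_mono2) auto
    finally have "1 / 3 powr p \<le> 1 / (p + 1)" using p by (intro divide_left_mono) auto
    then show ?thesis by (simp add: powr_divide)
  qed
  ultimately have "(1/144) powr p * (Q powr p * (1/3) powr p) \<le> (1/144) powr (p - 1) * (Q * (1 / (p + 1)))"
    using Q by (intro mult_mono) auto
  also have "(1/144) powr p * (Q powr p * (1/3) powr p) = (Q / 432) powr p"
    using Q by (simp add: powr_mult[symmetric])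
  finally show ?thesis by simp
qed

text \<open>\<open>4096 * N ^ 4\<close> is the product of the denominators 8,
  \<open>32 * N\<^sup>2\<close> and \<open>(4 * N)\<^sup>2\<close> in the lower bounds for
  \<open>ta\<close>, for \<alpha> times \<open>tb\<close> and for the squared width of the base.
  576000 comes from \<open>fibre_gap\<close>, 8 from \<open>ear_measure\<close> and 250000 from the
  square of first points.\<close>

definition gapQ :: "real \<Rightarrow> real" where
  "gapQ N = 1 / (4096 * N ^ 4 * 576000 * 8 * 250000)"

lemma hull_box:
  fixes z :: "real^2"
  assumes "z \<in> convex hull R" "\<And>r. r \<in> R \<Longrightarrow> l1 \<le> r$1 \<and> r$1 \<le> u1 \<and> l2 \<le> r$2 \<and> r$2 \<le> u2"
  shows "l1 \<le> z$1 \<and> z$1 \<le> u1 \<and> l2 \<le> z$2 \<and> z$2 \<le> u2"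
proof -
  have "{z::real^2. l1 \<le> z$1 \<and> z$1 \<le> u1 \<and> l2 \<le> z$2 \<and> z$2 \<le> u2} = cbox (vector [l1, l2]) (vector [u1, u2] :: real^2)"
    by (auto simp: mem_box_cart forall_2)
  then have "convex {z::real^2. l1 \<le> z$1 \<and> z$1 \<le> u1 \<and> l2 \<le> z$2 \<and> z$2 \<le> u2}" by simp
  from hull_ind[OF assms(1) this] assms(2) show ?thesis by blast
qed

context ear
begin

text \<open>Neither slide is short here, and the deficit comes from the strict convexity along the motion.\<close>
lemma Phi_wide_ear:
  fixes N e p :: real
  assumes b: "bnd 1 (set (A # C # mid @ [B]))" and S: "SS \<in> set mid"
    and PQ: "PP \<in> set (C # mid @ [B])" "QQ \<in> set (C # mid @ [B])"
    and ar: "2 * area (poly (A # C # mid @ [B])) = 1 + e"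
    and N: "N \<ge> 1" and e: "0 < e" "e \<le> 1 / (20000 * N)" and p: "p \<ge> 1"
    and D: "1 / (2 * N) \<le> cr B C SS"
    and y0: "A$2 \<le> 0" "B$2 \<le> 0" "C$2 \<le> 0"
    and t: "e / 8 \<le> ta" "e / 8 \<le> tb" and at: "e / (32 * N\<^sup>2) \<le> \<alpha> * tb"
  shows "Phi m p (poly (A # C # mid @ [B])) \<le> Phi m p T0 - (gapQ N / 432) powr p * e\<^sup>2"
proof -
  let ?K = "poly (A # C # mid @ [B])"
  let ?R = "set (C # mid @ [B])"
  have eN: "e * N \<le> 1/20000" and e5: "e \<le> 1/20000"
  proof -
    show "e * N \<le> 1/20000" using e N by (simp add: field_simps)
    moreover have "e * 1 \<le> e * N" using e N by (intro mult_left_mono) auto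
    ultimately show "e \<le> 1/20000" by simp
  qed
  \<comment> \<open>\<open>cap_bound\<close> at two sides of \<open>T0\<close> bounds the
    coordinates below by -e; the maximality of \<open>T0\<close> bounds them above by 1.\<close>
  have co: "- e \<le> z$1 \<and> z$1 \<le> 1 \<and> - e \<le> z$2 \<and> z$2 \<le> 1" if z: "z \<in> ?K" for z
  proof -
    have T: "PP \<in> ?K" "QQ \<in> ?K" "SS \<in> ?K" using PQ S by (auto intro!: hull_inc)
    have "- cr PP QQ z \<le> e" using cap_bound[OF body T(1,2,3) _ z] ar by (simp add: cr_def)
    moreover have "- cr SS PP z \<le> e" using cap_bound[OF body T(3,1,2) _ z] ar by (simp add: cr_def)
    moreover have "cr PP QQ z \<le> 1" "cr SS PP z \<le> 1" using bndD[OF bnd_hull[OF b]] T z by auto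
    ultimately show ?thesis by (simp add: cr_def)
  qed
  have inK: "z \<in> ?K" if "z \<in> insert A ?R" for z using that by (auto intro!: hull_inc)
  have coA: "- e \<le> A$1 \<and> A$1 \<le> 1 \<and> - e \<le> A$2 \<and> A$2 \<le> 0" and coB: "- e \<le> B$1 \<and> B$1 \<le> 1 \<and> - e \<le> B$2 \<and> B$2 \<le> 0"
    and coC: "- e \<le> C$1 \<and> C$1 \<le> 1 \<and> - e \<le> C$2 \<and> C$2 \<le> 0"
    using co[OF inK] y0 by auto
  let ?v = "C - B"
  have v2: "\<bar>?v$2\<bar> \<le> e" using coB coC by (simp add: abs_le_iff)
  \<comment> \<open>\<open>B\<close> and \<open>C\<close> are near the bottom side, so
    \<open>cr B C SS\<close> is nearly the horizontal width of the base of the ear, which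
    \<open>D\<close> thus bounds from below.\<close>
  have v1: "1 / (4 * N) \<le> ?v$1"
  proof -
    have D': "cr B C SS = ?v$1 * (1 - B$2) + ?v$2 * B$1" by (simp add: cr_def algebra_simps)
    have "\<bar>?v$2 * B$1\<bar> \<le> e * 1" using v2 coB e5 by (intro abs_prod_le) auto
    then have 1: "1 / (2 * N) - e \<le> ?v$1 * (1 - B$2)" using D D' by (simp add: abs_le_iff)
    have eN4: "e \<le> 1 / (8 * N)" using eN N by (simp add: field_simps)
    have "3 / (8 * N) \<le> ?v$1 * (1 - B$2)" using 1 eN4 by (simp add: field_simps)
    moreover have "1 \<le> 1 - B$2" "1 - B$2 \<le> 3/2" using coB e5 by auto
    moreover have "0 < 3 / (8 * N)" using N by simp
    ultimately have "0 < ?v$1 * (1 - B$2)" "0 < 1 - B$2" by linarith+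
    then have "0 < ?v$1" by (simp add: zero_less_mult_iff)
    then have "?v$1 * (1 - B$2) \<le> ?v$1 * (3/2)" using \<open>1 - B$2 \<le> 3/2\<close> by (intro mult_left_mono) auto
    then have "3 / (8 * N) \<le> ?v$1 * (3/2)" using \<open>3 / (8 * N) \<le> ?v$1 * (1 - B$2)\<close> by linarith
    then show ?thesis using N by (simp add: field_simps)
  qed
  have v1p: "0 < ?v$1" using v1 N by (meson less_le_trans zero_less_divide_1_iff zero_less_mult_iff zero_less_numeral zero_less_one)
  have vr: "\<bar>?v$2\<bar> \<le> ?v$1 / 1000"
  proof -
    have "e * 1000 \<le> 1 / (4 * N)" using eN N by (simp add: field_simps)
    then show ?thesis using v2 v1 by linarith
  qed
  \<comment> \<open>The ear is flat: its corners have heights between -e and 0.\<close>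
  have "\<alpha> \<le> 4 * e"
  proof -
    have "\<alpha> = (C$1 - A$1) * (B$2 - A$2) - (C$2 - A$2) * (B$1 - A$1)" by (simp add: \<alpha>_def cr_def)
    moreover have "\<bar>(C$1 - A$1) * (B$2 - A$2)\<bar> \<le> 2 * e" "\<bar>(C$2 - A$2) * (B$1 - A$1)\<bar> \<le> e * 2"
      using coA coB coC e5 by (intro abs_prod_le; simp add: abs_le_iff)+
    ultimately show ?thesis by (simp add: abs_le_iff)
  qed
  also have "4 * e \<le> (8 * (e * N)) * cr B C SS"
  proof -
    have "(8 * (e * N)) * (1 / (2 * N)) \<le> (8 * (e * N)) * cr B C SS" using D e N by (intro mult_left_mono) auto
    then show ?thesis using N by simp
  qed
  finally have k: "\<alpha> \<le> (8 * (e * N)) * cr B C SS" .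
  have k2: "8 * (e * N) \<le> 1/2500" using eN by simp
  have sl: "-1/1000 \<le> slide s $ 1 \<and> slide s $ 1 \<le> 1 + 1/1000 \<and> \<bar>slide s $ 2\<bar> \<le> 1/1000" if "- ta \<le> s" "s \<le> tb" for s
    using coB coC e e5 by (intro slide_bounds[OF b S that _ k k2]) auto
  have ends: "- ta \<le> s \<and> s \<le> tb" if "s \<in> {- ta, 0, tb}" for s using that ta_pos tb_pos by auto
  have earpt: "-1/1000 \<le> z$1 \<and> z$1 \<le> 1 + 1/1000 \<and> - (1/1000) \<le> z$2 \<and> z$2 \<le> 1/1000"
    if "z \<in> convex hull {slide s, C, B}" "- ta \<le> s" "s \<le> tb" for z s
    by (rule hull_box[OF that(1)]) (use sl[OF that(2,3)] coB coC e5 in \<open>auto simp: abs_le_iff\<close>)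
  have aK: "area ?K \<le> 1/2 + 1/4000" using ar e5 by simp
  have gap: "Phi m p ?K + (1/144) powr (p - 1) * (ta * tb * (?v$1)\<^sup>2) / (576000 * (p + 1)) * (\<alpha> / 8) * (1/250000)
    \<le> tb / (ta + tb) * Phi m p (psi (- ta) ` ?K) + ta / (ta + tb) * Phi m p (psi tb ` ?K)"
  proof (rule Phi_gap_normalized[OF body p ta_pos tb_pos _ _ _ aK _ v1p vr])
    show "planar_convex_body (psi (- ta) ` ?K)" "planar_convex_body (psi tb ` ?K)"
      using ta_pos tb_pos by (simp_all only: psi_poly body_slide)
    show "T0 \<subseteq> psi s ` ?K" if "s \<in> {- ta, 0, tb}" for s
      using ends[OF that] PQ S unfolding T0_def by (simp only: psi_poly) (intro hull_mono, auto)
    show "\<bar>z$1 - 1/3\<bar> \<le> 2 \<and> \<bar>z$2 - 1/3\<bar> \<le> 2" if s: "s \<in> {- ta, 0, tb}" and z: "z \<in> psi s ` ?K" for s z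
    proof -
      have z': "z \<in> poly (slide s # C # mid @ [B])" using z ends[OF s] by (simp only: psi_poly)
      have "-1 \<le> z$1 \<and> z$1 \<le> 2 \<and> -1 \<le> z$2 \<and> z$2 \<le> 2"
      proof (rule hull_box[OF z'])
        fix r assume "r \<in> set (slide s # C # mid @ [B])"
        then consider "r = slide s" | "r \<in> ?R" by auto
        then show "-1 \<le> r$1 \<and> r$1 \<le> 2 \<and> -1 \<le> r$2 \<and> r$2 \<le> 2"
        proof cases
          case 1
          then show ?thesis using sl[of s] ends[OF s] by (auto simp: abs_le_iff)
        next
          case 2
          then show ?thesis using co[OF inK[of r]] e5 by auto
        qed
      qed
      then show ?thesis by (simp add: abs_le_iff)
    qed
    show "ear_height B C \<alpha> z \<le> 0" if "z \<in> ?K" "1/8 \<le> z$2" for z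
    proof (rule ccontr)
      assume "\<not> ?thesis"
      then have "psi 0 z \<in> convex hull {slide 0, C, B}" using that ta_pos tb_pos by (intro psi_in_ear) auto
      from earpt[OF this] show False using that ta_pos tb_pos by simp
    qed
    show "-1/1000 \<le> psi s x $ 1 \<and> psi s x $ 1 \<le> 1 + 1/1000 \<and> \<bar>psi s x $ 2\<bar> \<le> 1/1000"
      if "s \<in> {- ta, 0, tb}" "x \<in> ?K" "1/2 \<le> ear_height B C \<alpha> x" for s x
      using earpt[OF psi_in_ear[of s x]] ends[OF that(1)] that by (auto simp: abs_le_iff)
    show "0 \<le> \<alpha> / 8" using alpha_pos by simp
    show "\<alpha> / 8 \<le> measure (unif ?K) {x \<in> ?K. 1/2 \<le> ear_height B C \<alpha> x}" using aK by (intro ear_measure) simp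
  qed
  have "tb / (ta + tb) * Phi m p (psi (- ta) ` ?K) + ta / (ta + tb) * Phi m p (psi tb ` ?K) \<le> Phi m p T0 - 0"
    using Phi_ends_le[OF p] ta_pos tb_pos
    by (intro convex_comb_le) (simp_all only: psi_poly, simp_all)
  moreover have "(gapQ N / 432) powr p * e\<^sup>2 \<le>
      (1/144) powr (p - 1) * (ta * tb * (?v$1)\<^sup>2) / (576000 * (p + 1)) * (\<alpha> / 8) * (1/250000)"
  proof -
    have N4: "N ^ 4 \<ge> 1" using N by (rule one_le_power)
    have Q: "0 < gapQ N" "gapQ N \<le> 1" 
    proof -
      have "1 \<le> 4096 * N ^ 4 * 576000 * 8 * 250000" using N4 by linarith
      then show "0 < gapQ N" "gapQ N \<le> 1" unfolding gapQ_def by (auto simp: divide_le_eq_1)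
    qed
    \<comment> \<open>The two factors e: one from \<open>ta\<close>, the other from \<alpha> times
      \<open>tb\<close>.\<close>
    have "e / 8 * (e / (32 * N\<^sup>2)) * (1 / (4 * N))\<^sup>2 \<le> ta * (\<alpha> * tb) * (?v$1)\<^sup>2"
      using t at e N v1 alpha_pos ta_pos tb_pos by (intro mult_mono power_mono) auto
    moreover have "e / 8 * (e / (32 * N\<^sup>2)) * (1 / (4 * N))\<^sup>2 = e\<^sup>2 / (4096 * N ^ 4)"
      by (simp add: power2_eq_square eval_nat_numeral)
    ultimately have main: "e\<^sup>2 / (4096 * N ^ 4) \<le> ta * (\<alpha> * tb) * (?v$1)\<^sup>2" by simp
    have "(gapQ N / 432) powr p * e\<^sup>2 \<le> (1/144) powr (p - 1) * (gapQ N / (p + 1)) * e\<^sup>2"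
      by (intro mult_right_mono powr_constants[OF p Q]) simp
    also have "\<dots> = (1/144) powr (p - 1) / ((p + 1) * (576000 * 8 * 250000)) * (e\<^sup>2 / (4096 * N ^ 4))"
      by (simp add: gapQ_def)
    also have "\<dots> \<le> (1/144) powr (p - 1) / ((p + 1) * (576000 * 8 * 250000)) * (ta * (\<alpha> * tb) * (?v$1)\<^sup>2)"
      using p by (intro mult_left_mono[OF main]) auto
    also have "\<dots> = (1/144) powr (p - 1) * (ta * tb * (?v$1)\<^sup>2) / (576000 * (p + 1)) * (\<alpha> / 8) * (1/250000)"
      by (simp add: mult_ac)
    finally show ?thesis .
  qed
  ultimately show ?thesis using gap by linarith
qed

text \<open>The edge from \<open>A\<close> to \<open>C\<close>, long as seen from \<open>SS\<close>,
  belongs to the ears at \<open>A\<close> and at \<open>C\<close>. If one of them is thin, its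
  vertex is slid; a short slide is also settled by induction. Otherwise both ears are substantial,
  and together they bound \<alpha> times \<open>tb\<close> from below.\<close>

lemma Phi_normalized_step:
  fixes N e p c e0 :: real
  assumes st: "stab n c e0" "0 < c" and len: "length mid + 2 \<le> n" and e0: "e \<le> e0"
    and b: "bnd 1 (set (A # C # mid @ [B]))"
    and PQS: "PP \<in> set (C # mid @ [B])" "QQ \<in> set (C # mid @ [B])" "SS \<in> set (C # mid @ [B])"
    and ar: "2 * area (poly (A # C # mid @ [B])) = 1 + e"
    and N: "N \<ge> 1" and e: "0 < e" "e \<le> 1 / (20000 * N)" and p: "p \<ge> 1"
    and E: "1 / N \<le> cr A C SS" and D: "1 / (2 * N) \<le> cr B C SS"
    and y0: "A$2 \<le> 0" "B$2 \<le> 0" "C$2 \<le> 0"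
  shows "Phi m p (poly (A # C # mid @ [B])) \<le> Phi m p T0 - (min (c / 8) (gapQ N / 432)) powr p * e\<^sup>2"
proof -
  let ?K = "poly (A # C # mid @ [B])" and ?c = "min (c / 8) (gapQ N / 432)"
  have N0: "0 < 1 / N" "0 < 1 / (2 * N)" using N by auto
  have "SS \<noteq> C" "SS \<noteq> B" using E D N0 by auto
  then have S: "SS \<in> set mid" using PQS(3) by auto
  have "e * 1 \<le> e * N" using e N by (intro mult_left_mono) auto
  moreover have "e * N \<le> 1/20000" using e N by (simp add: field_simps)
  ultimately have e1: "e \<le> 1" by linarith
  have Q0: "0 < gapQ N" unfolding gapQ_def using N by simp
  have c8: "?c powr p * e\<^sup>2 \<le> c powr p * (e / 2)\<^sup>2 / 2"
  proof -
    have "?c powr p \<le> (c / 8) powr p" using st(2) Q0 p by (intro powr_mono2) auto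
    also have "\<dots> = (1/8) powr p * c powr p" using st(2) by (simp add: powr_mult[symmetric])
    also have "\<dots> \<le> (1/8) * c powr p" using powr_mono'[OF p, of "1/8"] by (intro mult_right_mono) auto
    finally have "?c powr p * e\<^sup>2 \<le> (1/8) * c powr p * e\<^sup>2" by (rule mult_right_mono) simp
    then show ?thesis by (simp add: power_divide)
  qed
  have half: "c powr p * (e / 2)\<^sup>2 / 2 \<le> c powr p * (e / 2)\<^sup>2" by simp
  note args = len p less_imp_le[OF e(1)] e0 e1 ar
  consider (small) "\<alpha> \<le> e / (16 * N)" | (smallC) "cr A C (hd mid) \<le> e / (16 * N)"
    | (short) "ta \<le> e / 8 \<or> tb \<le> e / 8"
    | (wide) "e / (16 * N) \<le> \<alpha>" "e / (16 * N) \<le> cr A C (hd mid)" "e / 8 \<le> ta" "e / 8 \<le> tb" by linarith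
  then show ?thesis
  proof cases
    case small
    have "(e / 8) * (1 / (2 * N)) \<le> (e / 8) * cr B C SS" using D e by (intro mult_left_mono) auto
    then have "\<alpha> \<le> (e / 8) * cr B C SS" using small by simp
    from Phi_small_ear[OF st(1) args b S this, of m] c8 half show ?thesis by linarith
  next
    case short
    from Phi_short_slide[OF st(1) args b short, of m] c8 show ?thesis by linarith
  next
    case wide
    \<comment> \<open>The separate lower bounds for \<alpha> and \<open>tb\<close> would give a
      product of order e^2 only. This relation bounds the denominator of \<open>tb\<close> by the
      two ears at the long edge, and the product becomes of order e.\<close>
    have eq: "cr A C SS * cr C (hd mid) B = cr A C (hd mid) * cr B C SS + \<alpha> * cr C (hd mid) SS"
      by (simp add: \<alpha>_def cr_def algebra_simps)
    have b1: "cr B C SS \<le> 1" "cr C (hd mid) SS \<le> 1"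
      using S hd_mid by (auto intro!: bndD[OF b])
    let ?F = "cr C (hd mid) B" and ?aC = "cr A C (hd mid)"
    have F: "0 < ?F" "0 < ?aC" using mid_pos[OF hd_mid] by auto
    have "(1 / N) * ?F \<le> cr A C SS * ?F" using E F by (intro mult_right_mono) auto
    also have "\<dots> \<le> ?aC * 1 + \<alpha> * 1"
      unfolding eq using b1 F alpha_pos by (intro add_mono mult_left_mono) auto
    finally have F2: "?F \<le> N * (?aC + \<alpha>)" using N by (simp add: field_simps)
    \<comment> \<open>The bound min(x, y) / 2 <= x y / (x + y) for the two ears.\<close>
    define mn where "mn = min \<alpha> ?aC"
    have "mn * (?aC + \<alpha>) \<le> 2 * (\<alpha> * ?aC)"
    proof -
      have "mn * ?aC \<le> \<alpha> * ?aC" "mn * \<alpha> \<le> ?aC * \<alpha>" using F alpha_pos by (auto simp: mn_def intro!: mult_right_mono)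
      then show ?thesis by (simp add: algebra_simps)
    qed
    moreover have "e / (16 * N) \<le> mn" using wide by (simp add: mn_def)
    then have "e / (16 * N) * (?aC + \<alpha>) \<le> mn * (?aC + \<alpha>)" using F alpha_pos by (intro mult_right_mono) auto
    ultimately have "e / (32 * N) * (?aC + \<alpha>) \<le> \<alpha> * ?aC" by simp
    moreover have "e / (32 * N\<^sup>2) * ?F \<le> e / (32 * N\<^sup>2) * (N * (?aC + \<alpha>))"
      using F2 e N by (intro mult_left_mono) auto
    moreover have "e / (32 * N\<^sup>2) * (N * (?aC + \<alpha>)) = e / (32 * N) * (?aC + \<alpha>)"
      using N by (simp add: power2_eq_square)
    ultimately have "e / (32 * N\<^sup>2) * ?F \<le> \<alpha> * ?aC" by linarith
    then have "e / (32 * N\<^sup>2) \<le> \<alpha> * tb" using F by (simp add: tb_def pos_le_divide_eq)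
    from Phi_wide_ear[OF b S PQS(1,2) ar N e p D y0 wide(3,4) this, of m]
    have "Phi m p ?K \<le> Phi m p T0 - (gapQ N / 432) powr p * e\<^sup>2" .
    moreover have "?c powr p * e\<^sup>2 \<le> (gapQ N / 432) powr p * e\<^sup>2"
      using st(2) Q0 p by (intro mult_right_mono powr_mono2) auto
    ultimately show ?thesis by linarith
  next
    case smallC
    have hS: "SS \<in> set (tl mid)"
    proof -
      have "SS \<noteq> hd mid"
      proof
        assume "SS = hd mid"
        then have "1 / N \<le> e / (16 * N)" using smallC E by simp
        then show False using e1 N by (simp add: field_simps)
      qed
      then show ?thesis using S mid by (cases mid) auto
    qed
    have mid_eq: "mid = hd mid # tl mid" using mid by simp
    \<comment> \<open>Here the ear at \<open>C\<close>, cut off by \<open>A\<close> and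
      \<open>hd mid\<close>, is thin; the list is rotated so that \<open>C\<close> becomes the
      sliding vertex.\<close>
    interpret C: ear C A "hd mid" "tl mid @ [B]"
    proof
      have "ccw ((C # mid @ [B]) @ [A])" using ccw_rotate[of "[A]" "C # mid @ [B]"] ccw by simp
      then show "ccw (C # hd mid # (tl mid @ [B]) @ [A])" using mid_eq by (metis append_Cons append_assoc)
    qed simp
    have seteq: "set (C # hd mid # (tl mid @ [B]) @ [A]) = set (A # C # mid @ [B])"
    proof -
      have "set mid = insert (hd mid) (set (tl mid))" using mid_eq by (metis list.set(2))
      then show ?thesis by auto
    qed
    have "C.\<alpha> = cr A C (hd mid)" by (simp add: C.\<alpha>_def cr_rotate[of C "hd mid" A])
    moreover have "1 / (2 * N) \<le> cr A (hd mid) SS"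
    proof -
      have "cr A C SS + cr C (hd mid) SS = cr A C (hd mid) + cr A (hd mid) SS" by (simp add: cr_def algebra_simps)
      moreover have "0 < cr C (hd mid) SS" by (rule hd_pos[OF hS])
      moreover have "e / (16 * N) \<le> 1 / (2 * N)" "1 / N = 1 / (2 * N) + 1 / (2 * N)" using e1 N by (auto simp: field_simps)
      ultimately show ?thesis using smallC E by linarith
    qed
    then have "(e / 8) * (1 / (2 * N)) \<le> (e / 8) * cr A (hd mid) SS" using e by (intro mult_left_mono) auto
    ultimately have q: "C.\<alpha> \<le> (e / 8) * cr A (hd mid) SS" using smallC by simp
    have "Phi m p (poly (C # hd mid # (tl mid @ [B]) @ [A])) \<le> Phi m p T0 - c powr p * (e / 2)\<^sup>2"
    proof (rule C.Phi_small_ear[OF st(1) _ p _ e0 e1 _ _ _ q])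
      show "length (tl mid @ [B]) + 2 \<le> n" using len mid by simp
      show "2 * area (poly (C # hd mid # (tl mid @ [B]) @ [A])) = 1 + e" unfolding seteq by (rule ar)
      show "bnd 1 (set (C # hd mid # (tl mid @ [B]) @ [A]))" unfolding seteq by (rule b)
    qed (use e hS in auto)
    then show ?thesis unfolding seteq using c8 half by linarith
  qed
qed

end

section \<open>Induction on the number of vertices\<close>

lemma ccw_map_affmap: "det A > 0 \<Longrightarrow> ccw xs \<Longrightarrow> ccw (map (affmap A u) xs)"
  by (induction xs) (auto simp: sorted_wrt_map cr_affmap sorted_wrt_iff_nth_less)

lemma ccw_reflect: "det A < 0 \<Longrightarrow> ccw xs \<Longrightarrow> ccw (map (affmap A u) (rev xs))"
proof (induction xs)
  case (Cons a xs)
  have "sorted_wrt (\<lambda>X Y. 0 < cr X Y (affmap A u a)) (map (affmap A u) (rev xs))"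
    unfolding sorted_wrt_map sorted_wrt_rev
  proof (rule sorted_wrt_mono_rel[of xs "\<lambda>X Y. 0 < cr a X Y"])
    show "sorted_wrt (\<lambda>X Y. 0 < cr a X Y) xs" using Cons.prems by simp
    fix X Y assume "0 < cr a X Y"
    then have "cr Y X a < 0" by (simp add: cr_swap[of Y X a] cr_rotate[of X Y a])
    then show "0 < cr (affmap A u Y) (affmap A u X) (affmap A u a)"
      using Cons.prems(1) by (simp add: cr_affmap mult_neg_neg)
  qed
  then show ?case using Cons by (simp add: ccw_append)
qed simp

lemma poly_map_affmap: "poly (map (affmap A u) xs) = affmap A u ` poly xs"
  by (simp add: affmap_hull)

text \<open>Rotate the list so that \<open>X\<close> comes first; the orientation of the triangle
  then forces \<open>Y\<close> before \<open>Z\<close>.\<close>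

lemma split_triangle:
  assumes ccw: "ccw ys" and XYZ: "X \<in> set ys" "Y \<in> set ys" "Z \<in> set ys" "cr X Y Z > 0"
  obtains us vs ws where "ccw (X # us @ Y # vs @ Z # ws)" "set (X # us @ Y # vs @ Z # ws) = set ys"
    "length (X # us @ Y # vs @ Z # ws) = length ys"
proof -
  obtain l1 l2 where ys: "ys = l1 @ X # l2" using XYZ(1) by (auto simp: in_set_conv_decomp)
  let ?L = "l2 @ l1"
  have c: "ccw (X # ?L)" using ccw_rotate[of l1 "X # l2"] ccw ys by simp
  have "Y \<noteq> X" "Z \<noteq> X" "Y \<noteq> Z" using XYZ(4) by auto
  then have "Y \<in> set ?L" "Z \<in> set ?L" using XYZ ys by auto
  obtain k1 k2 where L: "?L = k1 @ Y # k2" using split_list[OF \<open>Y \<in> set ?L\<close>] by blast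
  have "Z \<in> set k1 \<or> Z \<in> set k2" using \<open>Z \<in> set ?L\<close> \<open>Y \<noteq> Z\<close> unfolding L by auto
  moreover have "Z \<notin> set k1"
  proof
    assume "Z \<in> set k1"
    then have "0 < cr X Z Y" using c unfolding L by (auto simp: sorted_wrt_append)
    moreover have "cr X Z Y = - cr X Y Z" by (simp add: cr_def)
    ultimately show False using XYZ(4) by simp
  qed
  ultimately have "Z \<in> set k2" by blast
  then obtain k3 k4 where k2: "k2 = k3 @ Z # k4" using split_list by metis
  have s: "set (X # ?L) = set ys" "length (X # ?L) = length ys" by (auto simp: ys)
  show ?thesis using that[of k1 k3 k4] c s unfolding L k2 by simp
qed

text \<open>Pigeonhole over the three arcs between the vertices of the triangle, rotated so that a
  long arc comes first.\<close>

lemma split_triangle_long: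
  assumes ccw: "ccw ys" and XYZ: "X \<in> set ys" "Y \<in> set ys" "Z \<in> set ys" "cr X Y Z > 0" and len: "length ys > 3 + 3 * k"
  obtains P Q S us vs ws where "ccw (P # us @ Q # vs @ S # ws)" "set (P # us @ Q # vs @ S # ws) = set ys"
    "length (P # us @ Q # vs @ S # ws) = length ys" "length us > k" "{P, Q, S} = {X, Y, Z}" "cr P Q S = cr X Y Z"
proof -
  obtain us vs ws where c: "ccw (X # us @ Y # vs @ Z # ws)" and s: "set (X # us @ Y # vs @ Z # ws) = set ys"
    and l: "length (X # us @ Y # vs @ Z # ws) = length ys"
    using split_triangle[OF ccw XYZ] by blast
  have "length us + length vs + length ws + 3 = length ys" using l by simp
  then have "length us > k \<or> length vs > k \<or> length ws > k" using len by linarith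
  then consider "length us > k" | "length vs > k" | "length ws > k" by blast
  then show ?thesis
  proof cases
    case 1
    show ?thesis by (rule that[OF c s l 1]) simp_all
  next
    case 2
    have c': "ccw (Y # vs @ Z # ws @ X # us)" using ccw_rotate[of "X # us" "Y # vs @ Z # ws"] c by simp
    show ?thesis
    proof (rule that[OF c' _ _ 2])
      show "set (Y # vs @ Z # ws @ X # us) = set ys" unfolding s[symmetric] by auto
      show "length (Y # vs @ Z # ws @ X # us) = length ys" unfolding l[symmetric] by simp
    qed (auto simp: cr_rotate[of Y Z X])
  next
    case 3
    have c': "ccw (Z # ws @ X # us @ Y # vs)" using ccw_rotate[of "X # us @ Y # vs" "Z # ws"] c by simp
    show ?thesis
    proof (rule that[OF c' _ _ 3])
      show "set (Z # ws @ X # us @ Y # vs) = set ys" unfolding s[symmetric] by auto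
      show "length (Z # ws @ X # us @ Y # vs) = length ys" unfolding l[symmetric] by simp
    qed (auto simp: cr_rotate[of Z X Y] cr_rotate[of Y Z X])
  qed
qed

text \<open>By convexity of the chain, the signed fan triangles from \<open>S\<close> over its edges
  add up to at least the triangle over the chord, so some edge has at least the average
  share.\<close>

lemma fan_edge:
  assumes "ccw (x # l @ [y])"
  shows "\<exists>pre u w post. x # l @ [y] = pre @ u # w # post \<and> cr S x y \<le> (real (length l) + 1) * cr S u w"
  using assms
proof (induction l arbitrary: x)
  case Nil
  show ?case by (rule exI[of _ "[]"], rule exI[of _ x], rule exI[of _ y], rule exI[of _ "[]"]) simp
next
  case (Cons a l)
  have "0 < cr x a y" using Cons.prems by (simp add: sorted_wrt_append)
  moreover have "cr S x a + cr S a y = cr S x y + cr x a y" by (simp add: cr_def algebra_simps)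
  ultimately have sum: "cr S x y \<le> cr S x a + cr S a y" by linarith
  show ?case
  proof (cases "cr S x y \<le> (real (length (a # l)) + 1) * cr S x a")
    case True
    then show ?thesis by (intro exI[of _ "[]"] exI[of _ x] exI[of _ a] exI[of _ "l @ [y]"]) simp
  next
    case False
    obtain pre u w post where *: "a # l @ [y] = pre @ u # w # post" "cr S a y \<le> (real (length l) + 1) * cr S u w"
      using Cons.IH[of a] Cons.prems by auto
    let ?n = "real (length l) + 1"
    have "(?n + 1) * cr S x y \<le> (?n + 1) * cr S x a + (?n + 1) * cr S a y"
      using mult_left_mono[OF sum, of "?n + 1"] by (simp add: distrib_left)
    moreover have "(?n + 1) * cr S x a < cr S x y" using False by (simp add: algebra_simps)
    ultimately have "?n * cr S x y \<le> (?n + 1) * cr S a y" by (simp add: algebra_simps)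
    also have "\<dots> \<le> (?n + 1) * (?n * cr S u w)" using *(2) by (intro mult_left_mono) auto
    finally have "?n * cr S x y \<le> ?n * ((?n + 1) * cr S u w)" by (simp add: mult_ac)
    then have "cr S x y \<le> (?n + 1) * cr S u w" by (subst (asm) mult_le_cancel_left_pos) auto
    then show ?thesis using *(1)
      by (intro exI[of _ "x # pre"] exI[of _ u] exI[of _ w] exI[of _ post]) (simp add: algebra_simps)
  qed
qed

text \<open>The arc from \<open>PP\<close> to \<open>QQ\<close> runs on or below the bottom side,
  and one of its edges has a share of at least 1 / N as seen from \<open>SS\<close>. Since the arc
  has inner vertices, an end of this edge differs from \<open>PP\<close> and \<open>QQ\<close>; that
  end is slid.\<close>

lemma Phi_normalized_list:
  fixes N e p c e0 :: real
  assumes st: "stab n c e0" "0 < c" and czs: "ccw (PP # us @ QQ # vs @ SS # ws)" and us: "us \<noteq> []"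
    and len: "length (PP # us @ QQ # vs @ SS # ws) \<le> Suc n" and e0: "e \<le> e0"
    and b: "bnd 1 (set (PP # us @ QQ # vs @ SS # ws))"
    and ar: "2 * area (poly (PP # us @ QQ # vs @ SS # ws)) = 1 + e"
    and N: "N = real (Suc n)" and e: "0 < e" "e \<le> 1 / (20000 * N)" and p: "p \<ge> 1"
  shows "Phi m p (poly (PP # us @ QQ # vs @ SS # ws)) \<le> Phi m p T0 - (min (c / 8) (gapQ N / 432)) powr p * e\<^sup>2"
proof -
  let ?zs = "PP # us @ QQ # vs @ SS # ws" and ?ch = "PP # us @ [QQ]" and ?rest = "vs @ SS # ws"
  have N1: "N \<ge> 1" using N by simp
  have zs: "?zs = ?ch @ ?rest" by simp
  have cch: "ccw ?ch" using czs unfolding zs ccw_append by blast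
  have y0: "w$2 \<le> 0" if "w \<in> set ?ch" for w
  proof -
    have "0 < cr PP w QQ" if "w \<in> set us" using that cch by (auto simp: sorted_wrt_append)
    then show ?thesis using that by (auto simp: cr_def)
  qed
  have y1: "-1 \<le> w$2" if "w \<in> set ?ch" for w
    using that bndD[OF b, of QQ PP w] by (auto simp: cr_def)
  obtain pre x y post where ch: "?ch = pre @ x # y # post" and le: "cr SS PP QQ \<le> (real (length us) + 1) * cr SS x y"
    using fan_edge[OF cch] by blast
  have ccwS: "0 < cr SS u w" if "?ch = l1 @ u # l2 @ w # l3" for u w l1 l2 l3
  proof -
    have "ccw (l1 @ u # l2 @ w # l3 @ ?rest)" using czs unfolding zs that by simp
    then have "0 < cr u w SS" by (simp add: ccw_append sorted_wrt_append)
    then show ?thesis by (simp add: cr_rotate[of u w SS])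
  qed
  have sxy: "1 / N \<le> cr SS x y"
  proof -
    have pos: "0 < cr SS x y" using ccwS[of pre x "[]" y post] ch by simp
    have "real (length us) + 1 \<le> N" using len N by simp
    then have "(real (length us) + 1) * cr SS x y \<le> N * cr SS x y" using pos by (intro mult_right_mono) auto
    moreover have "cr SS PP QQ = 1" by (simp add: cr_def)
    ultimately have "1 \<le> N * cr SS x y" using le by linarith
    then show ?thesis using N1 by (simp add: pos_divide_le_eq mult.commute)
  qed
  \<comment> \<open>Seen from \<open>SS\<close>, the base from u to w is at least half as large as
    either of its two edges, because the heights on the arc lie between -1 and 0 and the factors in
    the identity therefore between 1 and 2.\<close>
  have wide: "1 / (2 * N) \<le> cr SS u w"
    if d: "?ch = l1 @ u # a # w # l3" and "1 / N \<le> cr SS u a \<or> 1 / N \<le> cr SS a w" for u a w l1 l3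
  proof -
    have mem: "u \<in> set ?ch" "a \<in> set ?ch" "w \<in> set ?ch" unfolding d by auto
    have pos: "0 < cr SS u a" "0 < cr SS a w" "0 < cr SS u w"
      using ccwS[of l1 u "[]" a "w # l3"] ccwS[of "l1 @ [u]" a "[]" w l3] ccwS[of l1 u "[a]" w l3] d by auto
    have "cr SS u w * (1 - a$2) = cr SS u a * (1 - w$2) + cr SS a w * (1 - u$2)"
      by (simp add: cr_def algebra_simps)
    moreover have "cr SS u a * 1 \<le> cr SS u a * (1 - w$2)" "cr SS a w * 1 \<le> cr SS a w * (1 - u$2)"
      using pos y0 mem by (auto intro!: mult_left_mono simp del: mult_1_right)
    moreover have "cr SS u w * (1 - a$2) \<le> cr SS u w * 2" using pos y1[OF mem(2)] by (intro mult_left_mono) auto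
    ultimately have "1 / N \<le> cr SS u w * 2" using that(2) pos by linarith
    then show ?thesis by (simp add: field_simps)
  qed
  have PQ: "PP \<in> set ?ch" "QQ \<in> set ?ch" by auto
  show ?thesis
  proof (cases "pre = []")
    case False
    then obtain pre' B where pre: "pre = pre' @ [B]" by (metis rev_exhaust)
    define mid where "mid = post @ ?rest @ pre'"
    have zs': "?zs = (pre' @ [B]) @ (x # y # post @ ?rest)" unfolding zs ch pre by simp
    have ccw': "ccw (x # y # mid @ [B])"
      using ccw_rotate[of "pre' @ [B]" "x # y # post @ ?rest"] czs unfolding zs' by (simp add: mid_def)
    have seteq: "set (x # y # mid @ [B]) = set ?zs" unfolding zs' by (auto simp: mid_def)
    interpret ear x B y mid by unfold_locales (use ccw' in \<open>auto simp: mid_def\<close>)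
    have PPm: "PP \<in> set (y # mid @ [B])"
    proof -
      have "hd ?ch = hd pre" unfolding ch using False by simp
      then have "PP \<in> set pre" using False by simp
      then show ?thesis by (auto simp: mid_def pre)
    qed
    have QQm: "QQ \<in> set (y # mid @ [B])"
    proof -
      have "last ?ch = last (y # post)" unfolding ch by simp
      then have "QQ \<in> set (y # post)" using last_in_set[of "y # post"] by simp
      then show ?thesis by (auto simp: mid_def)
    qed
    have mem: "x \<in> set ?ch" "y \<in> set ?ch" "B \<in> set ?ch" unfolding ch pre by auto
    have "length (x # y # mid @ [B]) = length ?zs" unfolding zs' by (simp add: mid_def)
    then have "length mid + 2 \<le> n" using len by simp
    moreover have "1 / N \<le> cr x y SS" using sxy by (simp add: cr_rotate[of x y SS])
    moreover have "1 / (2 * N) \<le> cr B y SS"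
      using wide[of pre' B x y post] sxy by (simp add: ch pre cr_rotate[of B y SS])
    ultimately have "Phi m p (poly (x # y # mid @ [B])) \<le> Phi m p T0 - (min (c / 8) (gapQ N / 432)) powr p * e\<^sup>2"
      by (intro Phi_normalized_step[OF st _ e0 _ PPm QQm _ _ N1 e p] y0 mem) (simp_all only: seteq b ar, simp_all add: mid_def)
    then show ?thesis unfolding seteq .
  next
    case True
    then have x: "x = PP" and us': "us @ [QQ] = y # post" using ch by auto
    have "post \<noteq> []" using us us' by (cases us) auto
    then obtain B post' where post: "post = B # post'" by (cases post) auto
    \<comment> \<open>The long edge starts at \<open>PP\<close>, so its other end \<open>y\<close>
      must slide. This reflection exchanges \<open>PP\<close> and \<open>QQ\<close> and fixes
      \<open>SS\<close>; after it and a reversal of the list, the long edge again leads from the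
      sliding vertex to its successor.\<close>
    define R :: "real^2^2" where "R = vector [vector [-1, -1], vector [0, 1]]"
    have R: "R$1$1 = -1" "R$1$2 = -1" "R$2$1 = 0" "R$2$2 = 1" by (simp_all add: R_def)
    define \<rho> where "\<rho> = affmap R QQ"
    have dR: "det R = -1" by (simp add: det_2 R)
    have \<rho>: "\<rho> z $ 1 = 1 - z$1 - z$2" "\<rho> z $ 2 = z$2" for z by (simp_all add: \<rho>_def affmap_nth R)
    have \<rho>P: "\<rho> PP = QQ" "\<rho> QQ = PP" "\<rho> SS = SS" by (simp_all add: vec_eq_iff forall_2 \<rho>)
    have cr\<rho>: "cr (\<rho> X) (\<rho> Y) (\<rho> Z) = cr Y X Z" for X Y Z
      by (simp add: \<rho>_def cr_affmap dR cr_swap[of Y X])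
    define mid where "mid = map \<rho> (rev ?rest @ rev post')"
    have zs': "?zs = [PP, y, B] @ post' @ ?rest" unfolding zs ch True x post by simp
    have "ccw (map \<rho> (rev ?zs))" unfolding \<rho>_def using czs dR by (intro ccw_reflect) simp_all
    then have "ccw ((mid @ [\<rho> B]) @ [\<rho> y, QQ])" unfolding zs' by (simp add: mid_def \<rho>P)
    then have ccw': "ccw (\<rho> y # QQ # mid @ [\<rho> B])" using ccw_rotate[of "mid @ [\<rho> B]" "[\<rho> y, QQ]"] by simp
    have seteq: "set (\<rho> y # QQ # mid @ [\<rho> B]) = \<rho> ` set ?zs" unfolding zs' by (auto simp: mid_def \<rho>P)
    interpret ear "\<rho> y" "\<rho> B" QQ mid by unfold_locales (use ccw' in \<open>auto simp: mid_def\<close>)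
    have PPm: "PP \<in> set (QQ # mid @ [\<rho> B])"
    proof -
      have "last ?ch = last (B # post')" unfolding ch post by simp
      then have "QQ \<in> set (B # post')" using last_in_set[of "B # post'"] by simp
      then have "\<rho> QQ \<in> \<rho> ` set (B # post')" by blast
      then show ?thesis by (auto simp: mid_def \<rho>P)
    qed
    have "\<rho> SS \<in> \<rho> ` set ?rest" by simp
    then have SSm: "SS \<in> set (QQ # mid @ [\<rho> B])" unfolding \<rho>P by (auto simp: mid_def)
    have b': "bnd 1 (\<rho> ` set ?zs)" using b by (auto simp: bnd_def cr\<rho>)
    have inv: "invertible R" by (simp add: invertible_det_nz dR)
    have body: "planar_convex_body (poly ?zs)" by (rule ccw_body[OF czs]) (use us in \<open>cases us; simp\<close>)
    have poly: "convex hull (\<rho> ` set ?zs) = \<rho> ` poly ?zs"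
      unfolding \<rho>_def by (rule affmap_hull[symmetric])
    have ar': "2 * area (convex hull (\<rho> ` set ?zs)) = 1 + e"
      unfolding poly unfolding \<rho>_def area_affmap[OF inv body] dR using ar by simp
    have mem: "y \<in> set ?ch" "B \<in> set ?ch" unfolding ch post by auto
    have "length (\<rho> y # QQ # mid @ [\<rho> B]) = length ?zs" unfolding zs' by (simp add: mid_def)
    then have "length mid + 2 \<le> n" using len by simp
    moreover have "1 / N \<le> cr (\<rho> y) QQ SS"
    proof -
      have "cr (\<rho> y) QQ SS = cr (\<rho> y) (\<rho> PP) (\<rho> SS)" by (simp add: \<rho>P)
      also have "\<dots> = cr SS PP y" unfolding cr\<rho> by (simp add: cr_rotate[of PP y SS])
      finally show ?thesis using sxy x by simp
    qed
    moreover have "1 / (2 * N) \<le> cr (\<rho> B) QQ SS"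
    proof -
      have "cr (\<rho> B) QQ SS = cr (\<rho> B) (\<rho> PP) (\<rho> SS)" by (simp add: \<rho>P)
      also have "\<dots> = cr SS PP B" unfolding cr\<rho> by (simp add: cr_rotate[of PP B SS])
      finally show ?thesis using wide[of "[]" PP y B post'] sxy by (simp add: ch True x post)
    qed
    ultimately have "Phi m p (poly (\<rho> y # QQ # mid @ [\<rho> B])) \<le> Phi m p T0 - (min (c / 8) (gapQ N / 432)) powr p * e\<^sup>2"
      using y0[OF mem(1)] y0[OF mem(2)]
      by (intro Phi_normalized_step[OF st _ e0 _ PPm _ SSm _ N1 e p]) (simp_all only: seteq b' ar', simp_all add: \<rho>)
    then show ?thesis unfolding seteq poly unfolding \<rho>_def Phi_affmap[OF inv body p] .
  qed
qed

lemma normalize_polygon: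
  assumes ccw: "ccw ys" and XYZ: "X \<in> set ys" "Y \<in> set ys" "Z \<in> set ys" "cr X Y Z = \<mu>" and \<mu>: "\<mu> > 0"
    and b: "bnd \<mu> (set ys)" and ar: "2 * area (poly ys) = (1 + e) * \<mu>"
  obtains A u where "invertible A" "ccw (map (affmap A u) ys)" "affmap A u X = PP" "affmap A u Y = QQ" "affmap A u Z = SS"
    "bnd 1 (affmap A u ` set ys)" "2 * area (poly (map (affmap A u) ys)) = 1 + e" "det A > 0"
    "\<And>m p. p \<ge> 1 \<Longrightarrow> Phi m p (poly (map (affmap A u) ys)) = Phi m p (poly ys)"
proof -
  have c: "cr X Y Z > 0" using XYZ \<mu> by simp
  have "length ys \<ge> 3"
  proof -
    obtain us vs ws where "length (X # us @ Y # vs @ Z # ws) = length ys" using split_triangle[OF ccw XYZ(1-3) c] by blast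
    then show ?thesis by auto
  qed
  then have body: "planar_convex_body (poly ys)" by (rule ccw_body[OF ccw])
  obtain B where B: "invertible B" "det B = cr X Y Z" "affmap B X PP = X" "affmap B X QQ = Y" "affmap B X SS = Z"
    by (rule affine_frame[OF c])
  have "\<exists>A u. invertible A \<and> det A = 1 / det B \<and> (\<forall>x. affmap A u (affmap B X x) = x)"
  proof (rule affmap_inverse[OF B(1), of X])
    fix A u assume "invertible A" "det A = 1 / det B" "\<And>x. affmap A u (affmap B X x) = x"
    then show ?thesis by blast
  qed
  then obtain A u where A: "invertible A" "det A = 1 / det B" "\<And>x. affmap A u (affmap B X x) = x" by blast
  have dA: "det A = 1 / \<mu>" using A B XYZ by simp
  have 1: "ccw (map (affmap A u) ys)" using dA \<mu> by (intro ccw_map_affmap ccw) simp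
  have 2: "affmap A u X = PP" "affmap A u Y = QQ" "affmap A u Z = SS"
    using A(3)[of PP] A(3)[of QQ] A(3)[of SS] unfolding B(3-5) .
  have 3: "bnd 1 (affmap A u ` set ys)" using b \<mu> by (auto simp: bnd_def cr_affmap dA)
  have 4: "2 * area (poly (map (affmap A u) ys)) = 1 + e"
    unfolding poly_map_affmap area_affmap[OF A(1) body] dA using ar \<mu> by (simp add: field_simps)
  have 5: "det A > 0" using dA \<mu> by simp
  have 6: "Phi m p (poly (map (affmap A u) ys)) = Phi m p (poly ys)" if "p \<ge> 1" for m p
    unfolding poly_map_affmap by (rule Phi_affmap[OF A(1) body that])
  show ?thesis by (rule that[OF A(1) 1 2 3 4 5 6])
qed

lemma exact_max:
  assumes p: "p \<ge> 1" and e: "e > 0" and xs: "ccw xs" "length xs \<ge> 3" and b: "bnd \<mu> (set xs)" and ar: "(1 + e) * \<mu> \<le> 2 * area (poly xs)"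
  obtains ys X Y Z where "ccw ys" "3 \<le> length ys" "length ys \<le> length xs" "X \<in> set ys" "Y \<in> set ys" "Z \<in> set ys"
    "cr X Y Z > 0" "bnd (cr X Y Z) (set ys)" "2 * area (poly ys) = (1 + e) * cr X Y Z" "Phi m p (poly xs) \<le> Phi m p (poly ys)"
proof -
  have "xs \<noteq> []" using xs by auto
  then have "mxc xs \<le> \<mu>" using b by (simp add: mxc_le_iff)
  then have "(1 + e) * mxc xs \<le> 2 * area (poly xs)" using ar mult_left_mono[of "mxc xs" \<mu> "1 + e"] e by linarith
  from exact_ratio[OF p e xs this, of m] obtain ys where ys: "ccw ys" "3 \<le> length ys" "length ys \<le> length xs"
    "2 * area (poly ys) = (1 + e) * mxc ys" "Phi m p (poly xs) \<le> Phi m p (poly ys)" by blast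
  have ne: "ys \<noteq> []" using ys by auto
  obtain X Y Z where XYZ: "X \<in> set ys" "Y \<in> set ys" "Z \<in> set ys" "cr X Y Z = mxc ys"
    using mxc_attained[OF ne] by blast
  show ?thesis
    by (rule that[OF ys(1-3) XYZ(1-3)]) (use mxc_pos[OF ys(1,2)] bnd_mxc[OF ne] ys XYZ in simp_all)
qed

text \<open>A triangle has ratio 1, so the hypotheses leave only e = 0.\<close>

lemma stab_3: "stab 3 1 1"
  unfolding stab_def
proof (intro allI impI)
  fix m p xs \<mu> e
  assume ccw: "ccw xs" and len: "3 \<le> length xs" "length xs \<le> 3" and p: "1 \<le> (p::real)" and e: "0 \<le> e" and b: "bnd \<mu> (set xs)"
    and ar: "(1 + e) * \<mu> \<le> 2 * area (poly xs)"
  obtain X Y Z where xs: "xs = [X, Y, Z]" "cr X Y Z > 0" using ccw_3[OF ccw] len by auto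
  have "cr X Y Z \<le> \<mu>" using b by (rule bndD) (auto simp: xs)
  moreover have "(1 + e) * \<mu> \<le> cr X Y Z" using ar xs by (simp add: area_triangle)
  ultimately have "(1 + e) * \<mu> \<le> 1 * \<mu>" "\<mu> > 0" using xs(2) by linarith+
  then have "e = 0" using e by (simp only: mult_le_cancel_right_pos)
  then show "Phi m p (poly xs) \<le> Phi m p T0 - 1 powr p * e\<^sup>2" using Phi_triangle[OF xs(2) p, of m] xs(1) by simp
qed

text \<open>If the polygon from \<open>exact_max\<close> still has more than n vertices, some arc
  beside its maximal triangle has an inner vertex to slide. The constant is divided by at least 8
  and the range of e depends on N, so this induction gives nothing uniform in the number of
  vertices.\<close>

lemma stab_step:
  assumes st: "stab n c e0" "0 < c" "0 < e0" and n: "3 \<le> n"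
  shows "\<exists>c'>0. \<exists>e0'>0. stab (Suc n) c' e0'"
proof -
  define N where "N = real (Suc n)"
  define c' where "c' = min (c / 8) (gapQ N / 432)"
  define e0' where "e0' = min e0 (1 / (20000 * N))"
  have N: "N \<ge> 1" by (simp add: N_def)
  have c': "0 < c'" using st(2) N by (simp add: c'_def gapQ_def)
  have e0': "0 < e0'" using st(3) N by (simp add: e0'_def)
  have "stab (Suc n) c' e0'"
    unfolding stab_def
  proof (intro allI impI)
    fix m p xs \<mu> e
    assume ccw: "ccw xs" and len: "3 \<le> length xs" "length xs \<le> Suc n" and p: "1 \<le> (p::real)" and e: "0 \<le> e" "e \<le> e0'"
      and b: "bnd \<mu> (set xs)" and ar: "(1 + e) * \<mu> \<le> 2 * area (poly xs)"
    show "Phi m p (poly xs) \<le> Phi m p T0 - c' powr p * e\<^sup>2"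
    proof (cases "e = 0")
      case True
      then show ?thesis using Phi_le_triangle[OF p ccw len(1), of m] by simp
    next
      case False
      then have e': "e > 0" using e by simp
      have ee: "e \<le> e0" "e \<le> 1 / (20000 * N)" using e(2) by (auto simp: e0'_def)
      obtain ys X Y Z where ys: "ccw ys" "3 \<le> length ys" "length ys \<le> length xs" and XYZ: "X \<in> set ys" "Y \<in> set ys" "Z \<in> set ys"
        and pos: "cr X Y Z > 0" and bY: "bnd (cr X Y Z) (set ys)" and ay: "2 * area (poly ys) = (1 + e) * cr X Y Z"
        and Pxy: "Phi m p (poly xs) \<le> Phi m p (poly ys)"
        by (rule exact_max[OF p e' ccw len(1) b ar])
      have "Phi m p (poly ys) \<le> Phi m p T0 - c' powr p * e\<^sup>2"
      proof (cases "length ys \<le> n")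
        case True
        have "Phi m p (poly ys) \<le> Phi m p T0 - c powr p * e\<^sup>2"
          by (rule stabD[OF st(1) ys(1,2) True p e(1) ee(1) bY]) (simp add: ay)
        moreover have "c' powr p * e\<^sup>2 \<le> c powr p * e\<^sup>2"
          using c' st(2) p by (intro mult_right_mono powr_mono2) (auto simp: c'_def)
        ultimately show ?thesis by linarith
      next
        case False
        then have "length ys > 3 + 3 * 0" using n by simp
        then obtain P Q S us vs ws where sp: "ccw (P # us @ Q # vs @ S # ws)" "set (P # us @ Q # vs @ S # ws) = set ys"
          "length (P # us @ Q # vs @ S # ws) = length ys" "length us > 0" "{P, Q, S} = {X, Y, Z}" "cr P Q S = cr X Y Z"
          by (rule split_triangle_long[OF ys(1) XYZ pos])
        let ?zs = "P # us @ Q # vs @ S # ws"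
        obtain A u where A: "invertible A" "ccw (map (affmap A u) ?zs)" "affmap A u P = PP" "affmap A u Q = QQ" "affmap A u S = SS"
          "bnd 1 (affmap A u ` set ?zs)" "2 * area (poly (map (affmap A u) ?zs)) = 1 + e" "det A > 0"
          "\<And>m p. p \<ge> 1 \<Longrightarrow> Phi m p (poly (map (affmap A u) ?zs)) = Phi m p (poly ?zs)"
          by (rule normalize_polygon[OF sp(1) _ _ _ sp(6) pos _ _])
            (use bY ay in \<open>simp_all only: sp(2)\<close>, use sp(2) in auto)
        have mz: "map (affmap A u) ?zs = PP # map (affmap A u) us @ QQ # map (affmap A u) vs @ SS # map (affmap A u) ws"
          using A(3-5) by simp
        have "Phi m p (poly (map (affmap A u) ?zs)) \<le> Phi m p T0 - c' powr p * e\<^sup>2"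
          unfolding c'_def mz
        proof (rule Phi_normalized_list[OF st(1,2) _ _ _ ee(1) _ _ N_def e' ee(2) p])
          show "ccw (PP # map (affmap A u) us @ QQ # map (affmap A u) vs @ SS # map (affmap A u) ws)" using A(2) unfolding mz .
          show "map (affmap A u) us \<noteq> []" using sp(4) by simp
          show "length (PP # map (affmap A u) us @ QQ # map (affmap A u) vs @ SS # map (affmap A u) ws) \<le> Suc n"
            using sp(3) ys(3) len(2) by simp
          show "bnd 1 (set (PP # map (affmap A u) us @ QQ # map (affmap A u) vs @ SS # map (affmap A u) ws))"
            using A(6) unfolding mz[symmetric] set_map .
          show "2 * area (poly (PP # map (affmap A u) us @ QQ # map (affmap A u) vs @ SS # map (affmap A u) ws)) = 1 + e"
            using A(7) unfolding mz .
        qed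
        then show ?thesis unfolding A(9)[OF p] sp(2) .
      qed
      then show ?thesis using Pxy by linarith
    qed
  qed
  then show ?thesis using c' e0' by blast
qed

lemma stab_exists:
  assumes "3 \<le> n"
  shows "\<exists>c>0. \<exists>e0>0. stab n c e0"
  using assms
proof (induction n rule: dec_induct)
  case base
  show ?case using stab_3 by (meson zero_less_one)
next
  case (step n)
  then show ?case using stab_step by blast
qed

section \<open>Uniformity in the number of vertices\<close>

text \<open>The vertices lie in the triangle cut out by the parallels to the sides of \<open>T0\<close> through its
  vertices. This weak form of maximality of \<open>T0\<close> survives sliding any vertex that is neither a vertex
  of \<open>T0\<close> nor adjacent to one.\<close>
definition crit :: "real^2 \<Rightarrow> bool" where
  "crit z \<longleftrightarrow> z$1 \<le> 1 \<and> z$2 \<le> 1 \<and> 0 \<le> z$1 + z$2"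

text \<open>Seen from \<open>V\<close>, the moving vertex stays in the angle spanned by
  \<open>C\<close> and \<open>B\<close>, and a half-plane with \<open>V\<close> on its boundary that
  contains \<open>B\<close> and \<open>C\<close> contains this angle.\<close>

lemma (in ear) slide_halfplane:
  assumes V: "V \<in> set mid" and t: "- ta \<le> t" "t \<le> tb"
    and g: "k1 * V$1 + k2 * V$2 + k0 = 0" "0 \<le> k1 * C$1 + k2 * C$2 + k0" "0 \<le> k1 * B$1 + k2 * B$2 + k0"
  shows "0 \<le> k1 * slide t $ 1 + k2 * slide t $ 2 + k0"
proof -
  let ?g = "\<lambda>z::real^2. k1 * z$1 + k2 * z$2 + k0"
  have "cr C V B * ?g (slide t) = cr (slide t) V B * ?g C - cr (slide t) C B * ?g V + cr (slide t) C V * ?g B"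
    by (simp add: cr_def algebra_simps)
  also have "\<dots> = cr (slide t) V B * ?g C + cr (slide t) C V * ?g B" using g(1) by simp
  also have "\<dots> \<ge> 0" using slide_B(1)[OF t(1) V] slide_C(1)[OF t(2) V] g by simp
  finally show ?thesis using mid_pos[OF V] by (simp add: zero_le_mult_iff)
qed

lemma (in ear) slide_crit:
  assumes V: "PP \<in> set mid" "QQ \<in> set mid" "SS \<in> set mid" and t: "- ta \<le> t" "t \<le> tb" and BC: "crit B" "crit C"
  shows "crit (slide t)"
  using slide_halfplane[OF V(1) t, of 1 1 0] slide_halfplane[OF V(2) t, of "-1" 0 1] slide_halfplane[OF V(3) t, of 0 "-1" 1] BC
  by (simp add: crit_def)

text \<open>With more than 9 = 3 + 3 * 2 vertices, one of the arcs between the vertices of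
  \<open>T0\<close> has at least three inner ones. Sliding the second of them neither moves nor
  removes a vertex of \<open>T0\<close>, and an end of the slide has fewer vertices.\<close>

lemma reduce_polygon:
  assumes p: "p \<ge> 1" and "ccw zs" "PP \<in> set zs" "QQ \<in> set zs" "SS \<in> set zs" "\<And>z. z \<in> set zs \<Longrightarrow> crit z"
  shows "\<exists>ys. ccw ys \<and> 3 \<le> length ys \<and> length ys \<le> 9 \<and> PP \<in> set ys \<and> QQ \<in> set ys \<and> SS \<in> set ys
    \<and> (\<forall>z\<in>set ys. crit z) \<and> area (poly ys) = area (poly zs) \<and> Phi m p (poly zs) \<le> Phi m p (poly ys)"
  using assms(2-)
proof (induction "length zs" arbitrary: zs rule: less_induct)
  case less
  note ccw_zs = less.prems(1) and mem = less.prems(2-4) and cz = less.prems(5)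
  have pos: "cr PP QQ SS > 0" by (simp add: cr_def)
  have l3: "3 \<le> length zs"
  proof -
    obtain us vs ws where "length (PP # us @ QQ # vs @ SS # ws) = length zs"
      by (rule split_triangle[OF ccw_zs mem pos])
    then show ?thesis by simp
  qed
  show ?case
  proof (cases "length zs \<le> 9")
    case True
    then show ?thesis using less.prems l3 by blast
  next
    case False
    then have "length zs > 3 + 3 * 2" by simp
    then obtain P Q S us vs ws where sp: "ccw (P # us @ Q # vs @ S # ws)" "set (P # us @ Q # vs @ S # ws) = set zs"
      "length (P # us @ Q # vs @ S # ws) = length zs" "length us > 2" "{P, Q, S} = {PP, QQ, SS}" "cr P Q S = cr PP QQ SS"
      by (rule split_triangle_long[OF ccw_zs mem pos])
    obtain B A C us' where us: "us = B # A # C # us'"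
      using sp(4) by (cases us; cases "tl us"; cases "tl (tl us)") auto
    define mid where "mid = us' @ Q # vs @ S # ws @ [P]"
    have ccw': "ccw (A # C # mid @ [B])"
      using ccw_rotate[of "[P, B]" "A # C # us' @ Q # vs @ S # ws"] sp(1) by (simp add: us mid_def)
    have seteq: "set (A # C # mid @ [B]) = set zs" unfolding sp(2)[symmetric] by (auto simp: us mid_def)
    have leneq: "length (A # C # mid @ [B]) = length zs" unfolding sp(3)[symmetric] by (simp add: us mid_def)
    interpret ear A B C mid by unfold_locales (use ccw' in \<open>auto simp: mid_def\<close>)
    have "{P, Q, S} \<subseteq> set mid" by (auto simp: mid_def)
    then have V: "PP \<in> set mid" "QQ \<in> set mid" "SS \<in> set mid" unfolding sp(5) by auto
    have cABC: "crit z" if "z \<in> set (A # C # mid @ [B])" for z using that unfolding seteq by (rule cz)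
    have csl: "crit (slide t)" if "- ta \<le> t" "t \<le> tb" for t
      using cABC by (intro slide_crit[OF V that]) auto
    let ?goal = "\<lambda>L. \<exists>ys. ccw ys \<and> 3 \<le> length ys \<and> length ys \<le> 9 \<and> PP \<in> set ys \<and> QQ \<in> set ys \<and> SS \<in> set ys
      \<and> (\<forall>z\<in>set ys. crit z) \<and> area (poly ys) = area (poly L) \<and> Phi m p (poly L) \<le> Phi m p (poly ys)"
    have gb: "?goal (slide tb # mid @ [B])"
    proof (rule less.hyps[OF _ ccw_tb])
      show "length (slide tb # mid @ [B]) < length zs" unfolding leneq[symmetric] by simp
      show "crit z" if "z \<in> set (slide tb # mid @ [B])" for z
        using that csl[of tb] cABC ta_pos tb_pos by auto
    qed (use V in auto)
    have ga: "?goal (slide (- ta) # C # mid)"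
    proof (rule less.hyps[OF _ ccw_ta])
      show "length (slide (- ta) # C # mid) < length zs" unfolding leneq[symmetric] by simp
      show "crit z" if "z \<in> set (slide (- ta) # C # mid)" for z
        using that csl[of "- ta"] cABC ta_pos tb_pos by auto
    qed (use V in auto)
    have ar: "area (poly (slide tb # C # mid @ [B])) = area (poly zs)" "area (poly (slide (- ta) # C # mid @ [B])) = area (poly zs)"
      using ta_pos tb_pos area_slide[of tb] area_slide[of "- ta"] unfolding seteq by auto
    from Phi_slide_max[OF p ta_pos order_refl tb_pos order_refl, of m] show ?thesis
      unfolding seteq
    proof
      assume "Phi m p (poly zs) \<le> Phi m p (poly (slide (- ta) # C # mid @ [B]))"
      then show ?thesis using ga unfolding poly_ta ar by (meson order_trans)
    next
      assume "Phi m p (poly zs) \<le> Phi m p (poly (slide tb # C # mid @ [B]))"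
      then show ?thesis using gb unfolding poly_tb ar by (meson order_trans)
    qed
  qed
qed

text \<open>The vertices of the region around \<open>T0\<close> that is left by \<open>crit\<close>
  and by the bound e for the caps.\<close>

definition hexagon :: "real \<Rightarrow> (real^2) set" where
  "hexagon e = {vector [1, e], vector [e, 1], vector [1, - e], vector [- e, 1], vector [e, - e], vector [- e, e]}"

text \<open>Six sectors of directions, one for each vertex; in its sector the functional is a
  nonnegative combination of the two constraints active at that vertex.\<close>

lemma hexagon_max:
  fixes z :: "real^2"
  assumes z: "- e \<le> z$1" "z$1 \<le> 1" "- e \<le> z$2" "z$2 \<le> 1" "0 \<le> z$1 + z$2" "z$1 + z$2 \<le> 1 + e"
  shows "\<exists>v\<in>hexagon e. k1 * z$1 + k2 * z$2 \<le> k1 * v$1 + k2 * v$2"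
proof -
  have ml: "k * a \<le> k * b" if "0 \<le> k" "a \<le> b" for k a b :: real using that by (rule mult_left_mono[rotated])
  consider "0 \<le> k2" "k2 \<le> k1" | "0 \<le> k1" "k1 \<le> k2" | "k2 \<le> 0" "0 \<le> k1" | "k1 \<le> 0" "0 \<le> k2"
    | "k2 \<le> k1" "k1 \<le> 0" | "k1 \<le> k2" "k2 \<le> 0" by linarith
  then show ?thesis
  proof cases
    case 1
    then show ?thesis using ml[of k2 "z$1 + z$2" "1 + e"] ml[of "k1 - k2" "z$1" 1] z
      by (intro bexI[of _ "vector [1, e]"]) (simp_all add: hexagon_def algebra_simps)
  next
    case 2
    then show ?thesis using ml[of k1 "z$1 + z$2" "1 + e"] ml[of "k2 - k1" "z$2" 1] z
      by (intro bexI[of _ "vector [e, 1]"]) (simp_all add: hexagon_def algebra_simps)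
  next
    case 3
    then show ?thesis using ml[of k1 "z$1" 1] ml[of "- k2" "- e" "z$2"] ml[of "- k2" "- z$2" e] z
      by (intro bexI[of _ "vector [1, - e]"]) (simp_all add: hexagon_def algebra_simps)
  next
    case 4
    then show ?thesis using ml[of k2 "z$2" 1] ml[of "- k1" "- z$1" e] z
      by (intro bexI[of _ "vector [- e, 1]"]) (simp_all add: hexagon_def algebra_simps)
  next
    case 5
    then show ?thesis using ml[of "- k1" 0 "z$1 + z$2"] ml[of "k1 - k2" "- z$2" e] z
      by (intro bexI[of _ "vector [e, - e]"]) (simp_all add: hexagon_def algebra_simps)
  next
    case 6
    then show ?thesis using ml[of "- k2" 0 "z$1 + z$2"] ml[of "k2 - k1" "- z$1" e] z
      by (intro bexI[of _ "vector [- e, e]"]) (simp_all add: hexagon_def algebra_simps)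
  qed
qed

text \<open>The six points arise from the vertices of \<open>T0\<close> by displacements of order e
  parallel to the opposite sides. These do not change the area to first order, hence an excess of
  order e^2 instead of e.\<close>

lemma hexagon_bnd:
  assumes e: "0 \<le> e" "e \<le> 1/10"
  shows "bnd (1 + 3 * e\<^sup>2) (hexagon e)"
proof -
  have "0 \<le> e * e" by simp
  then have "e * 2 \<le> 1 + e * e" "e * 2 \<le> 1 + e * (e * 5)" "e * e \<le> e / 10"
    using e mult_left_mono[OF e(2) e(1)] by linarith+
  then show ?thesis
    using e unfolding bnd_def hexagon_def by (simp add: cr_def power2_eq_square algebra_simps)
qed

lemma near_triangle_bnd:
  assumes e: "0 \<le> e" "e \<le> 1/10"
    and R: "\<And>z. z \<in> R \<Longrightarrow> - e \<le> z$1 \<and> z$1 \<le> 1 \<and> - e \<le> z$2 \<and> z$2 \<le> 1 \<and> 0 \<le> z$1 + z$2 \<and> z$1 + z$2 \<le> 1 + e"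
  shows "bnd (1 + 3 * e\<^sup>2) R"
proof -
  have hm: "\<exists>v\<in>hexagon e. cr Z X Y \<le> cr v X Y" if "Z \<in> R" for X Y Z
    using hexagon_max[of e Z "X$2 - Y$2" "Y$1 - X$1"] R[OF that] unfolding cr_affine[of _ X Y] by auto
  show ?thesis unfolding bnd_def
  proof (intro ballI)
    fix X Y Z assume XYZ: "X \<in> R" "Y \<in> R" "Z \<in> R"
    obtain x where x: "x \<in> hexagon e" "cr X Y Z \<le> cr x Y Z" using hm[OF XYZ(1), of Y Z] by blast
    obtain y where y: "y \<in> hexagon e" "cr Y Z x \<le> cr y Z x" using hm[OF XYZ(2), of Z x] by blast
    obtain z where z: "z \<in> hexagon e" "cr Z x y \<le> cr z x y" using hm[OF XYZ(3), of x y] by blast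
    have "cr X Y Z \<le> cr z x y"
      using x(2) y(2) z(2) by (simp add: cr_rotate[of Y Z x] cr_rotate[of y Z x] cr_rotate[of Z x y])
    also have "\<dots> \<le> 1 + 3 * e\<^sup>2" using x y z by (intro bndD[OF hexagon_bnd[OF e]])
    finally show "cr X Y Z \<le> 1 + 3 * e\<^sup>2" .
  qed
qed

text \<open>The reduction to nine vertices keeps the area and raises the bound for inscribed
  triangles only to 1 + 3 e^2. For e <= 1/10 the ratio is then still at least 1 + e / 2, so
  \<open>stab 9\<close> applies with e / 2, and (1/4)^p <= 1/4 pays for the halving.\<close>

lemma stab_all: "\<exists>c>0. \<exists>e0>0. e0 \<le> 1/10 \<and> (\<forall>n. stab n c e0)"
proof -
  obtain c e9 where st: "0 < c" "0 < e9" "stab 9 c e9" using stab_exists[of 9] by auto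
  define e0 where "e0 = min e9 (1/10)"
  have e0: "0 < e0" "e0 \<le> 1/10" "e0 \<le> e9" using st by (auto simp: e0_def)
  have "stab n (c / 4) e0" for n
    unfolding stab_def
  proof (intro allI impI)
    fix m p xs \<mu> e
    assume ccw: "ccw xs" and len: "3 \<le> length xs" and p: "1 \<le> (p::real)" and e: "0 \<le> e" "e \<le> e0"
      and b: "bnd \<mu> (set xs)" and ar: "(1 + e) * \<mu> \<le> 2 * area (poly xs)"
    show "Phi m p (poly xs) \<le> Phi m p T0 - (c / 4) powr p * e\<^sup>2"
    proof (cases "e = 0")
      case True
      then show ?thesis using Phi_le_triangle[OF p ccw len, of m] by simp
    next
      case False
      then have e': "e > 0" using e by simp
      have e10: "e \<le> 1/10" using e e0 by linarith
      obtain ys X Y Z where ys: "ccw ys" "3 \<le> length ys" "length ys \<le> length xs" and XYZ: "X \<in> set ys" "Y \<in> set ys" "Z \<in> set ys"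
        and pos: "cr X Y Z > 0" and bY: "bnd (cr X Y Z) (set ys)" and ay: "2 * area (poly ys) = (1 + e) * cr X Y Z"
        and Pxy: "Phi m p (poly xs) \<le> Phi m p (poly ys)"
        by (rule exact_max[OF p e' ccw len b ar])
      obtain A u where A: "invertible A" "ccw (map (affmap A u) ys)" "affmap A u X = PP" "affmap A u Y = QQ" "affmap A u Z = SS"
        "bnd 1 (affmap A u ` set ys)" "2 * area (poly (map (affmap A u) ys)) = 1 + e" "det A > 0"
        "\<And>m p. p \<ge> 1 \<Longrightarrow> Phi m p (poly (map (affmap A u) ys)) = Phi m p (poly ys)"
        by (rule normalize_polygon[OF ys(1) XYZ refl pos bY ay]) auto
      let ?zs = "map (affmap A u) ys"
      have "affmap A u X \<in> set ?zs" "affmap A u Y \<in> set ?zs" "affmap A u Z \<in> set ?zs" using XYZ by auto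
      then have V: "PP \<in> set ?zs" "QQ \<in> set ?zs" "SS \<in> set ?zs" unfolding A(3-5) .
      have b1: "bnd 1 (set ?zs)" using A(6) by simp
      have cz: "crit z" if "z \<in> set ?zs" for z
        using bndD[OF b1 V(1,2) that] bndD[OF b1 V(2,3) that] bndD[OF b1 V(3,1) that] by (simp add: crit_def cr_def)
      from reduce_polygon[OF p A(2) V cz, of m] obtain ws where ws: "ccw ws" "3 \<le> length ws" "length ws \<le> 9"
        "PP \<in> set ws" "QQ \<in> set ws" "SS \<in> set ws" "\<And>z. z \<in> set ws \<Longrightarrow> crit z" "area (poly ws) = area (poly ?zs)"
        "Phi m p (poly ?zs) \<le> Phi m p (poly ws)" by blast
      have aw: "2 * area (poly ws) = 1 + e" using ws(8) A(7) by simp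
      have body: "planar_convex_body (poly ws)" by (rule ccw_body[OF ws(1,2)])
      have bw: "bnd (1 + 3 * e\<^sup>2) (set ws)"
      proof (rule near_triangle_bnd[OF e(1) e10])
        fix z assume z: "z \<in> set ws"
        have T: "PP \<in> poly ws" "QQ \<in> poly ws" "SS \<in> poly ws" and zw: "z \<in> poly ws" using ws z by (auto intro: hull_inc)
        have "- cr PP QQ z \<le> e" using cap_bound[OF body T(1,2,3) _ zw] aw by (simp add: cr_def)
        moreover have "- cr SS PP z \<le> e" using cap_bound[OF body T(3,1,2) _ zw] aw by (simp add: cr_def)
        moreover have "- cr QQ SS z \<le> e" using cap_bound[OF body T(2,3,1) _ zw] aw by (simp add: cr_def)
        ultimately show "- e \<le> z$1 \<and> z$1 \<le> 1 \<and> - e \<le> z$2 \<and> z$2 \<le> 1 \<and> 0 \<le> z$1 + z$2 \<and> z$1 + z$2 \<le> 1 + e"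
          using ws(7)[OF z] by (simp add: cr_def crit_def)
      qed
      have "(1 + e / 2) * (1 + 3 * e\<^sup>2) \<le> 1 + e"
      proof -
        have e2: "e\<^sup>2 \<le> e / 10" using mult_left_mono[OF e10 e(1)] by (simp add: power2_eq_square)
        define q where "q = (1 + e / 2) * (3 * e\<^sup>2)"
        have "q \<le> (1 + 1/20) * (3 * (e / 10))" unfolding q_def using e2 e e10 by (intro mult_mono) auto
        then have "1 + e / 2 + q \<le> 1 + e" using e(1) by simp
        moreover have "(1 + e / 2) * (1 + 3 * e\<^sup>2) = 1 + e / 2 + q" unfolding q_def by (simp add: distrib_left)
        ultimately show ?thesis by linarith
      qed
      then have "(1 + e / 2) * (1 + 3 * e\<^sup>2) \<le> 2 * area (poly ws)" unfolding aw .
      from stabD[OF st(3) ws(1,2,3) p _ _ bw this, of m] have "Phi m p (poly ws) \<le> Phi m p T0 - c powr p * (e / 2)\<^sup>2"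
        using e e0 by simp
      moreover have "(c / 4) powr p * e\<^sup>2 \<le> c powr p * (e / 2)\<^sup>2"
      proof -
        have "(c / 4) powr p = (1/4) powr p * c powr p" using st(1) by (simp add: powr_mult[symmetric])
        also have "\<dots> \<le> (1/4) * c powr p" using powr_mono'[OF p, of "1/4"] by (intro mult_right_mono) auto
        finally have "(c / 4) powr p * e\<^sup>2 \<le> (1/4) * c powr p * e\<^sup>2" by (rule mult_right_mono) simp
        then show ?thesis by (simp add: power_divide)
      qed
      ultimately show ?thesis using Pxy ws(9) A(9)[OF p, of m] by linarith
    qed
  qed
  then show ?thesis using e0 st(1) by (intro exI[of _ "c / 4"] conjI exI[of _ e0]) auto
qed

section \<open>Polygonal approximation and normalisation of convex bodies\<close>

lemma sorted_by_key_exists: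
  fixes s :: "'a \<Rightarrow> real"
  assumes "finite B" "inj_on s B"
  obtains L where "set L = B" "sorted_wrt (\<lambda>X Y. s X < s Y) L"
proof
  let ?L = "map (inv_into B s) (sorted_list_of_set (s ` B))"
  show "set ?L = B" using assms by (simp add: image_image)
  show "sorted_wrt (\<lambda>X Y. s X < s Y) ?L"
    unfolding sorted_wrt_map
    by (rule sorted_wrt_mono_rel[OF _ strict_sorted_list_of_set]) (use assms in \<open>auto simp: f_inv_into_f\<close>)
qed

lemma sorted_wrt_ccw:
  assumes "sorted_wrt R L" "\<And>X Y Z. X \<in> set L \<Longrightarrow> Y \<in> set L \<Longrightarrow> Z \<in> set L \<Longrightarrow> R X Y \<Longrightarrow> R Y Z \<Longrightarrow> 0 < cr X Y Z"
  shows "ccw L"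
  using assms
proof (induction L)
  case (Cons x L)
  have s: "sorted_wrt R L" and x: "\<And>Y. Y \<in> set L \<Longrightarrow> R x Y" using Cons.prems(1) by auto
  have "sorted_wrt (\<lambda>Y Z. 0 < cr x Y Z) L"
    by (rule sorted_wrt_mono_rel[OF _ s]) (use Cons.prems(2) x in auto)
  moreover have "ccw L" by (rule Cons.IH[OF s]) (use Cons.prems(2) in auto)
  ultimately show ?case by simp
qed simp

lemma minimal_hull_generators:
  assumes "finite F"
  obtains W where "W \<subseteq> F" "convex hull W = convex hull F" "\<forall>w\<in>W. w \<notin> convex hull (W - {w})"
proof -
  define P where "P W \<longleftrightarrow> W \<subseteq> F \<and> convex hull W = convex hull F" for W
  have "P F" by (simp add: P_def)
  then have "\<exists>W. P W \<and> (\<forall>V. P V \<longrightarrow> card W \<le> card V)" by (rule ex_has_least_nat)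
  then obtain W where PW: "P W" and least: "\<And>V. P V \<Longrightarrow> card W \<le> card V" by blast
  have W: "W \<subseteq> F" "convex hull W = convex hull F" using PW by (simp_all only: P_def)
  have fW: "finite W" using W(1) assms by (rule finite_subset)
  have "w \<notin> convex hull (W - {w})" if w: "w \<in> W" for w
  proof
    assume "w \<in> convex hull (W - {w})"
    then have "convex hull (insert w (W - {w})) = convex hull (W - {w})" by (rule hull_redundant)
    then have "convex hull (W - {w}) = convex hull F" using W(2) by (simp only: insert_Diff[OF w])
    then have "P (W - {w})" unfolding P_def using W(1) by blast
    then have "card W \<le> card (W - {w})" by (rule least)
    then show False using card_Diff1_less[OF fW w] by linarith
  qed
  then show thesis by (intro that[OF W] ballI)
qed

lemma three_le_card:
  fixes W :: "(real^2) set"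
  assumes "finite W" "interior (convex hull W) \<noteq> {}"
  shows "3 \<le> card W"
proof (rule ccontr)
  assume "\<not> 3 \<le> card W"
  then have "card W = 0 \<or> card W = 1 \<or> card W = 2" by linarith
  then have "\<exists>a b. W \<subseteq> {a, b}"
  proof (elim disjE)
    assume "card W = 0" then show ?thesis using assms(1) by simp
  next
    assume "card W = 1" then obtain a where "W = {a}" by (rule card_1_singletonE)
    then show ?thesis by blast
  next
    assume "card W = 2" then show ?thesis unfolding card_2_iff by blast
  qed
  then obtain a b where "W \<subseteq> {a, b}" by blast
  then have "convex hull W \<subseteq> closed_segment a b" unfolding segment_convex_hull by (rule hull_mono)
  then have "interior (convex hull W) \<subseteq> interior (closed_segment a b)" by (rule interior_mono)
  moreover have "interior (closed_segment a b) = {}" by (rule interior_closed_segment_ge2) simp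
  ultimately show False using assms(2) by blast
qed

text \<open>After separating one vertex \<open>A\<close> from the others by a line, they are sorted by their slope seen from \<open>A\<close>.\<close>

lemma ccw_list_exists:
  assumes F: "finite F" and int: "interior (convex hull F) \<noteq> {}"
  obtains xs where "ccw xs" "3 \<le> length xs" "set xs \<subseteq> F" "poly xs = convex hull F"
proof -
  obtain W where W: "W \<subseteq> F" "convex hull W = convex hull F" and "\<forall>w\<in>W. w \<notin> convex hull (W - {w})"
    by (rule minimal_hull_generators[OF F])
  then have W3: "\<And>w. w \<in> W \<Longrightarrow> w \<notin> convex hull (W - {w})" by blast
  have fW: "finite W" using W(1) F by (rule finite_subset)
  have c3: "3 \<le> card W" by (rule three_le_card[OF fW]) (simp only: W(2) int not_False_eq_True)
  have "W \<noteq> {}" using c3 by fastforce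
  then obtain A where A: "A \<in> W" by blast
  define B where "B = W - {A}"
  have "compact (convex hull B)" using fW by (simp add: B_def finite_imp_compact_convex_hull)
  then obtain a b where ab: "inner a A < b" "\<And>x. x \<in> convex hull B \<Longrightarrow> b < inner a x"
    using separating_hyperplane_closed_point[OF convex_convex_hull compact_imp_closed, of B A] W3[OF A, folded B_def]
    by blast
  \<comment> \<open>Up to a common factor, \<open>f\<close> and \<open>g\<close> are coordinates
    with origin \<open>A\<close>, along \<open>a\<close> and perpendicular to it. Since
    \<open>f\<close> is positive at the other points, the slope \<open>s\<close> is finite there and
    can order them.\<close>
  define f where "f x = a$1 * (x$1 - A$1) + a$2 * (x$2 - A$2)" for x :: "real^2"
  define g where "g x = a$1 * (x$2 - A$2) - a$2 * (x$1 - A$1)" for x :: "real^2"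
  define s where "s x = g x / f x" for x
  have f: "f x > 0" if "x \<in> B" for x
  proof -
    have "inner a A < inner a x" using ab(1) ab(2)[OF hull_inc[OF that]] by linarith
    then show ?thesis by (simp add: f_def inner_vec_def sum_2 algebra_simps)
  qed
  have Bne: "B \<noteq> {}"
  proof
    assume "B = {}" then have "W = {A}" using A by (auto simp: B_def)
    then show False using c3 by simp
  qed
  then obtain b0 where "b0 \<in> B" by blast
  then have "f b0 > 0" by (rule f)
  then have "a$1 \<noteq> 0 \<or> a$2 \<noteq> 0" by (auto simp: f_def)
  then have a: "(a$1)\<^sup>2 + (a$2)\<^sup>2 > 0" by (simp add: sum_power2_gt_zero_iff)
  have crA: "((a$1)\<^sup>2 + (a$2)\<^sup>2) * cr A X Y = f X * g Y - g X * f Y" for X Y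
    by (simp add: cr_def f_def g_def power2_eq_square algebra_simps)
  have crA': "((a$1)\<^sup>2 + (a$2)\<^sup>2) * cr A X Y = f X * f Y * (s Y - s X)" if "X \<in> B" "Y \<in> B" for X Y
    using f[OF that(1)] f[OF that(2)] unfolding crA s_def by (simp add: field_simps)
  \<comment> \<open>Of two points with the same slope, the nearer one lies on the segment from
    \<open>A\<close> to the farther one, against the minimality of \<open>W\<close>.\<close>
  have inj: "inj_on s B"
  proof (rule ccontr)
    assume "\<not> inj_on s B"
    then obtain X0 Y0 where XY0: "X0 \<in> B" "Y0 \<in> B" "X0 \<noteq> Y0" "s X0 = s Y0" by (auto simp: inj_on_def)
    have "\<exists>X Y. X \<in> B \<and> Y \<in> B \<and> X \<noteq> Y \<and> s X = s Y \<and> f X \<le> f Y"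
    proof (cases "f X0 \<le> f Y0")
      case True then show ?thesis using XY0 by blast
    next
      case False then have "f Y0 \<le> f X0" by simp
      then show ?thesis using XY0 by (intro exI[of _ Y0] exI[of _ X0]) simp
    qed
    then obtain X Y where XY: "X \<in> B" "Y \<in> B" "X \<noteq> Y" "s X = s Y" "f X \<le> f Y" by blast
    define t where "t = f X / f Y"
    have t: "0 \<le> t" "t \<le> 1" using f[OF XY(1)] f[OF XY(2)] XY(5) by (auto simp: t_def)
    have ft: "f X = t * f Y" using f[OF XY(2)] by (simp add: t_def)
    have "g X = s X * f X" "g Y = s Y * f Y" using f[OF XY(1)] f[OF XY(2)] by (simp_all add: s_def)
    then have gt: "g X = t * g Y" using XY(4) ft by simp
    have "((a$1)\<^sup>2 + (a$2)\<^sup>2) * (X$1 - A$1 - t * (Y$1 - A$1)) = a$1 * (f X - t * f Y) - a$2 * (g X - t * g Y)"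
      by (simp add: f_def g_def power2_eq_square algebra_simps)
    also have "\<dots> = 0" unfolding ft gt by simp
    finally have 1: "X$1 = A$1 + t * (Y$1 - A$1)" using a by (simp only: mult_eq_0_iff) linarith
    have "((a$1)\<^sup>2 + (a$2)\<^sup>2) * (X$2 - A$2 - t * (Y$2 - A$2)) = a$2 * (f X - t * f Y) + a$1 * (g X - t * g Y)"
      by (simp add: f_def g_def power2_eq_square algebra_simps)
    also have "\<dots> = 0" unfolding ft gt by simp
    finally have 2: "X$2 = A$2 + t * (Y$2 - A$2)" using a by (simp only: mult_eq_0_iff) linarith
    have "X = (1 - t) *\<^sub>R A + t *\<^sub>R Y"
      using 1 2 by (simp add: vec_eq_iff forall_2 algebra_simps)
    then have "X \<in> closed_segment A Y" using t by (auto simp: in_segment)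
    also have "\<dots> \<subseteq> convex hull (W - {X})" unfolding segment_convex_hull
      by (rule hull_mono) (use A XY(1-3) in \<open>auto simp: B_def\<close>)
    finally show False using W3[of X] XY(1) by (auto simp: B_def)
  qed
  have pos: "cr A X Y > 0" if "X \<in> B" "Y \<in> B" "s X < s Y" for X Y
  proof -
    have "((a$1)\<^sup>2 + (a$2)\<^sup>2) * cr A X Y > 0" unfolding crA'[OF that(1,2)]
      using f[OF that(1)] f[OF that(2)] that(3) by (intro mult_pos_pos) simp_all
    then show ?thesis by (rule zero_less_mult_pos[OF _ a])
  qed
  \<comment> \<open>Otherwise \<open>Y\<close> lies in the triangle of \<open>A\<close>,
    \<open>X\<close> and \<open>Z\<close>, again against minimality.\<close>
  have pos3: "cr X Y Z > 0" if XYZ: "X \<in> B" "Y \<in> B" "Z \<in> B" "s X < s Y" "s Y < s Z" for X Y Z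
  proof (rule ccontr)
    have sXYZ: "X \<noteq> Y" "Y \<noteq> Z" using XYZ(4,5) by auto
    assume "\<not> cr X Y Z > 0"
    then have "cr X Z Y \<ge> 0" by (simp add: cr_def algebra_simps)
    moreover have "cr Z A Y \<ge> 0" using pos[OF XYZ(2,3,5)] by (simp add: cr_rotate[of Z A Y] cr_rotate[of Y Z A])
    ultimately have "Y \<in> convex hull {A, X, Z}"
      using pos[of X Z] pos[of X Y] XYZ by (intro triangle_memI) simp_all
    also have "\<dots> \<subseteq> convex hull (W - {Y})"
      by (rule hull_mono) (use A XYZ(1-3) sXYZ in \<open>auto simp: B_def\<close>)
    finally show False using W3[of Y] XYZ(2) by (auto simp: B_def)
  qed
  have fB: "finite B" using fW by (simp add: B_def)
  obtain L where L: "set L = B" "sorted_wrt (\<lambda>X Y. s X < s Y) L" using sorted_by_key_exists[OF fB inj] .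
  have R: "sorted_wrt (\<lambda>X Y. 0 < cr A X Y) L"
    using L(2) by (rule sorted_wrt_mono_rel[rotated]) (simp only: L(1), rule pos)
  have cL: "ccw L" using L(2) by (rule sorted_wrt_ccw) (simp only: L(1), rule pos3)
  have c: "ccw (A # L)" unfolding ccw.simps using R cL by (rule conjI)
  have st: "set (A # L) = W" using A by (simp only: list.set L(1) B_def insert_Diff)
  have l: "3 \<le> length (A # L)" using card_length[of "A # L"] c3 by (simp only: st)
  have st': "set (A # L) \<subseteq> F" unfolding st by (rule W(1))
  have pl: "poly (A # L) = convex hull F" unfolding st by (rule W(2))
  show thesis by (rule that[OF c l st' pl])
qed

lemma affmap_mat: "affmap (mat s) u x = s *\<^sub>R x + u"
  by (simp add: vec_eq_iff forall_2 affmap_nth mat_def)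

lemma det_mat_2: "det (mat s :: real^2^2) = s\<^sup>2"
  by (simp add: det_2 mat_def power2_eq_square)

text \<open>Shrink \<open>K\<close> by 1 - t towards an interior point. The copy is compact and lies
  in the interior, so finitely many boxes inside \<open>K\<close> cover it, and finite sets spanning
  these boxes make up \<open>F\<close>. The area lost is at most 2 t times that of
  \<open>K\<close>.\<close>

lemma inner_polytope:
  assumes K: "planar_convex_body K" and \<eta>: "\<eta> > 0"
  obtains F where "finite F" "F \<subseteq> K" "interior (convex hull F) \<noteq> {}" "area K - area (convex hull F) < \<eta>"
proof -
  have cK: "compact K" and vK: "convex K" and iK: "interior K \<noteq> {}" using K by (auto simp: planar_convex_body_def)
  then obtain z where z: "z \<in> interior K" by blast
  have aK: "area K > 0" using body_emeasure[OF K] by simp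
  define t where "t = min (1/2) (\<eta> / (4 * area K))"
  have t: "0 < t" "t \<le> 1/2" "t * (4 * area K) \<le> \<eta>" using \<eta> aK
    by (auto simp: t_def min_def field_simps)
  define s where "s = 1 - t"
  have inv: "invertible (mat s :: real^2^2)" unfolding invertible_det_nz det_mat_2 using t by (simp add: s_def)
  define L where "L = affmap (mat s) (t *\<^sub>R z) ` K"
  have L: "planar_convex_body L" unfolding L_def by (rule body_affmap[OF inv K])
  have Lint: "L \<subseteq> interior K"
  proof
    fix y assume "y \<in> L"
    then obtain x where x: "x \<in> K" "y = s *\<^sub>R x + t *\<^sub>R z" by (auto simp: L_def affmap_mat)
    have "x - t *\<^sub>R (x - z) \<in> interior K"
      by (rule mem_interior_convex_shrink[OF vK z x(1)]) (use t in auto)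
    then show "y \<in> interior K" by (simp add: x(2) s_def algebra_simps)
  qed
  have "\<forall>y\<in>L. \<exists>S. finite S \<and> S \<subseteq> K \<and> y \<in> interior (convex hull S)"
  proof
    fix y assume "y \<in> L"
    then have "y \<in> interior K" using Lint by blast
    then obtain a b where ab: "y \<in> box a b" "cbox a b \<subseteq> interior K"
      by (rule open_contains_cbox[OF open_interior])
    obtain S where S: "finite S" "cbox a b = convex hull S" by (rule closed_interval_as_convex_hull)
    have "S \<subseteq> K" using hull_subset[of S convex] S(2) ab(2) interior_subset[of K] by blast
    moreover have "y \<in> interior (convex hull S)" using ab(1) unfolding S(2)[symmetric] interior_cbox .
    ultimately show "\<exists>S. finite S \<and> S \<subseteq> K \<and> y \<in> interior (convex hull S)" using S(1) by blast
  qed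
  then obtain S where S: "\<And>y. y \<in> L \<Longrightarrow> finite (S y)" "\<And>y. y \<in> L \<Longrightarrow> S y \<subseteq> K"
    "\<And>y. y \<in> L \<Longrightarrow> y \<in> interior (convex hull (S y))" by metis
  have cL: "compact L" using L by (simp add: planar_convex_body_def)
  obtain C where C: "C \<subseteq> L" "finite C" "L \<subseteq> (\<Union>c\<in>C. interior (convex hull (S c)))"
    by (rule compactE_image[OF cL, where C = L and f = "\<lambda>y. interior (convex hull (S y))"]) (use S(3) in auto)
  define F where "F = (\<Union>c\<in>C. S c)"
  have "finite F" unfolding F_def by (rule finite_UN_I[OF C(2)]) (use C(1) S(1) in blast)
  moreover have "F \<subseteq> K" unfolding F_def by (rule UN_least) (use C(1) S(2) in blast)
  ultimately have F: "finite F" "F \<subseteq> K" by simp_all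
  have LF: "L \<subseteq> convex hull F"
  proof
    fix y assume "y \<in> L"
    then obtain c where "c \<in> C" "y \<in> interior (convex hull (S c))" using C(3) by blast
    moreover have "convex hull (S c) \<subseteq> convex hull F" by (rule hull_mono) (use \<open>c \<in> C\<close> in \<open>auto simp: F_def\<close>)
    ultimately show "y \<in> convex hull F" using interior_subset by blast
  qed
  have iF: "interior (convex hull F) \<noteq> {}" using interior_mono[OF LF] L by (auto simp: planar_convex_body_def)
  have bF: "planar_convex_body (convex hull F)"
    using F(1) iF by (simp add: planar_convex_body_def finite_imp_compact_convex_hull)
  have "area L \<le> area (convex hull F)" by (rule area_mono[OF bF LF body_borel[OF L]])
  moreover have "area L = s\<^sup>2 * area K" unfolding L_def area_affmap[OF inv K] det_mat_2 by simp
  moreover have "area K - s\<^sup>2 * area K \<le> 2 * t * area K"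
    using aK t(1) by (simp add: s_def power2_eq_square algebra_simps mult_nonneg_nonneg)
  moreover have "2 * t * area K < \<eta>" using t \<eta> by (simp add: algebra_simps)
  ultimately have "area K - area (convex hull F) < \<eta>" by linarith
  then show thesis using that F iF by blast
qed

text \<open>Compactness gives an inscribed triangle of maximal area, which is not degenerate because
  \<open>K\<close> contains a small right triangle. Sending it to \<open>T0\<close> normalises the
  maximum of \<open>cr\<close> to 1.\<close>

lemma max_triangle_frame:
  assumes K: "planar_convex_body K"
  obtains B w where "invertible B" "PP \<in> affmap B w ` K" "QQ \<in> affmap B w ` K" "SS \<in> affmap B w ` K" "bnd 1 (affmap B w ` K)"
proof -
  have cK: "compact K" and iK: "interior K \<noteq> {}" using K by (auto simp: planar_convex_body_def)
  then obtain z where z: "z \<in> interior K" by blast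
  then obtain r where r: "r > 0" "cball z r \<subseteq> K" by (auto simp: mem_interior_cball)
  have in1: "z + r *\<^sub>R axis i 1 \<in> K" for i :: 2 using r by (auto simp: subset_iff dist_norm norm_axis_1)
  have zK: "z \<in> K" using r by auto
  have "continuous_on (K \<times> K \<times> K) (\<lambda>x. cr (fst x) (fst (snd x)) (snd (snd x)))" by (intro continuous_intros)
  moreover have "compact (K \<times> K \<times> K)" using cK by (intro compact_Times)
  moreover have "K \<times> K \<times> K \<noteq> {}" using zK by auto
  ultimately obtain m where m: "m \<in> K \<times> K \<times> K"
    "\<And>x. x \<in> K \<times> K \<times> K \<Longrightarrow> cr (fst x) (fst (snd x)) (snd (snd x)) \<le> cr (fst m) (fst (snd m)) (snd (snd m))"
    using continuous_attains_sup[of "K \<times> K \<times> K" "\<lambda>x. cr (fst x) (fst (snd x)) (snd (snd x))"] by blast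
  obtain X Y Z where XYZ: "m = (X, Y, Z)" by (cases m)
  have in2: "X \<in> K" "Y \<in> K" "Z \<in> K" using m(1) XYZ by auto
  have mx: "cr X' Y' Z' \<le> cr X Y Z" if "X' \<in> K" "Y' \<in> K" "Z' \<in> K" for X' Y' Z'
    using m(2)[of "(X', Y', Z')"] that XYZ by simp
  have "cr z (z + r *\<^sub>R axis 1 1) (z + r *\<^sub>R axis 2 1) = r\<^sup>2"
    by (simp add: cr_def axis_def power2_eq_square)
  then have pos: "cr X Y Z > 0" using mx[OF zK in1 in1, of 1 2] r(1) by (simp add: less_le_trans[of 0 "r\<^sup>2"])
  obtain A where A: "invertible A" "det A = cr X Y Z" "affmap A X PP = X" "affmap A X QQ = Y" "affmap A X SS = Z"
    by (rule affine_frame[OF pos])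
  obtain B w where B: "invertible B" "det B = 1 / det A" "\<And>x. affmap B w (affmap A X x) = x" "\<And>x. affmap A X (affmap B w x) = x"
    by (rule affmap_inverse[OF A(1), of X]) blast
  have "affmap B w X = PP" "affmap B w Y = QQ" "affmap B w Z = SS" using B(3) A(3-5) by metis+
  then have "PP \<in> affmap B w ` K" "QQ \<in> affmap B w ` K" "SS \<in> affmap B w ` K" using in2 by (metis imageI)+
  moreover have "bnd 1 (affmap B w ` K)"
    unfolding bnd_def using mx pos by (auto simp: cr_affmap B(2) A(2))
  ultimately show thesis using that B(1) by blast
qed

lemma simplex_affine_T0:
  fixes T :: "(real^2) set"
  assumes "2 simplex T"
  obtains h w where "invertible h" "T = affmap h w ` T0"
proof -
  obtain C where C: "\<not> affine_dependent C" "int (card C) = 2 + 1" "T = convex hull C"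
    using assms unfolding simplex by blast
  then have "card C = 3" by simp
  then obtain X Y Z where XYZ: "C = {X, Y, Z}" "X \<noteq> Y" "Y \<noteq> Z" "X \<noteq> Z" by (auto simp: card_3_iff)
  have ncol: "\<not> collinear {X, Y, Z}"
    using C(1) XYZ collinear_3_eq_affine_dependent[of X Y Z] by auto
  have nz: "cr X Y Z \<noteq> 0"
  proof
    assume 0: "cr X Y Z = 0"
    have "collinear {0, Y - X, Z - X}"
    proof (cases "Y$1 = X$1")
      case True
      then have "Y$2 \<noteq> X$2" using XYZ(2) by (auto simp: vec_eq_iff forall_2)
      with True 0 have "Z - X = ((Z$2 - X$2) / (Y$2 - X$2)) *\<^sub>R (Y - X)"
        by (simp add: cr_def vec_eq_iff forall_2)
      then show ?thesis unfolding collinear_lemma by blast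
    next
      case False
      have "Z$2 - X$2 = (Z$1 - X$1) * (Y$2 - X$2) / (Y$1 - X$1)"
        using 0 False by (simp add: cr_def eq_divide_eq mult.commute)
      then have "Z - X = ((Z$1 - X$1) / (Y$1 - X$1)) *\<^sub>R (Y - X)"
        using False by (simp add: vec_eq_iff forall_2)
      then show ?thesis unfolding collinear_lemma by blast
    qed
    then have "collinear {Y, X, Z}" by (subst collinear_3) simp_all
    then show False using ncol by (simp add: insert_commute)
  qed
  have "\<exists>X Y Z. C = {X, Y, Z} \<and> cr X Y Z > 0"
  proof (cases "cr X Y Z > 0")
    case True then show ?thesis using XYZ by blast
  next
    case False
    then have "cr Y X Z > 0" "C = {Y, X, Z}" using nz XYZ cr_swap[of Y X Z] by (auto simp: insert_commute)
    then show ?thesis by blast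
  qed
  then obtain X Y Z where XYZ: "C = {X, Y, Z}" "cr X Y Z > 0" by blast
  obtain A where A: "invertible A" "affmap A X PP = X" "affmap A X QQ = Y" "affmap A X SS = Z"
    by (rule affine_frame[OF XYZ(2)]) 
  have "T = affmap A X ` T0" unfolding T0_def affmap_hull C(3) XYZ(1) by (simp add: A)
  then show thesis using that A(1) by blast
qed

section \<open>The Banach-Mazur distance from a triangle\<close>

lemma mem_scaled_T0:
  assumes "l > 0"
  shows "z \<in> affmap (mat l) 0 ` T0 \<longleftrightarrow> 0 \<le> z$1 \<and> 0 \<le> z$2 \<and> z$1 + z$2 \<le> l"
proof
  assume "z \<in> affmap (mat l) 0 ` T0"
  then obtain t where t: "t \<in> T0" "z = l *\<^sub>R t" by (auto simp: affmap_mat)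
  have "l * (t$1 + t$2) \<le> l * 1" using t(1) assms unfolding mem_T0 by (intro mult_left_mono) auto
  then show "0 \<le> z$1 \<and> 0 \<le> z$2 \<and> z$1 + z$2 \<le> l" using t assms unfolding mem_T0 by (simp add: algebra_simps)
next
  assume z: "0 \<le> z$1 \<and> 0 \<le> z$2 \<and> z$1 + z$2 \<le> l"
  have "(1 / l) *\<^sub>R z \<in> T0" unfolding mem_T0 using z assms by (simp add: add_divide_distrib[symmetric])
  moreover have "z = affmap (mat l) 0 ((1 / l) *\<^sub>R z)" using assms by (simp add: affmap_mat)
  ultimately show "z \<in> affmap (mat l) 0 ` T0" by blast
qed

definition bm_set :: "(real^2) set \<Rightarrow> (real^2) set \<Rightarrow> real set" where
  "bm_set K M = {l. l \<ge> 1 \<and>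
     (\<exists>(A::real^2^2) x y. invertible A \<and>
        (\<lambda>z. z - x) ` K \<subseteq> (\<lambda>z. A *v (z - y)) ` M \<and>
        (\<lambda>z. A *v (z - y)) ` M \<subseteq> (\<lambda>z. l *\<^sub>R (z - x)) ` K)}"

lemma banach_mazur_eq: "banach_mazur K M = Inf (bm_set K M)"
  by (simp add: banach_mazur_def bm_set_def)

lemma bdd_below_bm_set: "bdd_below (bm_set K M)"
  by (rule bdd_belowI[of _ 1]) (simp add: bm_set_def)

text \<open>The two bodies may be given in different affine frames with linear parts F and h; the
  matrix l F h^-1 passes from one frame to the other. It contains the factor l because the
  definition wants an image of the second body between the first and its l-fold multiple, whereas
  here \<open>M\<close> lies inside \<open>K\<close>.\<close>

lemma mem_bm_set:
  fixes F h :: "real^2^2"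
  assumes F: "invertible F" and h: "invertible h" and l: "l \<ge> 1"
    and M: "M \<subseteq> K" "K \<subseteq> (\<lambda>t. g + l *\<^sub>R (t - g)) ` M"
  shows "l \<in> bm_set (affmap F u ` K) (affmap h w ` M)"
proof -
  obtain H where H: "h ** H = mat 1" "H ** h = mat 1" using h unfolding invertible_def by blast
  define A where "A = l *\<^sub>R (F ** H)"
  have "invertible H" unfolding invertible_def using H by blast
  then have "det (F ** H) \<noteq> 0" using F unfolding invertible_det_nz det_mul by simp
  moreover have "det A = l\<^sup>2 * det (F ** H)" by (simp add: A_def det_2 power2_eq_square algebra_simps)
  ultimately have A: "invertible A" using l by (simp add: invertible_det_nz)
  have Ah: "A *v (h *v x) = l *\<^sub>R (F *v x)" for x
  proof -
    have "A *v (h *v x) = l *\<^sub>R (F *v ((H ** h) *v x))"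
      by (simp add: A_def scaleR_matrix_vector_assoc[symmetric] matrix_vector_mul_assoc[symmetric] del: H)
    then show ?thesis by (simp add: H(2))
  qed
  have d: "affmap h w s - affmap h w t = h *v (s - t)" "affmap F u s - affmap F u t = F *v (s - t)" for s t
    by (simp_all add: affmap_def matrix_vector_mult_diff_distrib)
  have "(\<lambda>z. z - affmap F u g) ` affmap F u ` K \<subseteq> (\<lambda>z. A *v (z - affmap h w g)) ` affmap h w ` M"
  proof (clarsimp simp: d)
    fix k assume "k \<in> K"
    then obtain t where t: "t \<in> M" "k = g + l *\<^sub>R (t - g)" using M(2) by blast
    have "F *v (k - g) = A *v (affmap h w t - affmap h w g)"
      unfolding d Ah t(2) by (simp add: scaleR_matrix_vector_assoc[symmetric] matrix_vector_mult_scaleR)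
    then show "F *v (k - g) \<in> (\<lambda>z. A *v (z - affmap h w g)) ` affmap h w ` M" using t(1) by blast
  qed
  moreover have "(\<lambda>z. A *v (z - affmap h w g)) ` affmap h w ` M \<subseteq> (\<lambda>z. l *\<^sub>R (z - affmap F u g)) ` affmap F u ` K"
  proof (clarsimp simp: d Ah)
    fix t assume "t \<in> M"
    then have "t \<in> K" using M(1) by blast
    moreover have "l *\<^sub>R (F *v (t - g)) = l *\<^sub>R (affmap F u t - affmap F u g)" unfolding d ..
    ultimately show "l *\<^sub>R (F *v (t - g)) \<in> (\<lambda>z. l *\<^sub>R (z - affmap F u g)) ` affmap F u ` K" by blast
  qed
  ultimately show ?thesis unfolding bm_set_def using l A by blast
qed

text \<open>A point sticks out beyond a side at most by the excess from \<open>cap_bound\<close>,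
  and at most by 1 because the triangle it forms with that side is inscribed too. The second bound
  later makes \<delta> <= 3 available.\<close>

lemma normalized_coords:
  assumes K: "planar_convex_body K" and P: "PP \<in> K" "QQ \<in> K" "SS \<in> K" and b: "bnd 1 K"
    and z: "z \<in> K" and e: "e = min (2 * area K - 1) 1"
  shows "- e \<le> z$1" "- e \<le> z$2" "z$1 + z$2 \<le> 1 + e"
proof -
  have c: "cr PP QQ z = z$2" "cr QQ SS z = 1 - z$1 - z$2" "cr SS PP z = z$1"
    "cr QQ PP z = - z$2" "cr SS QQ z = z$1 + z$2 - 1" "cr PP SS z = - z$1"
    "cr PP QQ SS = 1" "cr QQ SS PP = 1" "cr SS PP QQ = 1"
    by (simp_all add: cr_def algebra_simps)
  show "- e \<le> z$1"
    using cap_bound[OF K P(3,1,2) _ z] bndD[OF b P(1,3) z] unfolding c e by linarith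
  show "- e \<le> z$2"
    using cap_bound[OF K P(1,2,3) _ z] bndD[OF b P(2,1) z] unfolding c e by linarith
  show "z$1 + z$2 \<le> 1 + e"
    using cap_bound[OF K P(2,3,1) _ z] bndD[OF b P(3,2) z] unfolding c e by linarith
qed

lemma T0_subset:
  assumes "convex K" "PP \<in> K" "QQ \<in> K" "SS \<in> K"
  shows "T0 \<subseteq> K"
  unfolding T0_def by (rule hull_minimal) (use assms in auto)

lemma banach_mazur_normalized:
  assumes F: "invertible F" and h: "invertible h"
    and K: "planar_convex_body K" and P: "PP \<in> K" "QQ \<in> K" "SS \<in> K" and b: "bnd 1 K"
    and e: "e = min (2 * area K - 1) 1"
  shows "banach_mazur (affmap F u ` K) (affmap h w ` T0) \<le> 1 + 3 * e"
proof -
  have sub: "T0 \<subseteq> K" using K P by (intro T0_subset) (auto simp: planar_convex_body_def)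
  have "area T0 \<le> area K" by (rule area_mono[OF K sub body_borel[OF body_T0]])
  then have e0: "0 \<le> e" by (simp add: e area_T0)
  \<comment> \<open>The lines on which the coordinates are -e, or their sum is 1 + e, bound a
    homothetic copy of \<open>T0\<close> with the same centroid and ratio 1 + 3 e.\<close>
  define l where "l = 1 + 3 * e"
  have l: "l \<ge> 1" "e = (l - 1) / 3" using e0 by (simp_all add: l_def)
  define g :: "real^2" where "g = vector [1/3, 1/3]"
  have "K \<subseteq> (\<lambda>t. g + l *\<^sub>R (t - g)) ` T0"
  proof
    fix z assume "z \<in> K"
    note z = normalized_coords[OF K P b this e]
    define t where "t = g + (1 / l) *\<^sub>R (z - g)"
    have t: "l * t$1 = z$1 + e" "l * t$2 = z$2 + e"
      using l(1) unfolding t_def g_def l(2) by (simp_all add: field_simps)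
    have "0 \<le> l * t$1" "0 \<le> l * t$2" unfolding t using z by simp_all
    moreover have "l * (t$1 + t$2) \<le> l * 1" unfolding distrib_left t using z by (simp add: l_def)
    ultimately
    have "t \<in> T0" unfolding mem_T0 using l(1) by (simp add: zero_le_mult_iff)
    moreover have "z = g + l *\<^sub>R (t - g)" using l(1) by (simp add: t_def)
    ultimately show "z \<in> (\<lambda>t. g + l *\<^sub>R (t - g)) ` T0" by blast
  qed
  then have "l \<in> bm_set (affmap F u ` K) (affmap h w ` T0)" by (rule mem_bm_set[OF F h l(1) sub])
  then show ?thesis unfolding banach_mazur_eq l_def by (rule cInf_lower[OF _ bdd_below_bm_set])
qed

text \<open>The strict inequality leaves room for an inscribed polygon whose ratio bound is still 1
  + e; its triangles are triangles in \<open>K\<close>, so \<open>bnd\<close> is inherited. The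
  polygon is chosen so that \<open>Phi_subset\<close> costs at most d.\<close>

lemma Phi_normalized_body:
  assumes st: "\<And>n. stab n c e0" and K: "planar_convex_body K" and b: "bnd 1 K" and p: "p \<ge> 1"
    and e: "0 \<le> e" "e \<le> e0" and ar: "1 + e < 2 * area K"
  shows "Phi m p K \<le> Phi m p T0 - c powr p * e\<^sup>2"
proof (rule field_le_epsilon)
  fix d :: real assume d: "d > 0"
  have aK: "area K > 0" using body_emeasure[OF K] by simp
  define t where "t = min (d * area K / 3) ((2 * area K - (1 + e)) / 2)"
  have t: "t \<le> d * area K / 3" "t \<le> (2 * area K - (1 + e)) / 2" unfolding t_def by (rule min.cobounded1, rule min.cobounded2)
  have "t > 0" using d aK ar by (simp add: t_def)
  then obtain F where F: "finite F" "F \<subseteq> K" "interior (convex hull F) \<noteq> {}" "area K - area (convex hull F) < t"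
    by (rule inner_polytope[OF K])
  obtain xs where xs: "ccw xs" "3 \<le> length xs" "set xs \<subseteq> F" "poly xs = convex hull F"
    by (rule ccw_list_exists[OF F(1,3)])
  have "bnd 1 (set xs)" using xs(3) F(2) by (intro bnd_subset[OF b]) blast
  moreover have "(1 + e) * 1 \<le> 2 * area (poly xs)" using F(4) t(2) unfolding xs(4) by (simp add: field_simps)
  ultimately have 1: "Phi m p (poly xs) \<le> Phi m p T0 - c powr p * e\<^sup>2"
    by (intro stabD[OF st xs(1,2) order_refl p e])
  have "poly xs \<subseteq> K" unfolding xs(4) by (rule hull_minimal) (use F(2) K in \<open>auto simp: planar_convex_body_def\<close>)
  then have "Phi m p K \<le> Phi m p (poly xs) + 3 * ((area K - area (poly xs)) / area K)"
    by (intro Phi_subset K ccw_body xs p)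
  moreover have "area K - area (poly xs) \<le> d * area K / 3" using F(4) t unfolding xs(4) by linarith
  then have "3 * ((area K - area (poly xs)) / area K) \<le> d" using aK by (simp add: field_simps)
  ultimately show "Phi m p K \<le> Phi m p T0 - c powr p * e\<^sup>2 + d" using 1 by linarith
qed

lemma Phi_simplex:
  assumes "2 simplex T" "p \<ge> 1"
  shows "Phi m p T = Phi m p T0"
proof -
  obtain h w where "invertible h" "T = affmap h w ` T0" by (rule simplex_affine_T0[OF assms(1)])
  then show ?thesis using Phi_affmap[OF _ body_T0 assms(2)] by simp
qed

lemma Phi_stability:
  "\<exists>c>0. \<forall>m T K \<delta> p. 2 simplex T \<longrightarrow> planar_convex_body K \<longrightarrow> \<delta> > 0 \<longrightarrow> banach_mazur K T = 1 + \<delta> \<longrightarrow> p \<ge> 1 \<longrightarrow>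
    Phi m p K \<le> Phi m p T0 - c powr p * \<delta>\<^sup>2"
proof -
  obtain c e0 where c: "c > 0" "e0 > 0" "e0 \<le> 1/10" "\<And>n. stab n c e0" using stab_all by blast
  have "Phi m p K \<le> Phi m p T0 - (c * (e0\<^sup>2 / 9)) powr p * \<delta>\<^sup>2"
    if T: "2 simplex T" and K: "planar_convex_body K" and \<delta>: "\<delta> > 0" "banach_mazur K T = 1 + \<delta>" and p: "p \<ge> 1"
    for m T K \<delta> p
  proof -
    obtain h v where h: "invertible h" "T = affmap h v ` T0" by (rule simplex_affine_T0[OF T])
    obtain B w where B: "invertible B" and P: "PP \<in> affmap B w ` K" "QQ \<in> affmap B w ` K" "SS \<in> affmap B w ` K"
      and b: "bnd 1 (affmap B w ` K)" by (rule max_triangle_frame[OF K])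
    obtain F u where F: "invertible F" "det F = 1 / det B" "\<And>x. affmap F u (affmap B w x) = x"
      "\<And>x. affmap B w (affmap F u x) = x"
      by (rule affmap_inverse[OF B, of w]) blast
    define K' where "K' = affmap B w ` K"
    have K': "planar_convex_body K'" unfolding K'_def by (rule body_affmap[OF B K])
    have KK': "K = affmap F u ` K'" by (simp add: K'_def image_image F(3))
    define e where "e = min (2 * area K' - 1) 1"
    have "1 + \<delta> \<le> 1 + 3 * e"
      unfolding \<delta>(2)[symmetric] h(2) KK' by (rule banach_mazur_normalized[OF F(1) h(1) K' P[folded K'_def] b[folded K'_def] e_def])
    then have e: "\<delta> / 3 \<le> e" by simp
    \<comment> \<open>\<delta> / 6 in place of \<delta> / 3 makes the area inequality strict, and
      \<open>e0\<close> keeps within the range of stability. As \<delta> <= 3 and e0 <= 1/10, the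
      minimum is still at least \<open>e0 / 3 * \<delta>\<close>.\<close>
    define \<epsilon> where "\<epsilon> = min (\<delta> / 6) e0"
    have "0 \<le> \<epsilon>" "\<epsilon> \<le> e0" using \<delta> c by (simp_all add: \<epsilon>_def)
    moreover have "1 + \<epsilon> < 2 * area K'" using e \<delta>(1) unfolding \<epsilon>_def e_def by linarith
    ultimately have 1: "Phi m p K' \<le> Phi m p T0 - c powr p * \<epsilon>\<^sup>2"
      by (rule Phi_normalized_body[OF c(4) K' b[folded K'_def] p])
    have "\<delta> \<le> 3" using e unfolding e_def by linarith
    then have "e0 * \<delta> \<le> e0 * 3" using c(2) by (intro mult_left_mono) auto
    moreover have "e0 * \<delta> \<le> (1/10) * \<delta>" using c(3) \<delta>(1) by (intro mult_right_mono) auto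
    ultimately have "e0 / 3 * \<delta> \<le> \<epsilon>" using \<delta>(1) unfolding \<epsilon>_def by linarith
    then have "(e0 / 3 * \<delta>)\<^sup>2 \<le> \<epsilon>\<^sup>2" using c(2) \<delta>(1) by (intro power_mono) auto
    then have "c powr p * (e0\<^sup>2 / 9 * \<delta>\<^sup>2) \<le> c powr p * \<epsilon>\<^sup>2"
      by (intro mult_left_mono) (auto simp: power_mult_distrib power_divide)
    moreover have "(e0\<^sup>2 / 9) powr p \<le> e0\<^sup>2 / 9"
    proof -
      have "e0\<^sup>2 \<le> 1\<^sup>2" using c(2,3) by (intro power_mono) auto
      then have "(e0\<^sup>2 / 9) powr p \<le> (e0\<^sup>2 / 9) powr 1" using p by (intro powr_mono') auto
      then show ?thesis using c(2) by simp
    qed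
    then have "c powr p * ((e0\<^sup>2 / 9) powr p * \<delta>\<^sup>2) \<le> c powr p * (e0\<^sup>2 / 9 * \<delta>\<^sup>2)"
      by (intro mult_left_mono mult_right_mono) auto
    moreover have "(c * (e0\<^sup>2 / 9)) powr p = c powr p * (e0\<^sup>2 / 9) powr p" by (rule powr_mult)
    moreover have "Phi m p K' = Phi m p K" unfolding K'_def by (rule Phi_affmap[OF B K p])
    ultimately show ?thesis using 1 by (simp add: mult.assoc)
  qed
  moreover have "c * (e0\<^sup>2 / 9) > 0" using c by simp
  ultimately show ?thesis by blast
qed

section \<open>Optimality of the exponent\<close>

text \<open>A triangle of size \<open>1 + r\<close> with a corner of size \<open>r\<close> cut off: its distance from the triangle
  is of order \<open>r\<close>, but only a set of area of order \<open>r\<^sup>2\<close> is lost.\<close>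

definition cut_triangle :: "real \<Rightarrow> (real^2) set" where
  "cut_triangle r = {z. 0 \<le> z$1 \<and> 0 \<le> z$2 \<and> z$2 \<le> 1 \<and> z$1 + z$2 \<le> 1 + r}"

context
  fixes r :: real
  assumes r: "0 < r" "r \<le> 1/2"
begin

lemma invertible_scale: "invertible (mat (1 + r) :: real^2^2)"
  unfolding invertible_det_nz det_mat_2 using r by simp

lemma body_scaled: "planar_convex_body (affmap (mat (1 + r)) 0 ` T0)"
  by (rule body_affmap[OF invertible_scale body_T0])

lemma T0_subset_cut: "T0 \<subseteq> cut_triangle r"
proof
  fix z assume "z \<in> T0"
  then show "z \<in> cut_triangle r" unfolding mem_T0 cut_triangle_def using r by simp
qed

lemma cut_subset_scaled: "cut_triangle r \<subseteq> affmap (mat (1 + r)) 0 ` T0"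
proof
  fix z assume "z \<in> cut_triangle r"
  then show "z \<in> affmap (mat (1 + r)) 0 ` T0" using r by (subst mem_scaled_T0) (auto simp: cut_triangle_def)
qed

lemma body_cut: "planar_convex_body (cut_triangle r)"
proof -
  have eq: "cut_triangle r = affmap (mat (1 + r)) 0 ` T0 \<inter> {z. z$2 \<le> 1}"
    using r by (intro set_eqI) (simp add: mem_scaled_T0 cut_triangle_def, argo)
  have "closed {z::real^2. z$2 \<le> 1}" by (rule closed_halfspace_component_le_cart)
  moreover have "convex {z::real^2. z$2 \<le> 1}"
    by (auto simp: convex_def intro!: convex_bound_le)
  ultimately have "compact (cut_triangle r)" "convex (cut_triangle r)"
    unfolding eq using body_scaled by (auto simp: planar_convex_body_def intro: compact_Int_closed convex_Int)
  moreover have "interior (cut_triangle r) \<noteq> {}"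
    using interior_mono[OF T0_subset_cut] body_T0 by (auto simp: planar_convex_body_def)
  ultimately show ?thesis by (simp add: planar_convex_body_def)
qed

lemma area_scaled: "area (affmap (mat (1 + r)) 0 ` T0) = (1 + r)\<^sup>2 / 2"
  using area_affmap[OF invertible_scale body_T0] by (simp add: det_mat_2 area_T0)

lemma area_cut: "(1 + r)\<^sup>2 / 2 - r\<^sup>2 / 2 \<le> area (cut_triangle r)"
proof -
  define X Y W :: "real^2" where XYW: "X = vector [0, 1]" "Y = vector [r, 1]" "W = vector [0, 1 + r]"
  have crN: "cr X Y W = r * r" by (simp add: XYW cr_def)
  have N: "planar_convex_body (convex hull {X, Y, W})" by (rule body_triangle) (use r crN in simp)
  have aN: "area (convex hull {X, Y, W}) = r\<^sup>2 / 2" unfolding area_triangle crN by (simp add: power2_eq_square)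
  have sub: "affmap (mat (1 + r)) 0 ` T0 \<subseteq> cut_triangle r \<union> convex hull {X, Y, W}"
  proof
    fix z assume "z \<in> affmap (mat (1 + r)) 0 ` T0"
    then have z: "0 \<le> z$1" "0 \<le> z$2" "z$1 + z$2 \<le> 1 + r" using r by (simp_all add: mem_scaled_T0)
    show "z \<in> cut_triangle r \<union> convex hull {X, Y, W}"
    proof (cases "z$2 \<le> 1")
      case True then show ?thesis using z by (simp add: cut_triangle_def)
    next
      case False
      have "cr X Y W > 0" unfolding crN using r by simp
      moreover have "cr X Y z = r * (z$2 - 1)" "cr Y W z = r * (1 + r - z$1 - z$2)" "cr W X z = r * z$1"
        by (simp_all add: XYW cr_def algebra_simps)
      ultimately have "z \<in> convex hull {X, Y, W}" using z False r by (intro triangle_memI) simp_all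
      then show ?thesis by blast
    qed
  qed
  let ?B = "affmap (mat (1 + r)) 0 ` T0"
  have "emeasure lborel ?B \<le> emeasure lborel (cut_triangle r \<union> convex hull {X, Y, W})"
    using body_borel[OF body_cut] body_borel[OF N] by (intro emeasure_mono sub) auto
  also have "\<dots> \<le> emeasure lborel (cut_triangle r) + emeasure lborel (convex hull {X, Y, W})"
    using body_borel[OF body_cut] body_borel[OF N] by (intro emeasure_subadditive) auto
  also have "\<dots> = ennreal (area (cut_triangle r) + area (convex hull {X, Y, W}))"
    unfolding body_emeasure(1)[OF body_cut] body_emeasure(1)[OF N]
    using body_emeasure(2)[OF body_cut] body_emeasure(2)[OF N] by (intro ennreal_plus[symmetric]) auto
  finally have "ennreal (area ?B) \<le> ennreal (area (cut_triangle r) + area (convex hull {X, Y, W}))"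
    unfolding body_emeasure(1)[OF body_scaled] .
  then have "area ?B \<le> area (cut_triangle r) + area (convex hull {X, Y, W})"
    using body_emeasure(2)[OF body_cut] body_emeasure(2)[OF N] by (subst (asm) ennreal_le_iff) auto
  then show ?thesis unfolding area_scaled aN by simp
qed

text \<open>The body is a trapezoid, so it is enough to check its corners. Its area differs from
  that of the uncut triangle by order r^2 only, but its largest inscribed triangle is smaller than
  the uncut triangle by order r; this gives the distance.\<close>

lemma bnd_cut: "bnd (1 + r) (cut_triangle r)"
proof -
  define a b c d :: "real^2" where abcd: "a = vector [0, 0]" "b = vector [1 + r, 0]" "c = vector [r, 1]" "d = vector [0, 1]"
  have "bnd (1 + r) {a, b, c, d}"
    unfolding bnd_def using r by (simp add: abcd cr_def algebra_simps)
  then have "bnd (1 + r) (convex hull {a, b, c, d})" by (rule bnd_hull)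
  moreover have "cut_triangle r \<subseteq> convex hull {a, b, c, d}"
  proof
    fix z assume "z \<in> cut_triangle r"
    then have z: "0 \<le> z$1" "0 \<le> z$2" "z$2 \<le> 1" "z$1 + z$2 \<le> 1 + r" by (auto simp: cut_triangle_def)
    show "z \<in> convex hull {a, b, c, d}"
    proof (cases "z$1 \<le> r * z$2")
      case True
      have "cr a c z = r * z$2 - z$1" "cr c d z = r * (1 - z$2)" "cr d a z = z$1" "cr a c d = r"
        by (simp_all add: abcd cr_def algebra_simps)
      then have "z \<in> convex hull {a, c, d}" using z True r by (intro triangle_memI) simp_all
      then show ?thesis using hull_mono[of "{a, c, d}" "{a, b, c, d}"] by blast
    next
      case False
      have "cr a b z = (1 + r) * z$2" "cr b c z = 1 + r - z$1 - z$2" "cr c a z = z$1 - r * z$2" "cr a b c = 1 + r"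
        by (simp_all add: abcd cr_def algebra_simps)
      then have "z \<in> convex hull {a, b, c}" using z False r by (intro triangle_memI) simp_all
      then show ?thesis using hull_mono[of "{a, b, c}" "{a, b, c, d}"] by blast
    qed
  qed
  ultimately show ?thesis by (rule bnd_subset)
qed

lemma Phi_cut:
  assumes p: "p \<ge> 1"
  shows "Phi m p T0 - 3 * r\<^sup>2 \<le> Phi m p (cut_triangle r)"
proof -
  let ?B = "affmap (mat (1 + r)) 0 ` T0"
  have "Phi m p ?B \<le> Phi m p (cut_triangle r) + 3 * ((area ?B - area (cut_triangle r)) / area ?B)"
    by (rule Phi_subset[OF body_scaled body_cut cut_subset_scaled p])
  moreover have "Phi m p ?B = Phi m p T0" by (rule Phi_affmap[OF invertible_scale body_T0 p])
  moreover have "(area ?B - area (cut_triangle r)) / area ?B \<le> r\<^sup>2"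
  proof -
    have "area ?B - area (cut_triangle r) \<le> r\<^sup>2 * (1/2)" using area_cut unfolding area_scaled by simp
    also have "\<dots> \<le> r\<^sup>2 * area ?B" unfolding area_scaled using r by (intro mult_left_mono) (auto simp: power2_eq_square algebra_simps)
    finally show ?thesis using body_emeasure(2)[OF body_scaled] by (simp add: divide_le_eq)
  qed
  ultimately show ?thesis by linarith
qed

text \<open>The lower bound compares areas, up to the factor |det h|. The image of the triangle
  contains a translate of the body, so twice its area is at least 1 + 2 r; it also lies in a
  translate of the l-fold body, where triangles have twice the area at most l^2 (1 + r).\<close>

lemma banach_mazur_cut:
  assumes h: "invertible h"
  shows "1 + r / 4 \<le> banach_mazur (affmap h w ` cut_triangle r) (affmap h w ` T0)"
    "banach_mazur (affmap h w ` cut_triangle r) (affmap h w ` T0) \<le> 1 + r"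
proof -
  let ?K = "affmap h w ` cut_triangle r" and ?T = "affmap h w ` T0"
  have "cut_triangle r \<subseteq> (\<lambda>t. 0 + (1 + r) *\<^sub>R (t - 0)) ` T0"
    using cut_subset_scaled by (simp add: affmap_mat)
  then have mem: "1 + r \<in> bm_set ?K ?T" using r by (intro mem_bm_set[where g = 0, OF h h _ T0_subset_cut]) auto
  then show "banach_mazur ?K ?T \<le> 1 + r" unfolding banach_mazur_eq by (rule cInf_lower[OF _ bdd_below_bm_set])
  have "1 + r / 4 \<le> l" if l: "l \<in> bm_set ?K ?T" for l
  proof -
    obtain A :: "real^2^2" and x y where l1: "l \<ge> 1" and A: "invertible A"
      "(\<lambda>z. z - x) ` ?K \<subseteq> (\<lambda>z. A *v (z - y)) ` ?T" "(\<lambda>z. A *v (z - y)) ` ?T \<subseteq> (\<lambda>z. l *\<^sub>R (z - x)) ` ?K"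
      using l unfolding bm_set_def by blast
    define f where "f = affmap A (- (A *v y))"
    have f: "A *v (z - y) = f z" for z by (simp add: f_def affmap_def matrix_vector_mult_diff_distrib)
    have tr: "z - x = affmap (mat 1) (- x) z" for z by (simp add: affmap_mat)
    have inv1: "invertible (mat 1 :: real^2^2)" by (simp add: invertible_det_nz)
    have bK: "planar_convex_body ?K" and bT: "planar_convex_body ?T"
      using body_affmap[OF h] body_cut body_T0 by blast+
    have "area (affmap (mat 1) (- x) ` ?K) \<le> area (f ` ?T)"
      using A(2) unfolding f tr f_def
      by (intro area_mono body_affmap A(1) bT body_borel inv1 bK)
    then have "\<bar>det h\<bar> * area (cut_triangle r) \<le> \<bar>det A\<bar> * (\<bar>det h\<bar> * (1/2))"
      unfolding area_affmap[OF inv1 bK] f_def area_affmap[OF A(1) bT] area_affmap[OF h body_cut] area_affmap[OF h body_T0] area_T0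
      by simp
    then have "\<bar>det h\<bar> * (2 * area (cut_triangle r)) \<le> \<bar>det h\<bar> * \<bar>det A\<bar>" by (simp add: algebra_simps)
    then have 1: "2 * area (cut_triangle r) \<le> \<bar>det A\<bar>" using h by (simp add: invertible_det_nz)
    have ex: "\<exists>q\<in>cut_triangle r. f (affmap h w t) = l *\<^sub>R (affmap h w q - x)" if "t \<in> T0" for t
      using A(3) that unfolding f by blast
    have PT: "PP \<in> T0" "QQ \<in> T0" "SS \<in> T0" by (simp_all add: mem_T0)
    obtain q1 where q1: "q1 \<in> cut_triangle r" "f (affmap h w PP) = l *\<^sub>R (affmap h w q1 - x)" using ex[OF PT(1)] by blast
    obtain q2 where q2: "q2 \<in> cut_triangle r" "f (affmap h w QQ) = l *\<^sub>R (affmap h w q2 - x)" using ex[OF PT(2)] by blast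
    obtain q3 where q3: "q3 \<in> cut_triangle r" "f (affmap h w SS) = l *\<^sub>R (affmap h w q3 - x)" using ex[OF PT(3)] by blast
    have "cr (f (affmap h w PP)) (f (affmap h w QQ)) (f (affmap h w SS)) = det A * (det h * cr PP QQ SS)"
      by (simp add: f_def cr_affmap)
    moreover have "cr PP QQ SS = 1" by (simp add: cr_def)
    moreover have "cr (f (affmap h w PP)) (f (affmap h w QQ)) (f (affmap h w SS))
      = l\<^sup>2 * cr (affmap h w q1) (affmap h w q2) (affmap h w q3)"
      unfolding q1(2) q2(2) q3(2) by (simp add: cr_def power2_eq_square algebra_simps)
    ultimately have "det h * det A = det h * (l\<^sup>2 * cr q1 q2 q3)" by (auto simp: cr_affmap)
    then have "det A = l\<^sup>2 * cr q1 q2 q3" using h by (simp add: invertible_det_nz)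
    then have "\<bar>det A\<bar> = l\<^sup>2 * \<bar>cr q1 q2 q3\<bar>" by (simp add: abs_mult)
    also have "\<dots> \<le> l\<^sup>2 * (1 + r)" using bnd_abs[OF bnd_cut q1(1) q2(1) q3(1)] by (intro mult_left_mono) auto
    finally have "(1 + r)\<^sup>2 - r\<^sup>2 \<le> l\<^sup>2 * (1 + r)" using 1 area_cut by linarith
    then have 2: "1 + 2 * r \<le> l\<^sup>2 * (1 + r)" by (simp add: power2_eq_square algebra_simps)
    \<comment> \<open>For 0 < r <= 1/2, the square of 1 + r / 4 times 1 + r stays below 1 + 2
      r.\<close>
    show "1 + r / 4 \<le> l"
    proof (rule ccontr)
      assume "\<not> 1 + r / 4 \<le> l"
      then have "l\<^sup>2 \<le> (1 + r / 4)\<^sup>2" using l1 by (intro power_mono) auto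
      then have "l\<^sup>2 * (1 + r) \<le> (1 + r / 4)\<^sup>2 * (1 + r)" using r by (intro mult_right_mono) auto
      moreover have "(1 + r / 4)\<^sup>2 * (1 + r) = 1 + 3/2 * r + 9/16 * (r * r) + (r * r) * r / 16"
        by (simp add: power2_eq_square field_simps)
      moreover have "r * r \<le> r * (1/2)" using r by (intro mult_left_mono) auto
      moreover have "(r * r) * r \<le> (r * r) * (1/2)" using r by (intro mult_left_mono) auto
      ultimately show False using 2 r by linarith
    qed
  qed
  then show "1 + r / 4 \<le> banach_mazur ?K ?T" unfolding banach_mazur_eq using mem by (intro cInf_greatest) auto
qed

end

text \<open>The cut triangle loses at most 3 r^2, while \<delta> lies between r / 4 and r. The
  supposed inequality would give \<open>c * \<tau> \<le> 48 * r powr (2 - q)\<close>, which fails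
  for small r.\<close>

lemma Phi_optimal:
  assumes T: "2 simplex T" and p: "p \<ge> 1" and q: "q < 2" and c: "c > 0" and \<epsilon>: "\<epsilon> > 0"
    and le: "\<And>K \<delta>. planar_convex_body K \<Longrightarrow> 0 < \<delta> \<Longrightarrow> \<delta> < \<epsilon> \<Longrightarrow> banach_mazur K T = 1 + \<delta> \<Longrightarrow>
      Phi m p K \<le> (1 - c * \<delta> powr q) * Phi m p T"
  shows False
proof -
  obtain h w where h: "invertible h" and Tw: "T = affmap h w ` T0" by (rule simplex_affine_T0[OF T])
  define \<tau> where "\<tau> = Phi m p T0"
  have \<tau>T: "Phi m p T = \<tau>" unfolding \<tau>_def by (rule Phi_simplex[OF T p])
  have cut: "\<exists>\<delta>. r / 4 \<le> \<delta> \<and> \<delta> \<le> r \<and> banach_mazur (affmap h w ` cut_triangle r) T = 1 + \<delta>"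
    if "0 < r" "r \<le> 1/2" for r
    using banach_mazur_cut[OF that h, of w] unfolding Tw
    by (intro exI[of _ "banach_mazur (affmap h w ` cut_triangle r) (affmap h w ` T0) - 1"]) simp
  have bc: "planar_convex_body (affmap h w ` cut_triangle r)" if "0 < r" "r \<le> 1/2" for r
    by (rule body_affmap[OF h body_cut[OF that]])
  \<comment> \<open>Positivity follows from stability itself: some body has a positive deficit, and
    its functional is not negative.\<close>
  have \<tau>: "\<tau> > 0"
  proof -
    obtain c where c: "c > 0" and st: "\<And>K \<delta>. planar_convex_body K \<Longrightarrow> \<delta> > 0 \<Longrightarrow> banach_mazur K T = 1 + \<delta> \<Longrightarrow>
      Phi m p K \<le> Phi m p T0 - c powr p * \<delta>\<^sup>2" using Phi_stability T p by meson
    obtain \<delta> where \<delta>: "1/2 / 4 \<le> \<delta>" "banach_mazur (affmap h w ` cut_triangle (1/2)) T = 1 + \<delta>" using cut[of "1/2"] by auto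
    have "0 \<le> Phi m p (affmap h w ` cut_triangle (1/2))" by (rule Phi_bounds(1)[OF bc p]) auto
    also have "\<dots> \<le> Phi m p T0 - c powr p * \<delta>\<^sup>2" by (rule st[OF bc _ \<delta>(2)]) (use \<delta>(1) in auto)
    finally have "c powr p * \<delta>\<^sup>2 \<le> \<tau>" by (simp add: \<tau>_def)
    moreover have "c powr p * \<delta>\<^sup>2 > 0" using c \<delta>(1) by simp
    ultimately show ?thesis by linarith
  qed
  define r where "r = min (min (\<epsilon> / 2) (1/2)) ((c * \<tau> / 96) powr (1 / (2 - q)))"
  have r: "0 < r" "r \<le> 1/2" "r < \<epsilon>" using \<epsilon> c \<tau> by (auto simp: r_def)
  obtain \<delta> where \<delta>: "r / 4 \<le> \<delta>" "\<delta> \<le> r" "banach_mazur (affmap h w ` cut_triangle r) T = 1 + \<delta>"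
    using cut[OF r(1,2)] by blast
  have \<delta>0: "\<delta> > 0" using \<delta>(1) r(1) by linarith
  have "\<tau> - 3 * r\<^sup>2 \<le> Phi m p (cut_triangle r)" unfolding \<tau>_def by (rule Phi_cut[OF r(1,2) p])
  also have "\<dots> = Phi m p (affmap h w ` cut_triangle r)" by (rule Phi_affmap[OF h body_cut[OF r(1,2)] p, symmetric])
  also have "\<dots> \<le> (1 - c * \<delta> powr q) * Phi m p T" using \<delta>(2) r(3) by (intro le[OF bc[OF r(1,2)] \<delta>0 _ \<delta>(3)]) simp
  finally have 1: "c * \<tau> * \<delta> powr q \<le> 3 * r\<^sup>2" unfolding \<tau>T by (simp add: algebra_simps)
  have "r\<^sup>2 \<le> (4 * \<delta>)\<^sup>2" using \<delta>(1) r(1) by (intro power_mono) auto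
  also have "\<dots> = 16 * \<delta> powr 2" using \<delta>0 by (simp add: power_mult_distrib powr_numeral)
  also have "\<delta> powr 2 = \<delta> powr (2 - q) * \<delta> powr q" by (simp add: powr_add[symmetric])
  finally have "c * \<tau> * \<delta> powr q \<le> (48 * \<delta> powr (2 - q)) * \<delta> powr q" using 1 by simp
  then have "c * \<tau> \<le> 48 * \<delta> powr (2 - q)" using \<delta>0 by simp
  also have "\<dots> \<le> 48 * r powr (2 - q)" using \<delta>0 \<delta>(2) q by (intro mult_left_mono powr_mono2) auto
  also have "r powr (2 - q) \<le> ((c * \<tau> / 96) powr (1 / (2 - q))) powr (2 - q)"
    using r(1) q by (intro powr_mono2) (auto simp: r_def)
  also have "\<dots> = c * \<tau> / 96" using q c \<tau> by (simp add: powr_powr)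
  finally show False using c \<tau> by simp
qed

theorem theorem5:
  "(\<exists>c::real. c > 0 \<and>
      (\<forall>(T::(real^2) set) (K::(real^2) set) (\<delta>::real) (p::real).
         2 simplex T \<longrightarrow> planar_convex_body K \<longrightarrow> \<delta> > 0 \<longrightarrow>
         banach_mazur K T = 1 + \<delta> \<longrightarrow> p \<ge> 1 \<longrightarrow>
           Estar p K \<le> (1 - c powr p * \<delta>\<^sup>2) * Estar p T \<and>
           E3 p K \<le> (1 - c powr p * \<delta>\<^sup>2) * E3 p T))
   \<and>
   (\<forall>(T::(real^2) set) (p::real) (q::real) (c'::real).
      2 simplex T \<longrightarrow> p \<ge> 1 \<longrightarrow> q < 2 \<longrightarrow> c' > 0 \<longrightarrow>
        \<not> (\<exists>\<epsilon>>0. \<forall>K \<delta>. planar_convex_body K \<longrightarrow> 0 < \<delta> \<longrightarrow> \<delta> < \<epsilon> \<longrightarrow>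
              banach_mazur K T = 1 + \<delta> \<longrightarrow>
                Estar p K \<le> (1 - c' * \<delta> powr q) * Estar p T) \<and>
        \<not> (\<exists>\<epsilon>>0. \<forall>K \<delta>. planar_convex_body K \<longrightarrow> 0 < \<delta> \<longrightarrow> \<delta> < \<epsilon> \<longrightarrow>
              banach_mazur K T = 1 + \<delta> \<longrightarrow>
                E3 p K \<le> (1 - c' * \<delta> powr q) * E3 p T))"
proof (intro conjI allI impI)
  obtain c where c: "c > 0" and st: "\<And>m T K \<delta> p. 2 simplex T \<Longrightarrow> planar_convex_body K \<Longrightarrow> \<delta> > 0 \<Longrightarrow> banach_mazur K T = 1 + \<delta> \<Longrightarrow> p \<ge> 1 \<Longrightarrow>
    Phi m p K \<le> Phi m p T0 - c powr p * \<delta>\<^sup>2" using Phi_stability by blast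
  have "Phi m p K \<le> (1 - c powr p * \<delta>\<^sup>2) * Phi m p T"
    if "2 simplex T" "planar_convex_body K" "\<delta> > 0" "banach_mazur K T = 1 + \<delta>" "p \<ge> 1" for m T K \<delta> p
  proof -
    \<comment> \<open>At the triangle \<open>Phi\<close> is at most 1, so the additive deficit
      implies the multiplicative one.\<close>
    have "c powr p * \<delta>\<^sup>2 * Phi m p T0 \<le> c powr p * \<delta>\<^sup>2 * 1"
      using Phi_bounds(2)[OF body_T0 that(5)] by (intro mult_left_mono) auto
    then show ?thesis using st[OF that, of m] unfolding Phi_simplex[OF that(1,5)] by (simp add: algebra_simps)
  qed
  from this[where m = True] this[where m = False]
  show "\<exists>c::real. c > 0 \<and>
      (\<forall>(T::(real^2) set) (K::(real^2) set) (\<delta>::real) (p::real).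
         2 simplex T \<longrightarrow> planar_convex_body K \<longrightarrow> \<delta> > 0 \<longrightarrow>
         banach_mazur K T = 1 + \<delta> \<longrightarrow> p \<ge> 1 \<longrightarrow>
           Estar p K \<le> (1 - c powr p * \<delta>\<^sup>2) * Estar p T \<and>
           E3 p K \<le> (1 - c powr p * \<delta>\<^sup>2) * E3 p T)"
    using c unfolding Phi_def by (intro exI[of _ c]) simp
next
  fix T :: "(real^2) set" and p q c' :: real
  assume a: "2 simplex T" "p \<ge> 1" "q < 2" "c' > 0"
  show "\<not> (\<exists>\<epsilon>>0. \<forall>K \<delta>. planar_convex_body K \<longrightarrow> 0 < \<delta> \<longrightarrow> \<delta> < \<epsilon> \<longrightarrow>
              banach_mazur K T = 1 + \<delta> \<longrightarrow> Estar p K \<le> (1 - c' * \<delta> powr q) * Estar p T)"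
    using Phi_optimal[OF a, of _ False] unfolding Phi_def by (auto simp only: if_False)
  show "\<not> (\<exists>\<epsilon>>0. \<forall>K \<delta>. planar_convex_body K \<longrightarrow> 0 < \<delta> \<longrightarrow> \<delta> < \<epsilon> \<longrightarrow>
              banach_mazur K T = 1 + \<delta> \<longrightarrow> E3 p K \<le> (1 - c' * \<delta> powr q) * E3 p T)"
    using Phi_optimal[OF a, of _ True] unfolding Phi_def by (auto simp only: if_True)
qed

end
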